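(* There exists a unique minimiser $\alpha_{\mathbb S}^\perp$ of $\mathcal L$ over $H_{\mathbb S}^\perp$. Moreover, writing $\alpha^\perp=a-\theta-\sum_{S\in\mathbb S}\alpha_S^\perp$ and $k_{\mathbb S}=\sum_{S\in\mathbb S}k_S$, for any (measurable) estimator sequence $(\theta_n)$ we have $$\sup_{I\subset\mathbb R,\ J\subset\mathbb R^{k_{\mathbb S}}}\ \liminf_{n\to\infty}\ \max_{t\in I,\ v_{\mathbb S}\in J}\ \mathbb E_{P_{n,t,v_{\mathbb S}}}\bigl[n\{\theta_n-\theta(f_{n^{-1/2}t\alpha^\perp})\}^2\bigr]\ \ge\ \inf_{\alpha_{\mathbb S}\in H_{\mathbb S}^\perp}\mathcal L(\alpha_{\mathbb S}),$$ where the supremum is taken over all finite subsets $I$ of $\mathbb R$ and finite subsets $J$ of $\mathbb R^{k_{\mathbb S}}$.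
   Context: Setting. Let $d\ge 2$, $[d]=\{1,\dots,d\}$, let $f$ be a probability density on $\mathbb R^d$ and $X\sim f$. For $x\in\mathbb R^d$, $S\subseteq[d]$ write $x_S=(x_j:j\in S)\in\mathbb R^S$ and $f_S$ for the density of $X_S$. Let $\mathbb S\subseteq 2^{[d]}\setminus\{[d]\}$. For each $S\in\mathbb S$ let $k_S\in\mathbb N$, let $\Psi_S=(\psi_{S,1},\dots,\psi_{S,k_S}):\mathbb R^S\to\mathbb R^{k_S}$ be a known bounded measurable function, let $w_S\in\mathbb R^{k_S}$ be an (unknown) parameter, $r_S(x_S)=\exp(w_S^T\Psi_S(x_S))$ and $\bar r_S=r_S/\int r_Sf_S$. It is assumed that for no $S\in\mathbb S$ and no nonzero $u_S\in\mathbb R^{k_S}$ is $u_S^T\Psi_S(\cdot)$ a constant function. Let $a:\mathbb R^d\to\mathbb R$ be a known measurable function with $\int a^2f<\infty$, $\theta(g)=\int ag$ for a density $g$, and $\theta=\theta(f)$. Data. For sample sizes $n$ and $n_S\ge 1$ ($S\in\mathbb S$, with $n_S/n\to\lambda_S\in(0,\infty)$ as $n\to\infty$) we observe mutually independent samples: $X_1,\dots,X_n$ i.i.d. with density $f$; and, for each $S\in\mathbb S$, $X_{S,1},\dots,X_{S,n_S}$ for which only the coordinates in $S$ are observed, with $(X_{S,i})_S$ i.i.d. with density $\bar r_Sf_S$. An estimator is a measurable function of the observed data. Objective. $L^2=\{\alpha:\mathbb R^d\to\mathbb R:\int\alpha^2f<\infty\}$, $H_S=\{\alpha_S\in L^2:\alpha_S(x)\equiv\alpha_S(x_S),\int\alpha_Sf=0\}$,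 $H_S^\perp=\{\alpha_S\in H_S:\mathbb E\{\alpha_S(X_S)\Psi_S(X_S)\}=0\}$, $H_{\mathbb S}^\perp=\prod_{S\in\mathbb S}H_S^\perp$, and $$\mathcal L(\alpha_{\mathbb S})=\mathrm{Var}\Bigl(a(X)-\sum_{S\in\mathbb S}\alpha_S(X_S)\Bigr)+\sum_{S\in\mathbb S}\mathbb E\Bigl[\frac{\alpha_S(X_S)^2}{\lambda_S\bar r_S(X_S)}\Bigr].$$ Perturbations. Let $k(u)=1/2+(1+e^{-4u})^{-1}$; for $h\in L^2$, $f_h$ is the probability density with $f_h(x)\propto k(h(x))f(x)$. For $t\in\mathbb R$ and $v_{\mathbb S}=(v_S:S\in\mathbb S)$ with $v_S\in\mathbb R^{k_S}$, $P_{n,t,v_{\mathbb S}}$ is the distribution of the data when the target density $f$ is replaced by $g=f_{n^{-1/2}t\alpha^\perp}$ and each $r_S$ is replaced by $\exp((w_S+n^{-1/2}v_S)^T\Psi_S(x_S))$ (so that the data on $S$ have density proportional to $\exp((w_S+n^{-1/2}v_S)^T\Psi_S)\,g_S$). *)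

theory Defs
  imports "HOL-Probability.Probability"
begin

section \<open>Coordinate spaces, densities and marginals\<close>

text \<open>\<open>\<real>\<^sup>S\<close>, for a set \<open>S\<close> of coordinates, consists of the extensional functions on \<open>S\<close>; the
  projection \<open>x \<mapsto> x\<^sub>S\<close> is \<open>restrict x S\<close>. The ambient space \<open>\<real>\<^sup>d\<close> is \<open>Rspace {1..d}\<close>.\<close>

definition Rspace :: "nat set \<Rightarrow> (nat \<Rightarrow> real) measure" where
  "Rspace S = Pi\<^sub>M S (\<lambda>_. lborel)"

definition prob_density :: "'x measure \<Rightarrow> ('x \<Rightarrow> real) \<Rightarrow> bool" where
  "prob_density M g \<longleftrightarrow>
     g \<in> borel_measurable M \<and> (\<forall>x\<in>space M. 0 \<le> g x) \<and> (\<integral>\<^sup>+ x. ennreal (g x) \<partial>M) = 1"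

definition law :: "nat set \<Rightarrow> ((nat \<Rightarrow> real) \<Rightarrow> real) \<Rightarrow> (nat \<Rightarrow> real) measure" where
  "law S g = density (Rspace S) (\<lambda>x. ennreal (g x))"

text \<open>The density of \<open>X\<^sub>S\<close> when \<open>X\<close> has density \<open>g\<close> on \<open>\<real>\<^sup>d\<close>; lemma \<open>distr_law_marginal\<close> below
  confirms this. The Bochner integral is 0 on the null set where the integral over the
  remaining coordinates diverges.\<close>

definition marginal :: "nat \<Rightarrow> ((nat \<Rightarrow> real) \<Rightarrow> real) \<Rightarrow> nat set \<Rightarrow> (nat \<Rightarrow> real) \<Rightarrow> real" where
  "marginal d g S x =
     (\<integral> y. g (merge S ({1..d} - S) (x, y)) \<partial>Rspace ({1..d} - S))"

section \<open>Exponential tilts\<close>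

text \<open>Vectors in \<open>\<real>\<^sup>k\<close>, and families \<open>(v\<^sub>S : S \<in> SS)\<close> with \<open>v\<^sub>S \<in> \<real>\<^bsup>k\<^sub>S\<^esup>\<close>. The latter set is the
  parameter space \<open>\<real>\<^bsup>k\<^sub>1 + k\<^sub>2 + \<dots>\<^esup>\<close>. A map \<open>\<Psi>\<^sub>S\<close> into \<open>\<real>\<^bsup>k\<^sub>S\<^esup>\<close> is given by its components
  \<open>Psi S j\<close> for \<open>j \<in> {1..k S}\<close>.\<close>

definition vecs :: "nat \<Rightarrow> (nat \<Rightarrow> real) set" where
  "vecs k = ({1..k} \<rightarrow>\<^sub>E UNIV)"

definition vec_families :: "nat set set \<Rightarrow> (nat set \<Rightarrow> nat) \<Rightarrow> (nat set \<Rightarrow> nat \<Rightarrow> real) set" where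
  "vec_families SS k = (\<Pi>\<^sub>E S\<in>SS. vecs (k S))"

definition lin_comb ::
  "nat \<Rightarrow> (nat \<Rightarrow> real) \<Rightarrow> (nat \<Rightarrow> (nat \<Rightarrow> real) \<Rightarrow> real) \<Rightarrow> (nat \<Rightarrow> real) \<Rightarrow> real" where
  "lin_comb k u psi x = (\<Sum>j=1..k. u j * psi j x)"

definition tilt ::
  "nat \<Rightarrow> (nat \<Rightarrow> real) \<Rightarrow> (nat \<Rightarrow> (nat \<Rightarrow> real) \<Rightarrow> real) \<Rightarrow> (nat \<Rightarrow> real) \<Rightarrow> real" where
  "tilt k u psi x = exp (lin_comb k u psi x)"

text \<open>\<open>r\<^sub>S / \<integral> r\<^sub>S g\<^sub>S\<close> for a density \<open>g\<close> on \<open>\<real>\<^sup>d\<close>.\<close>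

definition normalised_tilt ::
  "nat \<Rightarrow> ((nat \<Rightarrow> real) \<Rightarrow> real) \<Rightarrow> nat set \<Rightarrow> nat \<Rightarrow> (nat \<Rightarrow> real)
     \<Rightarrow> (nat \<Rightarrow> (nat \<Rightarrow> real) \<Rightarrow> real) \<Rightarrow> (nat \<Rightarrow> real) \<Rightarrow> real" where
  "normalised_tilt d g S k u psi x =
     tilt k u psi x / (\<integral> y. tilt k u psi y * marginal d g S y \<partial>Rspace S)"

section \<open>The data\<close>

text \<open>An observation is a pair: the complete sample \<open>X\<^sub>1, \<dots>, X\<^sub>n\<close> in \<open>\<real>\<^sup>d\<close>, and for each
  \<open>S \<in> SS\<close> the incomplete sample \<open>X\<^bsub>S,1\<^esub>, \<dots>, X\<^bsub>S,m S\<^esub>\<close> in \<open>\<real>\<^sup>S\<close>.\<close>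

type_synonym obs = "(nat \<Rightarrow> nat \<Rightarrow> real) \<times> (nat set \<Rightarrow> nat \<Rightarrow> nat \<Rightarrow> real)"

definition data_space :: "nat \<Rightarrow> nat set set \<Rightarrow> nat \<Rightarrow> (nat set \<Rightarrow> nat) \<Rightarrow> obs measure" where
  "data_space d SS n m =
     Pi\<^sub>M {1..n} (\<lambda>_. Rspace {1..d}) \<Otimes>\<^sub>M Pi\<^sub>M SS (\<lambda>S. Pi\<^sub>M {1..m S} (\<lambda>_. Rspace S))"

text \<open>The joint distribution of the independent samples when the target density is \<open>g\<close> and the
  tilt parameters are \<open>u\<close>.\<close>

definition data_law ::
  "nat \<Rightarrow> nat set set \<Rightarrow> (nat set \<Rightarrow> nat) \<Rightarrow> (nat set \<Rightarrow> nat \<Rightarrow> (nat \<Rightarrow> real) \<Rightarrow> real)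
     \<Rightarrow> nat \<Rightarrow> (nat set \<Rightarrow> nat) \<Rightarrow> ((nat \<Rightarrow> real) \<Rightarrow> real) \<Rightarrow> (nat set \<Rightarrow> nat \<Rightarrow> real) \<Rightarrow> obs measure" where
  "data_law d SS k Psi n m g u =
     Pi\<^sub>M {1..n} (\<lambda>_. law {1..d} g) \<Otimes>\<^sub>M
     Pi\<^sub>M SS (\<lambda>S. Pi\<^sub>M {1..m S}
       (\<lambda>_. law S (\<lambda>x. normalised_tilt d g S (k S) (u S) (Psi S) x * marginal d g S x)))"

section \<open>The variational problem\<close>

definition L2 :: "nat \<Rightarrow> ((nat \<Rightarrow> real) \<Rightarrow> real) \<Rightarrow> ((nat \<Rightarrow> real) \<Rightarrow> real) set" where
  "L2 d f = {\<alpha> \<in> borel_measurable (Rspace {1..d}).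
               integrable (Rspace {1..d}) (\<lambda>x. (\<alpha> x)\<^sup>2 * f x)}"

text \<open>Elements of \<open>H\<^sub>S\<close> are functions on \<open>\<real>\<^sup>d\<close> that depend on the coordinates in \<open>S\<close> only, so
  that \<open>\<alpha>\<^sub>S(X\<^sub>S)\<close> is \<open>\<alpha>\<^sub>S(X)\<close>.\<close>

definition H :: "nat \<Rightarrow> ((nat \<Rightarrow> real) \<Rightarrow> real) \<Rightarrow> nat set \<Rightarrow> ((nat \<Rightarrow> real) \<Rightarrow> real) set" where
  "H d f S = {\<alpha> \<in> L2 d f.
      (\<forall>x\<in>space (Rspace {1..d}). \<forall>y\<in>space (Rspace {1..d}).
          restrict x S = restrict y S \<longrightarrow> \<alpha> x = \<alpha> y) \<and>
      (\<integral> x. \<alpha> x * f x \<partial>Rspace {1..d}) = 0}"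

definition H_perp ::
  "nat \<Rightarrow> ((nat \<Rightarrow> real) \<Rightarrow> real) \<Rightarrow> nat \<Rightarrow> (nat \<Rightarrow> (nat \<Rightarrow> real) \<Rightarrow> real) \<Rightarrow> nat set
     \<Rightarrow> ((nat \<Rightarrow> real) \<Rightarrow> real) set" where
  "H_perp d f k psi S = {\<alpha> \<in> H d f S.
      \<forall>j\<in>{1..k}. prob_space.expectation (law {1..d} f) (\<lambda>x. \<alpha> x * psi j (restrict x S)) = 0}"

definition H_perp_prod ::
  "nat \<Rightarrow> ((nat \<Rightarrow> real) \<Rightarrow> real) \<Rightarrow> nat set set \<Rightarrow> (nat set \<Rightarrow> nat)
     \<Rightarrow> (nat set \<Rightarrow> nat \<Rightarrow> (nat \<Rightarrow> real) \<Rightarrow> real) \<Rightarrow> (nat set \<Rightarrow> (nat \<Rightarrow> real) \<Rightarrow> real) set" where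
  "H_perp_prod d f SS k Psi = (\<Pi>\<^sub>E S\<in>SS. H_perp d f (k S) (Psi S) S)"

definition objective ::
  "nat \<Rightarrow> ((nat \<Rightarrow> real) \<Rightarrow> real) \<Rightarrow> nat set set \<Rightarrow> (nat set \<Rightarrow> nat)
     \<Rightarrow> (nat set \<Rightarrow> nat \<Rightarrow> (nat \<Rightarrow> real) \<Rightarrow> real) \<Rightarrow> (nat set \<Rightarrow> nat \<Rightarrow> real) \<Rightarrow> (nat set \<Rightarrow> real)
     \<Rightarrow> ((nat \<Rightarrow> real) \<Rightarrow> real) \<Rightarrow> (nat set \<Rightarrow> (nat \<Rightarrow> real) \<Rightarrow> real) \<Rightarrow> real" where
  "objective d f SS k Psi w lam a \<alpha> =
     prob_space.variance (law {1..d} f) (\<lambda>x. a x - (\<Sum>S\<in>SS. \<alpha> S x)) +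
     (\<Sum>S\<in>SS. prob_space.expectation (law {1..d} f)
        (\<lambda>x. (\<alpha> S x)\<^sup>2 /
              (lam S * normalised_tilt d f S (k S) (w S) (Psi S) (restrict x S))))"

definition minimiser ::
  "nat \<Rightarrow> ((nat \<Rightarrow> real) \<Rightarrow> real) \<Rightarrow> nat set set \<Rightarrow> (nat set \<Rightarrow> nat)
     \<Rightarrow> (nat set \<Rightarrow> nat \<Rightarrow> (nat \<Rightarrow> real) \<Rightarrow> real) \<Rightarrow> (nat set \<Rightarrow> nat \<Rightarrow> real) \<Rightarrow> (nat set \<Rightarrow> real)
     \<Rightarrow> ((nat \<Rightarrow> real) \<Rightarrow> real) \<Rightarrow> (nat set \<Rightarrow> (nat \<Rightarrow> real) \<Rightarrow> real) \<Rightarrow> bool" where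
  "minimiser d f SS k Psi w lam a =
     is_arg_min (objective d f SS k Psi w lam a) (\<lambda>\<alpha>. \<alpha> \<in> H_perp_prod d f SS k Psi)"

section \<open>The functional and the perturbed models\<close>

definition theta :: "nat \<Rightarrow> ((nat \<Rightarrow> real) \<Rightarrow> real) \<Rightarrow> ((nat \<Rightarrow> real) \<Rightarrow> real) \<Rightarrow> real" where
  "theta d a g = (\<integral> x. a x * g x \<partial>Rspace {1..d})"

definition kfun :: "real \<Rightarrow> real" where
  "kfun u = 1 / 2 + 1 / (1 + exp (- 4 * u))"

definition perturbed ::
  "nat \<Rightarrow> ((nat \<Rightarrow> real) \<Rightarrow> real) \<Rightarrow> ((nat \<Rightarrow> real) \<Rightarrow> real) \<Rightarrow> (nat \<Rightarrow> real) \<Rightarrow> real" where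
  "perturbed d f h x = kfun (h x) * f x / (\<integral> y. kfun (h y) * f y \<partial>Rspace {1..d})"

definition influence ::
  "nat \<Rightarrow> ((nat \<Rightarrow> real) \<Rightarrow> real) \<Rightarrow> nat set set \<Rightarrow> ((nat \<Rightarrow> real) \<Rightarrow> real)
     \<Rightarrow> (nat set \<Rightarrow> (nat \<Rightarrow> real) \<Rightarrow> real) \<Rightarrow> (nat \<Rightarrow> real) \<Rightarrow> real" where
  "influence d f SS a \<alpha> x = a x - theta d a f - (\<Sum>S\<in>SS. \<alpha> S x)"

text \<open>The density \<open>f\<^sub>h\<close> with \<open>h = n\<^bsup>-1/2\<^esup> t \<alpha>\<^sup>\<bottom>\<close>, where \<open>\<phi> = \<alpha>\<^sup>\<bottom>\<close>.\<close>

definition local_density ::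
  "nat \<Rightarrow> ((nat \<Rightarrow> real) \<Rightarrow> real) \<Rightarrow> ((nat \<Rightarrow> real) \<Rightarrow> real) \<Rightarrow> nat \<Rightarrow> real
     \<Rightarrow> (nat \<Rightarrow> real) \<Rightarrow> real" where
  "local_density d f \<phi> n t = perturbed d f (\<lambda>x. t * \<phi> x / sqrt (real n))"

definition local_law ::
  "nat \<Rightarrow> ((nat \<Rightarrow> real) \<Rightarrow> real) \<Rightarrow> nat set set \<Rightarrow> (nat set \<Rightarrow> nat)
     \<Rightarrow> (nat set \<Rightarrow> nat \<Rightarrow> (nat \<Rightarrow> real) \<Rightarrow> real) \<Rightarrow> (nat set \<Rightarrow> nat \<Rightarrow> real)
     \<Rightarrow> (nat set \<Rightarrow> nat \<Rightarrow> nat) \<Rightarrow> ((nat \<Rightarrow> real) \<Rightarrow> real)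
     \<Rightarrow> nat \<Rightarrow> real \<Rightarrow> (nat set \<Rightarrow> nat \<Rightarrow> real) \<Rightarrow> obs measure" where
  "local_law d f SS k Psi w N \<phi> n t v =
     data_law d SS k Psi n (\<lambda>S. N S n) (local_density d f \<phi> n t)
       (\<lambda>S j. w S j + v S j / sqrt (real n))"

text \<open>The scaled mean squared error \<open>\<E> [n {\<theta>\<^sub>n - \<theta>(f\<^sub>h)}\<^sup>2]\<close>; it may be infinite.\<close>

definition local_risk ::
  "nat \<Rightarrow> ((nat \<Rightarrow> real) \<Rightarrow> real) \<Rightarrow> nat set set \<Rightarrow> (nat set \<Rightarrow> nat)
     \<Rightarrow> (nat set \<Rightarrow> nat \<Rightarrow> (nat \<Rightarrow> real) \<Rightarrow> real) \<Rightarrow> (nat set \<Rightarrow> nat \<Rightarrow> real)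
     \<Rightarrow> (nat set \<Rightarrow> nat \<Rightarrow> nat) \<Rightarrow> ((nat \<Rightarrow> real) \<Rightarrow> real) \<Rightarrow> ((nat \<Rightarrow> real) \<Rightarrow> real)
     \<Rightarrow> (nat \<Rightarrow> obs \<Rightarrow> real) \<Rightarrow> nat \<Rightarrow> real \<Rightarrow> (nat set \<Rightarrow> nat \<Rightarrow> real) \<Rightarrow> ennreal" where
  "local_risk d f SS k Psi w N a \<phi> est n t v =
     (\<integral>\<^sup>+ z. ennreal (real n * (est n z - theta d a (local_density d f \<phi> n t))\<^sup>2)
        \<partial>local_law d f SS k Psi w N \<phi> n t v)"

section \<open>The marginal density is the density of the projection\<close>

lemma distr_law_marginal:
  assumes f: "prob_density (Rspace {1..d}) f" and S: "S \<subseteq> {1..d}"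
  shows "distr (law {1..d} f) (Rspace S) (\<lambda>x. restrict x S) = law S (marginal d f S)"
proof -
  interpret product_sigma_finite "\<lambda>_::nat. lborel :: real measure"
    by standard
  define T where "T = {1..d} - S"
  have ST: "S \<inter> T = {}" "S \<union> T = {1..d}" and fin: "finite S" "finite T"
    using S finite_subset[OF S] by (auto simp: T_def)
  interpret S: sigma_finite_measure "Rspace S"
    unfolding Rspace_def by (rule sigma_finite[OF fin(1)])
  interpret T: sigma_finite_measure "Rspace T"
    unfolding Rspace_def by (rule sigma_finite[OF fin(2)])
  have fm[measurable]: "f \<in> borel_measurable (Rspace {1..d})"
    and f0: "\<And>x. x \<in> space (Rspace {1..d}) \<Longrightarrow> 0 \<le> f x"
    and f1: "(\<integral>\<^sup>+ x. ennreal (f x) \<partial>Rspace {1..d}) = 1"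
    using f by (auto simp: prob_density_def)
  have mm[measurable]: "merge S T \<in> measurable (Rspace S \<Otimes>\<^sub>M Rspace T) (Rspace {1..d})"
    using measurable_merge[of S T "\<lambda>_. lborel"] by (simp add: Rspace_def ST)
  have rm[measurable]: "(\<lambda>x. restrict x S) \<in> measurable (Rspace {1..d}) (Rspace S)"
    unfolding Rspace_def by (rule measurable_restrict_subset[OF S])
  have fold: "(\<integral>\<^sup>+ x. g x \<partial>Rspace {1..d}) = (\<integral>\<^sup>+ x. \<integral>\<^sup>+ y. g (merge S T (x, y)) \<partial>Rspace T \<partial>Rspace S)"
    if "g \<in> borel_measurable (Rspace {1..d})" for g
    using product_nn_integral_fold[OF ST(1) fin, of g] that by (simp add: Rspace_def ST)
  have sp: "merge S T (x, y) \<in> space (Rspace {1..d})"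
    if "x \<in> space (Rspace S)" "y \<in> space (Rspace T)" for x y
    using measurable_space[OF mm, of "(x, y)"] that by (simp add: space_pair_measure)
  have fmm[measurable]: "(\<lambda>z. f (merge S T z)) \<in> borel_measurable (Rspace S \<Otimes>\<^sub>M Rspace T)"
    using measurable_compose[OF mm fm] .
  have pm: "(\<lambda>x. \<integral>\<^sup>+ y. ennreal (f (merge S T (x, y))) \<partial>Rspace T) \<in> borel_measurable (Rspace S)"
    by (rule T.borel_measurable_nn_integral) (simp add: case_prod_unfold)
  have "(\<integral>\<^sup>+ x. \<integral>\<^sup>+ y. ennreal (f (merge S T (x, y))) \<partial>Rspace T \<partial>Rspace S) = 1"
    using fold[OF measurable_compose[OF fm measurable_ennreal]] f1 by simp
  then have fin_ae: "AE x in Rspace S. (\<integral>\<^sup>+ y. ennreal (f (merge S T (x, y))) \<partial>Rspace T) \<noteq> \<infinity>"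
    by (intro nn_integral_noteq_infinite[OF pm]) simp
  have marg: "AE x in Rspace S.
      (\<integral>\<^sup>+ y. ennreal (f (merge S T (x, y))) \<partial>Rspace T) = ennreal (marginal d f S x)"
    using fin_ae AE_space
  proof eventually_elim
    case (elim x)
    have nn: "AE y in Rspace T. 0 \<le> f (merge S T (x, y))"
      using f0 sp elim(2) by (intro AE_I2) auto
    have "(\<lambda>y. f (merge S T (x, y))) \<in> borel_measurable (Rspace T)"
      using elim(2) by measurable
    then have "integrable (Rspace T) (\<lambda>y. f (merge S T (x, y)))"
      using elim(1) nn by (intro integrableI_nonneg) (auto simp: top.not_eq_extremum)
    from nn_integral_eq_integral[OF this nn] show ?case
      by (simp add: marginal_def T_def)
  qed
  have margm: "marginal d f S \<in> borel_measurable (Rspace S)"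
    unfolding marginal_def[abs_def] T_def[symmetric] by measurable
  show ?thesis
  proof (rule measure_eqI)
    show "sets (distr (law {1..d} f) (Rspace S) (\<lambda>x. restrict x S)) = sets (law S (marginal d f S))"
      by (simp add: law_def)
  next
    fix A assume "A \<in> sets (distr (law {1..d} f) (Rspace S) (\<lambda>x. restrict x S))"
    then have A[measurable]: "A \<in> sets (Rspace S)" by simp
    let ?B = "(\<lambda>x. restrict x S) -` A \<inter> space (Rspace {1..d})"
    have B[measurable]: "?B \<in> sets (Rspace {1..d})"
      using measurable_sets[OF rm A] .
    have ind: "indicator ?B (merge S T (x, y)) = (indicator A x :: ennreal)"
      if "x \<in> space (Rspace S)" "y \<in> space (Rspace T)" for x y
    proof -
      have "restrict x S = x" using that(1) by (auto simp: Rspace_def space_PiM PiE_restrict)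
      then show ?thesis using sp[OF that] ST(1) by (simp add: indicator_def)
    qed
    have "emeasure (distr (law {1..d} f) (Rspace S) (\<lambda>x. restrict x S)) A
        = (\<integral>\<^sup>+ x. ennreal (f x) * indicator ?B x \<partial>Rspace {1..d})"
      using rm by (subst emeasure_distr)
        (simp_all add: law_def emeasure_density[OF measurable_compose[OF fm measurable_ennreal] B]
           del: One_nat_def)
    also have "\<dots> = (\<integral>\<^sup>+ x. \<integral>\<^sup>+ y. ennreal (f (merge S T (x, y))) * indicator ?B (merge S T (x, y))
        \<partial>Rspace T \<partial>Rspace S)"
      by (rule fold) measurable
    also have "\<dots> = (\<integral>\<^sup>+ x. \<integral>\<^sup>+ y. ennreal (f (merge S T (x, y))) * indicator A x \<partial>Rspace T \<partial>Rspace S)"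
      by (intro nn_integral_cong) (simp only: ind)
    also have "\<dots> = (\<integral>\<^sup>+ x. (\<integral>\<^sup>+ y. ennreal (f (merge S T (x, y))) \<partial>Rspace T) * indicator A x \<partial>Rspace S)"
      by (intro nn_integral_cong nn_integral_multc) measurable
    also have "\<dots> = (\<integral>\<^sup>+ x. ennreal (marginal d f S x) * indicator A x \<partial>Rspace S)"
      using marg by (intro nn_integral_cong_AE) auto
    also have "\<dots> = emeasure (law S (marginal d f S)) A"
      using margm by (simp add: law_def emeasure_density)
    finally show "emeasure (distr (law {1..d} f) (Rspace S) (\<lambda>x. restrict x S)) A
        = emeasure (law S (marginal d f S)) A" .
  qed
qed

end

theory Submission
  imports Defs
begin

text \<open>
  The lower bound explores the model along one path. At amplitude \<open>t\<close> the density moves by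
  \<open>t / sqrt n\<close> in the direction \<open>\<phi> = a - \<theta> - \<Sum>\<^sub>S \<alpha>\<^sub>S\<close>, with \<open>\<alpha>\<close> the minimiser, and each tilt
  parameter moves by \<open>t / sqrt n\<close> in a direction \<open>v\<^sub>S\<close>. The score of a complete observation is
  \<open>\<phi>(X)\<close>, that of an incomplete one is \<open>E(\<phi>(X) | X\<^sub>S) + v\<^sub>S\<^sup>T \<Psi>\<^sub>S(X\<^sub>S)\<close>. Stationarity of the
  minimiser says that \<open>E(\<phi>(X) | X\<^sub>S) - \<alpha>\<^sub>S / (\<lambda>\<^sub>S r\<^sub>S)\<close>, with \<open>r\<^sub>S\<close> the normalised tilt, is
  orthogonal to \<open>H\<^sub>S\<^sup>\<bottom>\<close>, and the orthogonal complement of \<open>H\<^sub>S\<^sup>\<bottom>\<close> consists of the functions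
  \<open>c + u\<^sup>T \<Psi>\<^sub>S\<close> (\<open>orthogonal_complement_H_perp\<close>). For \<open>v\<^sub>S = -u\<close> the score of an incomplete
  observation is therefore \<open>\<alpha>\<^sub>S / (\<lambda>\<^sub>S r\<^sub>S)\<close> up to a constant (\<open>least_favourable_direction\<close>). With
  this choice the Fisher information of the path (\<open>information\<close>) and the speed of the functional
  along it (\<open>derivative\<close>) are both equal to the minimal value \<open>L\<close> of the objective, so that the
  information bound, squared speed over information, is \<open>L\<close>.

  The information bound itself is proved on a finite grid of amplitudes, without asymptotic
  normality of the likelihood and without a prior. The second moment of the likelihood ratio
  between neighbouring grid points multiplies over independent observations (\<open>chi2_le_pair\<close>,
  \<open>chi2_le_PiM\<close>), and a one-observation expansion (\<open>local_chi2\<close>, \<open>X_chi2\<close>, \<open>S_chi2\<close>) shows that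
  for grid width \<open>\<delta>\<close> it is at most a quantity that converges to \<open>exp (\<delta>\<^sup>2 L)\<close> (\<open>data_chi2\<close>). By
  the Cauchy-Schwarz inequality (\<open>mean_diff_le\<close>) the mean of an estimator with risk at most \<open>M\<close>
  moves by at most about \<open>\<delta> sqrt (M L)\<close> between neighbours, while the target moves by \<open>\<delta> L\<close>. If
  \<open>M < L\<close>, the bias decreases by a fixed amount at every step, although it never exceeds \<open>sqrt M\<close>
  in absolute value; this is impossible on a long enough grid (\<open>bias_walk\<close>). Hence the maximal
  risk over a suitable finite grid is eventually at least \<open>M\<close>, for every \<open>M < L\<close>
  (\<open>risk_lower_bound\<close>).

  Existence and uniqueness of the minimiser rest on the parallelogram identity for the quadratic
  objective (\<open>near_minimisers_close\<close>). It makes a minimising sequence Cauchy; a fast one converges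
  almost everywhere, and Fatou's lemma identifies its limit as a minimiser (\<open>minimiser_exists\<close>).
  The penalty weights are bounded away from 0, which separates the components and gives uniqueness
  (\<open>minimiser_unique\<close>).
\<close>

section \<open>Square integrable functions\<close>

lemma square_integrable_integrable:
  assumes "prob_space M" "g \<in> borel_measurable M" "integrable M (\<lambda>x. (g x)\<^sup>2 :: real)"
  shows "integrable M g"
proof -
  interpret prob_space M by fact
  show ?thesis using assms(2,3) square_integrable_imp_integrable by blast
qed

text \<open>The inequality comes from expanding the nonnegative integral of \<open>(B g - P h)\<^sup>2\<close>, where \<open>B\<close> is
  the integral of \<open>h\<^sup>2\<close> and \<open>P\<close> that of \<open>g h\<close>; the case \<open>B = 0\<close> is separate.\<close>

lemma Cauchy_Schwarz_integral:
  fixes g h :: "'a \<Rightarrow> real"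
  assumes [measurable]: "g \<in> borel_measurable M" "h \<in> borel_measurable M"
    and g: "integrable M (\<lambda>x. (g x)\<^sup>2)" and h: "integrable M (\<lambda>x. (h x)\<^sup>2)"
  shows "integrable M (\<lambda>x. g x * h x)"
    and "(\<integral>x. g x * h x \<partial>M)\<^sup>2 \<le> (\<integral>x. (g x)\<^sup>2 \<partial>M) * (\<integral>x. (h x)\<^sup>2 \<partial>M)"
proof -
  have le: "\<bar>x * y\<bar> \<le> x\<^sup>2 + y\<^sup>2" for x y :: real
  proof -
    have "0 \<le> (\<bar>x\<bar> - \<bar>y\<bar>)\<^sup>2" by simp
    then have "2 * \<bar>x * y\<bar> \<le> x\<^sup>2 + y\<^sup>2" by (simp add: power2_diff abs_mult)
    then show ?thesis by simp
  qed
  show gh: "integrable M (\<lambda>x. g x * h x)"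
    by (rule Bochner_Integration.integrable_bound[OF Bochner_Integration.integrable_add[OF g h]])
        (auto simp: le)
  then have gh': "integrable M (\<lambda>x. \<bar>g x\<bar> * \<bar>h x\<bar>)"
    by (subst abs_mult[symmetric]) (rule integrable_abs)
  let ?A = "\<integral>x. (g x)\<^sup>2 \<partial>M" and ?B = "\<integral>x. (h x)\<^sup>2 \<partial>M" and ?P = "\<integral>x. g x * h x \<partial>M"
  have "0 \<le> (\<integral>x. (?B * g x - ?P * h x)\<^sup>2 \<partial>M)" by simp
  also have "\<dots> = (\<integral>x. ?B\<^sup>2 * (g x)\<^sup>2 + ?P\<^sup>2 * (h x)\<^sup>2 - (2 * ?B * ?P) * (g x * h x) \<partial>M)"
    by (intro Bochner_Integration.integral_cong refl) (simp add: power2_diff power_mult_distrib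
        algebra_simps)
  also have "\<dots> = ?B\<^sup>2 * ?A + ?P\<^sup>2 * ?B - (2 * ?B * ?P) * ?P"
    using g h gh by simp
  also have "\<dots> = ?B * (?B * ?A - ?P\<^sup>2)" by (simp add: power2_eq_square algebra_simps)
  finally have *: "0 \<le> ?B * (?B * ?A - ?P\<^sup>2)" .
  show "?P\<^sup>2 \<le> ?A * ?B"
  proof (cases "?B = 0")
    case True
    then have "AE x in M. (h x)\<^sup>2 = 0"
      using h by (subst (asm) integral_nonneg_eq_0_iff_AE) auto
    then have "?P = (\<integral>x. 0 \<partial>M)" by (intro integral_cong_AE) auto
    then show ?thesis using True by simp
  next
    case False
    then have "?B > 0" by (simp add: order_less_le)
    with * have "0 \<le> ?B * ?A - ?P\<^sup>2" by (simp add: zero_le_mult_iff)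
    then show ?thesis by (simp add: mult.commute)
  qed
qed

definition sq_integrable :: "'x measure \<Rightarrow> ('x \<Rightarrow> real) \<Rightarrow> bool" where
  "sq_integrable M g \<longleftrightarrow> g \<in> borel_measurable M \<and> integrable M (\<lambda>x. (g x)\<^sup>2)"

lemma sq_integrable_mult:
  "sq_integrable M g \<Longrightarrow> sq_integrable M h \<Longrightarrow> integrable M (\<lambda>x. g x * h x)"
  unfolding sq_integrable_def by (rule Cauchy_Schwarz_integral(1)) auto

lemma sq_integrable_add:
  assumes "sq_integrable M g" "sq_integrable M h" shows "sq_integrable M (\<lambda>x. g x + h x)"
  using assms sq_integrable_mult[OF assms]
  by (auto simp: sq_integrable_def power2_sum mult.assoc)

lemma sq_integrable_cmult: "sq_integrable M g \<Longrightarrow> sq_integrable M (\<lambda>x. c * g x)"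
  by (auto simp: sq_integrable_def power_mult_distrib)

lemma sq_integrable_diff:
  assumes "sq_integrable M g" "sq_integrable M h" shows "sq_integrable M (\<lambda>x. g x - h x)"
  using sq_integrable_add[OF assms(1) sq_integrable_cmult[OF assms(2), of "-1"]] by simp

lemma sq_integrable_sum:
  assumes "\<And>i. i \<in> I \<Longrightarrow> sq_integrable M (g i)" shows "sq_integrable M (\<lambda>x. \<Sum>i\<in>I. g i x)"
  using assms
proof (induction I rule: infinite_finite_induct)
  case (insert i I)
  then show ?case by (simp add: sq_integrable_add)
qed (auto simp: sq_integrable_def)

lemma sq_integrable_bounded_mult:
  assumes g: "sq_integrable M g" and [measurable]: "b \<in> borel_measurable M"
    and b: "\<And>x. x \<in> space M \<Longrightarrow> \<bar>b x\<bar> \<le> B"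
  shows "sq_integrable M (\<lambda>x. b x * g x)"
proof -
  have [measurable]: "g \<in> borel_measurable M" using g by (simp add: sq_integrable_def)
  have "integrable M (\<lambda>x. (b x * g x)\<^sup>2)"
  proof (rule Bochner_Integration.integrable_bound)
    show "integrable M (\<lambda>x. B\<^sup>2 * (g x)\<^sup>2)" using g by (simp add: sq_integrable_def)
    show "AE x in M. norm ((b x * g x)\<^sup>2) \<le> norm (B\<^sup>2 * (g x)\<^sup>2)"
    proof (rule AE_I2)
      fix x assume "x \<in> space M"
      from power_mono[OF b[OF this], of 2] show "norm ((b x * g x)\<^sup>2) \<le> norm (B\<^sup>2 * (g x)\<^sup>2)"
        by (simp add: power_mult_distrib mult_right_mono)
    qed
  qed measurable
  then show ?thesis by (simp add: sq_integrable_def)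
qed

context prob_space
begin

lemma sq_integrable_int: "sq_integrable M g \<Longrightarrow> integrable M g"
  unfolding sq_integrable_def using square_integrable_integrable[OF prob_space_axioms] by blast

lemma sq_integrable_const: "sq_integrable M (\<lambda>_. c)"
  by (simp add: sq_integrable_def)

lemma abs_expectation_le_sqrt:
  assumes g: "sq_integrable M g"
  shows "expectation (\<lambda>x. \<bar>g x\<bar>) \<le> sqrt (expectation (\<lambda>x. (g x)\<^sup>2))"
proof (rule real_le_rsqrt)
  show "(expectation (\<lambda>x. \<bar>g x\<bar>))\<^sup>2 \<le> expectation (\<lambda>x. (g x)\<^sup>2)"
    using Cauchy_Schwarz_integral(2)[of "\<lambda>x. \<bar>g x\<bar>" M "\<lambda>_. 1"] g
    by (auto simp: sq_integrable_def prob_space)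
qed

end

section \<open>Second moments of likelihood ratios\<close>

text \<open>For probability measures this says that the \<open>\<chi>\<^sup>2\<close> divergence of \<open>N\<close> from \<open>M\<close> is at most \<open>C - 1\<close>.
  The second moment, and not the divergence, is what multiplies over independent observations.\<close>

definition chi2_le :: "'x measure \<Rightarrow> 'x measure \<Rightarrow> ennreal \<Rightarrow> bool" where
  "chi2_le M N C \<longleftrightarrow> (\<exists>L \<in> borel_measurable M. N = density M L \<and> (\<integral>\<^sup>+ x. (L x)\<^sup>2 \<partial>M) \<le> C)"

lemma chi2_le_mono: "chi2_le M N C \<Longrightarrow> C \<le> D \<Longrightarrow> chi2_le M N D"
  by (auto simp: chi2_le_def intro: order_trans)

lemma chi2_le_pair:
  assumes "prob_space M'" "prob_space N'"
    and MN: "chi2_le M N C" and MN': "chi2_le M' N' C'"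
  shows "chi2_le (M \<Otimes>\<^sub>M M') (N \<Otimes>\<^sub>M N') (C * C')"
proof -
  interpret M': prob_space M' by fact
  interpret N': prob_space N' by fact
  obtain L where L[measurable]: "L \<in> borel_measurable M" and N: "N = density M L"
    and C: "(\<integral>\<^sup>+ x. (L x)\<^sup>2 \<partial>M) \<le> C"
    using MN by (auto simp: chi2_le_def)
  obtain L' where L'[measurable]: "L' \<in> borel_measurable M'" and N': "N' = density M' L'"
    and C': "(\<integral>\<^sup>+ x. (L' x)\<^sup>2 \<partial>M') \<le> C'"
    using MN' by (auto simp: chi2_le_def)
  have "N \<Otimes>\<^sub>M N' = density (M \<Otimes>\<^sub>M M') (\<lambda>(x, y). L x * L' y)"
    unfolding N N' using N'.sigma_finite_measure_axioms
    by (intro pair_measure_density M'.sigma_finite_measure_axioms) (auto simp: N')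
  moreover have "(\<integral>\<^sup>+ z. (case z of (x, y) \<Rightarrow> L x * L' y)\<^sup>2 \<partial>(M \<Otimes>\<^sub>M M'))
      = (\<integral>\<^sup>+ x. \<integral>\<^sup>+ y. (L x)\<^sup>2 * (L' y)\<^sup>2 \<partial>M' \<partial>M)"
    by (subst M'.nn_integral_fst[symmetric]) (simp_all add: power_mult_distrib)
  moreover have "\<dots> = (\<integral>\<^sup>+ x. (L x)\<^sup>2 \<partial>M) * (\<integral>\<^sup>+ y. (L' y)\<^sup>2 \<partial>M')"
    by (simp add: nn_integral_cmult nn_integral_multc)
  moreover have "\<dots> \<le> C * C'" by (intro mult_mono C C') auto
  ultimately show ?thesis
    unfolding chi2_le_def by (intro bexI[of _ "\<lambda>(x, y). L x * L' y"]) simp_all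
qed

text \<open>The density of a product measure is the product of the densities, by uniqueness of measures on
  boxes, and the integral of a product of functions of separate coordinates factorises.\<close>

lemma chi2_le_PiM:
  assumes I: "finite I"
    and pM: "\<And>i. i \<in> I \<Longrightarrow> prob_space (M i)" and pN: "\<And>i. i \<in> I \<Longrightarrow> prob_space (N i)"
    and MN: "\<And>i. i \<in> I \<Longrightarrow> chi2_le (M i) (N i) (C i)"
  shows "chi2_le (PiM I M) (PiM I N) (\<Prod>i\<in>I. C i)"
proof -
  (* outside I the factors are arbitrary; a one-point space there makes all factors sigma-finite *)
  define M' where "M' i = (if i \<in> I then M i else count_space {undefined})" for i
  define N' where "N' i = (if i \<in> I then N i else count_space {undefined})" for i
  have eq: "PiM I M = PiM I M'" "PiM I N = PiM I N'"
    by (auto simp: M'_def N'_def intro: PiM_cong)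
  have sc: "sigma_finite_measure (count_space {undefined})"
    by (intro sigma_finite_measure_count_space_finite) simp
  interpret M: product_sigma_finite M'
    using pM sc by (auto simp: product_sigma_finite_def M'_def prob_space_imp_sigma_finite)
  interpret N: product_sigma_finite N'
    using pN sc by (auto simp: product_sigma_finite_def N'_def prob_space_imp_sigma_finite)
  have "\<forall>i\<in>I. \<exists>L. L \<in> borel_measurable (M' i) \<and> N' i = density (M' i) L \<and>
      (\<integral>\<^sup>+ x. (L x)\<^sup>2 \<partial>M' i) \<le> C i"
    using MN by (auto simp: chi2_le_def M'_def N'_def)
  then obtain L where "\<forall>i\<in>I. L i \<in> borel_measurable (M' i) \<and> N' i = density (M' i) (L i) \<and>
      (\<integral>\<^sup>+ x. (L i x)\<^sup>2 \<partial>M' i) \<le> C i" by metis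
  then have L[measurable]: "\<And>i. i \<in> I \<Longrightarrow> L i \<in> borel_measurable (M' i)"
    and N': "\<And>i. i \<in> I \<Longrightarrow> N' i = density (M' i) (L i)"
    and C: "\<And>i. i \<in> I \<Longrightarrow> (\<integral>\<^sup>+ x. (L i x)\<^sup>2 \<partial>M' i) \<le> C i"
    by auto
  let ?L = "\<lambda>x. \<Prod>i\<in>I. L i (x i)"
  have Lm: "?L \<in> borel_measurable (PiM I M')"
    by (intro borel_measurable_prod_ennreal measurable_compose[OF measurable_component_singleton])
      (auto simp: L)
  have "density (PiM I M') ?L = PiM I N'"
  proof (rule N.PiM_eqI[OF I])
    show "sets (density (PiM I M') ?L) = sets (PiM I N')"
      by (auto simp: N' intro!: sets_PiM_cong)
  next
    fix A assume "\<And>i. i \<in> I \<Longrightarrow> A i \<in> sets (N' i)"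
    then have A[measurable]: "\<And>i. i \<in> I \<Longrightarrow> A i \<in> sets (M' i)" by (auto simp: N')
    have PA: "PiE I A \<in> sets (PiM I M')" using I A by (rule sets_PiM_I_finite)
    have "emeasure (density (PiM I M') ?L) (PiE I A)
        = (\<integral>\<^sup>+ x. ?L x * indicator (PiE I A) x \<partial>PiM I M')"
      by (rule emeasure_density[OF Lm PA])
    also have "\<dots> = (\<integral>\<^sup>+ x. (\<Prod>i\<in>I. L i (x i) * indicator (A i) (x i)) \<partial>PiM I M')"
    proof (rule nn_integral_cong)
      fix x assume "x \<in> space (PiM I M')"
      then have "x \<in> extensional I" by (simp add: space_PiM PiE_def)
      then have "indicator (PiE I A) x = (\<Prod>i\<in>I. indicator (A i) (x i) :: ennreal)"
        using I by (auto simp: indicator_def PiE_iff prod_zero_iff)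
      then show "?L x * indicator (PiE I A) x = (\<Prod>i\<in>I. L i (x i) * indicator (A i) (x i))"
        by (simp add: prod.distrib)
    qed
    also have "\<dots> = (\<Prod>i\<in>I. \<integral>\<^sup>+ x. L i x * indicator (A i) x \<partial>M' i)"
      using I L A by (intro M.product_nn_integral_prod borel_measurable_times_ennreal
        borel_measurable_indicator) auto
    also have "\<dots> = (\<Prod>i\<in>I. emeasure (N' i) (A i))"
      by (intro prod.cong refl) (simp add: N' emeasure_density)
    finally show "emeasure (density (PiM I M') ?L) (PiE I A) = (\<Prod>i\<in>I. emeasure (N' i) (A i))" .
  qed
  moreover have "(\<integral>\<^sup>+ x. (?L x)\<^sup>2 \<partial>PiM I M') = (\<Prod>i\<in>I. \<integral>\<^sup>+ x. (L i x)\<^sup>2 \<partial>M' i)"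
    using I L by (simp only: prod_power_distrib)
      (intro M.product_nn_integral_prod borel_measurable_power_ennreal, auto)
  moreover have "\<dots> \<le> (\<Prod>i\<in>I. C i)"
    using C by (intro prod_mono_ennreal) auto
  ultimately show ?thesis
    unfolding chi2_le_def eq using Lm by (intro bexI[of _ ?L]) simp_all
qed

lemma chi2_le_iid:
  assumes "prob_space M" "prob_space N" "chi2_le M N C"
  shows "chi2_le (PiM {1..n} (\<lambda>_. M)) (PiM {1..n::nat} (\<lambda>_. N)) (C ^ n)"
  using chi2_le_PiM[of "{1..n}" "\<lambda>_. M" "\<lambda>_. N" "\<lambda>_. C"] assms by simp

text \<open>The information inequality in its discrete form. With \<open>l\<close> the density of \<open>N\<close>, the difference of
  the two means of \<open>T\<close> is the integral of \<open>(T - s) (l - 1)\<close> under \<open>M\<close>, since \<open>l - 1\<close> has mean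
  zero; the Cauchy-Schwarz inequality bounds it by the risk of \<open>T\<close> at \<open>s\<close> times the \<open>\<chi>\<^sup>2\<close>
  divergence.\<close>

lemma mean_diff_le:
  fixes T :: "'x \<Rightarrow> real"
  assumes "prob_space M" "prob_space N"
    and T[measurable]: "T \<in> borel_measurable M"
    and MN: "chi2_le M N (ennreal C)"
    and M: "(\<integral>\<^sup>+ x. ennreal ((T x - s)\<^sup>2) \<partial>M) \<le> ennreal V" and V: "V \<ge> 0"
    and N: "integrable N T"
  shows "\<bar>(\<integral>x. T x \<partial>N) - (\<integral>x. T x \<partial>M)\<bar> \<le> sqrt (V * (C - 1))"
proof -
  interpret M: prob_space M by fact
  interpret N: prob_space N by fact
  obtain L where L[measurable]: "L \<in> borel_measurable M" and Nd: "N = density M L"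
    and C: "(\<integral>\<^sup>+ x. (L x)\<^sup>2 \<partial>M) \<le> ennreal C"
    using MN by (auto simp: chi2_le_def)
  have L1: "(\<integral>\<^sup>+ x. L x \<partial>M) = 1"
    using N.emeasure_space_1 by (simp add: Nd emeasure_density)
  then have "AE x in M. L x \<noteq> \<infinity>"
    by (intro nn_integral_noteq_infinite) auto
  then have Lf: "AE x in M. L x = ennreal (enn2real (L x))"
    by eventually_elim (simp add: top.not_eq_extremum)
  define l where "l x = enn2real (L x)" for x
  have l[measurable]: "l \<in> borel_measurable M" unfolding l_def by measurable
  have l0: "0 \<le> l x" for x by (simp add: l_def)
  have Nl: "N = density M (\<lambda>x. ennreal (l x))"
    unfolding Nd using Lf by (intro density_cong) (auto simp: l_def)
  have "(\<integral>\<^sup>+ x. ennreal (l x) \<partial>M) = 1"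
    using Lf by (subst L1[symmetric], intro nn_integral_cong_AE) (auto simp: l_def)
  then have il: "integrable M l" and l1: "(\<integral>x. l x \<partial>M) = 1"
    using l0 by (auto intro!: integrableI_nonneg simp: integral_eq_nn_integral)
  have "(\<integral>\<^sup>+ x. ennreal ((l x)\<^sup>2) \<partial>M) = (\<integral>\<^sup>+ x. (L x)\<^sup>2 \<partial>M)"
  proof (intro nn_integral_cong_AE, use Lf in eventually_elim)
    fix x assume "L x = ennreal (enn2real (L x))"
    then show "ennreal ((l x)\<^sup>2) = (L x)\<^sup>2"
      using ennreal_power[OF l0, of x 2] by (simp add: l_def)
  qed
  then have C': "(\<integral>\<^sup>+ x. ennreal ((l x)\<^sup>2) \<partial>M) \<le> ennreal C" using C by simp
  then have il2: "integrable M (\<lambda>x. (l x)\<^sup>2)"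
    by (intro integrableI_nonneg) (auto simp: less_top[symmetric] top_unique)
  have "ennreal (\<integral>x. (l x)\<^sup>2 \<partial>M) \<le> ennreal C"
    using C' nn_integral_eq_integral[OF il2] by simp
  moreover have "(\<integral>x. (l x - 1)\<^sup>2 \<partial>M) = (\<integral>x. (l x)\<^sup>2 \<partial>M) - 1"
  proof -
    have "(\<integral>x. (l x - 1)\<^sup>2 \<partial>M) = (\<integral>x. (l x)\<^sup>2 - 2 * l x + 1 \<partial>M)"
      by (intro Bochner_Integration.integral_cong refl) (simp add: power2_diff)
    also have "\<dots> = (\<integral>x. (l x)\<^sup>2 \<partial>M) - 1"
      using il il2 l1 by (simp add: M.prob_space)
    finally show ?thesis .
  qed
  moreover have "0 \<le> (\<integral>x. (l x - 1)\<^sup>2 \<partial>M)" by simp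
  ultimately have lC: "(\<integral>x. (l x - 1)\<^sup>2 \<partial>M) \<le> C - 1"
    by (smt (verit) ennreal_le_iff ennreal_neg ennreal_eq_0_iff le_zero_eq)
  have iT2: "integrable M (\<lambda>x. (T x - s)\<^sup>2)"
    using M by (intro integrableI_nonneg) (auto simp: less_top[symmetric] top_unique)
  have TV: "(\<integral>x. (T x - s)\<^sup>2 \<partial>M) \<le> V"
    using M V nn_integral_eq_integral[OF iT2] by simp
  have iT: "integrable M (\<lambda>x. T x - s)"
    by (rule square_integrable_integrable[OF \<open>prob_space M\<close> _ iT2]) simp
  have il': "integrable M (\<lambda>x. (l x - 1)\<^sup>2)"
    using il il2 by (simp add: power2_diff)
  have iTl: "integrable M (\<lambda>x. (T x - s) * (l x - 1))"
    and CS: "(\<integral>x. (T x - s) * (l x - 1) \<partial>M)\<^sup>2 \<le> (\<integral>x. (T x - s)\<^sup>2 \<partial>M) * (\<integral>x. (l x - 1)\<^sup>2 \<partial>M)"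
    using iT2 il' by (auto intro!: Cauchy_Schwarz_integral)
  have "integrable M (\<lambda>x. l x * T x)"
    using N l0 unfolding Nl by (subst (asm) integrable_real_density) auto
  moreover have "(\<integral>x. T x \<partial>N) = (\<integral>x. l x * T x \<partial>M)"
    using l0 unfolding Nl by (subst integral_real_density) auto
  moreover have "integrable M T" using Bochner_Integration.integrable_add[OF iT, of "\<lambda>_. s"] by simp
  ultimately have "(\<integral>x. T x \<partial>N) - (\<integral>x. T x \<partial>M) = (\<integral>x. l x * T x - T x - s * (l x - 1) \<partial>M)"
    using il l1 by (simp add: M.prob_space)
  also have "\<dots> = (\<integral>x. (T x - s) * (l x - 1) \<partial>M)"
    by (intro Bochner_Integration.integral_cong refl) (simp add: algebra_simps)
  finally have "((\<integral>x. T x \<partial>N) - (\<integral>x. T x \<partial>M))\<^sup>2 \<le> V * (C - 1)"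
    using CS TV lC V by (auto intro: order_trans[OF _ mult_mono])
  then show ?thesis using real_le_rsqrt
      by (metis abs_le_square_iff power2_abs real_sqrt_abs real_sqrt_le_iff)
qed

text \<open>The bias of \<open>T\<close> is bounded by \<open>sqrt V\<close> at every point of the walk. In one step the mean of \<open>T\<close>
  moves by at most \<open>sqrt (V (C - 1))\<close>. If the target always moves by at least \<open>e\<close> more than that,
  the bias falls by \<open>e\<close> in every step, so that the walk cannot have more than \<open>2 sqrt V / e\<close>
  steps. This replaces a prior on the path: it yields the sharp constant for the maximal risk
  directly.\<close>

lemma bias_walk:
  fixes T :: "'x \<Rightarrow> real" and \<theta> C :: "nat \<Rightarrow> real"
  assumes D: "\<And>j. j \<le> m \<Longrightarrow> prob_space (D j)" and T: "\<And>j. j \<le> m \<Longrightarrow> T \<in> borel_measurable (D j)"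
    and V: "V \<ge> 0" and risk: "\<And>j. j \<le> m \<Longrightarrow> (\<integral>\<^sup>+ x. ennreal ((T x - \<theta> j)\<^sup>2) \<partial>D j) \<le> ennreal V"
    and chi2: "\<And>j. j < m \<Longrightarrow> chi2_le (D j) (D (Suc j)) (ennreal (C j))"
    and step: "\<And>j. j < m \<Longrightarrow> sqrt (V * (C j - 1)) + e \<le> \<theta> (Suc j) - \<theta> j"
  shows "real m * e \<le> 2 * sqrt V"
proof -
  define b where "b j = (\<integral>x. T x \<partial>D j) - \<theta> j" for j
  have sq: "sq_integrable (D j) (\<lambda>x. T x - \<theta> j)" and V': "(\<integral>x. (T x - \<theta> j)\<^sup>2 \<partial>D j) \<le> V" if "j
      \<le> m" for j
  proof -
    note [measurable] = T[OF that]
    have i: "integrable (D j) (\<lambda>x. (T x - \<theta> j)\<^sup>2)"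
      using risk[OF that] by (intro integrableI_nonneg) (auto simp: less_top[symmetric] top_unique)
    then show "sq_integrable (D j) (\<lambda>x. T x - \<theta> j)" by (simp add: sq_integrable_def)
    show "(\<integral>x. (T x - \<theta> j)\<^sup>2 \<partial>D j) \<le> V"
      using risk[OF that] V nn_integral_eq_integral[OF i] by simp
  qed
  have Ti: "integrable (D j) T" if "j \<le> m" for j
  proof -
    interpret prob_space "D j" by (rule D[OF that])
    show ?thesis using Bochner_Integration.integrable_add[OF sq_integrable_int[OF sq[OF that]],
        of "\<lambda>_. \<theta> j"] by simp
  qed
  have b_bound: "\<bar>b j\<bar> \<le> sqrt V" if "j \<le> m" for j
  proof -
    interpret prob_space "D j" by (rule D[OF that])
    have "b j = (\<integral>x. T x - \<theta> j \<partial>D j)" using Ti[OF that] by (simp add: b_def prob_space)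
    then have "\<bar>b j\<bar> \<le> (\<integral>x. \<bar>T x - \<theta> j\<bar> \<partial>D j)" by (simp only: integral_abs_bound)
    also have "\<dots> \<le> sqrt (\<integral>x. (T x - \<theta> j)\<^sup>2 \<partial>D j)" by (rule abs_expectation_le_sqrt[OF sq[OF that]])
    also have "\<dots> \<le> sqrt V" by (rule real_sqrt_le_mono[OF V'[OF that]])
    finally show ?thesis .
  qed
  have b_step: "b (Suc j) \<le> b j - e" if "j < m" for j
  proof -
    have "\<bar>(\<integral>x. T x \<partial>D (Suc j)) - (\<integral>x. T x \<partial>D j)\<bar> \<le> sqrt (V * (C j - 1))"
      using that by (intro mean_diff_le[OF _ _ _ chi2 risk V]) (auto intro: D T Ti)
    then show ?thesis using step[OF that] unfolding b_def by linarith
  qed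
  have "b j \<le> b 0 - real j * e" if "j \<le> m" for j
    using that
  proof (induction j)
    case (Suc j)
    then show ?case using b_step[of j] by (simp add: algebra_simps)
  qed simp
  from this[of m] b_bound[of m] b_bound[of 0] show ?thesis by simp
qed

section \<open>Local families of densities\<close>

lemma chi2_le_densities:
  fixes p q :: "'x \<Rightarrow> real"
  assumes [measurable]: "p \<in> borel_measurable R" "q \<in> borel_measurable R"
    and p: "\<And>x. x \<in> space R \<Longrightarrow> p x \<ge> 0" and q: "\<And>x. x \<in> space R \<Longrightarrow> q x > 0"
    and i: "integrable R (\<lambda>x. (p x)\<^sup>2 / q x)"
  shows "chi2_le (density R (\<lambda>x. ennreal (q x))) (density R (\<lambda>x. ennreal (p x)))
    (ennreal (\<integral>x. (p x)\<^sup>2 / q x \<partial>R))"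
proof -
  have "density R (\<lambda>x. ennreal (p x))
      = density (density R (\<lambda>x. ennreal (q x))) (\<lambda>x. ennreal (p x / q x))"
    using p q by (subst density_density_eq)
      (auto intro!: density_cong AE_I2 simp: ennreal_mult'[symmetric] less_imp_le
          less_imp_neq[THEN not_sym])
  moreover have "(\<integral>\<^sup>+ x. (ennreal (p x / q x))\<^sup>2 \<partial>density R (\<lambda>x. ennreal (q x)))
      = (\<integral>\<^sup>+ x. ennreal ((p x)\<^sup>2 / q x) \<partial>R)"
  proof (subst nn_integral_density, measurable, rule nn_integral_cong)
    fix x assume x: "x \<in> space R"
    then have "ennreal (q x) * (ennreal (p x / q x))\<^sup>2 = ennreal (q x * (p x / q x)\<^sup>2)"
      using p[OF x] q[OF x] by (simp add: ennreal_power ennreal_mult'[symmetric] less_imp_le)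
    then show "ennreal (q x) * (ennreal (p x / q x))\<^sup>2 = ennreal ((p x)\<^sup>2 / q x)"
      using q[OF x] by (simp add: power2_eq_square)
  qed
  moreover have "\<dots> = ennreal (\<integral>x. (p x)\<^sup>2 / q x \<partial>R)"
    using p q by (intro nn_integral_eq_integral i AE_I2) (auto simp: less_imp_le)
  ultimately show ?thesis
    unfolding chi2_le_def by (intro bexI[of _ "\<lambda>x. ennreal (p x / q x)"]) simp_all
qed

lemma tendsto_dominated_integral_mult:
  fixes b D e :: "'x \<Rightarrow> real"
  assumes [measurable]: "\<And>n. G n \<in> borel_measurable R" "b \<in> borel_measurable R" "e
      \<in> borel_measurable R"
    and lim: "AE x in R. (\<lambda>n. G n x) \<longlonglongrightarrow> b x"
    and bound: "\<And>n. AE x in R. \<bar>G n x\<bar> \<le> D x"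
    and D: "integrable R (\<lambda>x. \<bar>e x\<bar> * D x)"
  shows "(\<lambda>n. \<integral>x. e x * G n x \<partial>R) \<longlonglongrightarrow> (\<integral>x. e x * b x \<partial>R)"
proof (rule integral_dominated_convergence[OF _ _ D])
  show "AE x in R. (\<lambda>n. e x * G n x) \<longlonglongrightarrow> e x * b x"
    using lim by eventually_elim (intro tendsto_intros)
  show "AE x in R. norm (e x * G n x) \<le> \<bar>e x\<bar> * D x" for n
    using bound[of n] by eventually_elim (auto simp: abs_mult intro: mult_left_mono)
qed measurable

text \<open>A deviation from 1 that converges after multiplication by \<open>sqrt n\<close> vanishes.\<close>

lemma tendsto_1_of_sqrt:
  assumes "(\<lambda>n. sqrt (real n) * (y n - 1)) \<longlonglongrightarrow> l" shows "(y :: nat \<Rightarrow> real) \<longlonglongrightarrow> 1"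
proof -
  have "(\<lambda>n. inverse (sqrt (real n))) \<longlonglongrightarrow> 0"
    by (intro tendsto_inverse_0_at_top filterlim_compose[OF sqrt_at_top]
        filterlim_real_sequentially)
  from tendsto_mult[OF this assms]
  have "(\<lambda>n. y n - 1) \<longlonglongrightarrow> 0 * l"
  proof (rule Lim_transform_eventually)
    show "\<forall>\<^sub>F n in sequentially. inverse (sqrt (real n)) * (sqrt (real n) * (y n - 1)) = y n - 1"
      using eventually_gt_at_top[of 0] by eventually_elim simp
  qed
  then show ?thesis by (simp add: LIM_zero_cancel)
qed

text \<open>Unnormalised densities \<open>G n\<close> with respect to \<open>R\<close> that approach 1 at rate \<open>1 / sqrt n\<close> with score
  \<open>b\<close>. The pointwise limit and a square integrable envelope \<open>D\<close> are all that the \<open>\<chi>\<^sup>2\<close> asymptotics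
  need; the bounds \<open>lo\<close> and \<open>hi\<close> keep likelihood ratios bounded.\<close>

locale local_family = prob_space R for R :: "'x measure" +
  fixes G :: "nat \<Rightarrow> 'x \<Rightarrow> real" and b D :: "'x \<Rightarrow> real" and lo hi :: real
  assumes G[measurable]: "\<And>n. G n \<in> borel_measurable R"
    and b[measurable]: "b \<in> borel_measurable R"
    and D[measurable]: "D \<in> borel_measurable R"
    and lo: "0 < lo" and G_lo: "\<And>n x. x \<in> space R \<Longrightarrow> lo \<le> G n x"
    and G_hi: "\<And>n x. x \<in> space R \<Longrightarrow> G n x \<le> hi"
    and lim: "AE x in R. (\<lambda>n. sqrt (real n) * (G n x - 1)) \<longlonglongrightarrow> b x"
    and bound: "\<And>n. AE x in R. \<bar>sqrt (real n) * (G n x - 1)\<bar> \<le> D x"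
    and D2: "integrable R (\<lambda>x. (D x)\<^sup>2)"
begin

definition Z :: "nat \<Rightarrow> real" where "Z n = (\<integral>x. G n x \<partial>R)"

definition pdens :: "nat \<Rightarrow> 'x \<Rightarrow> real" where "pdens n x = G n x / Z n"

lemma hi: "lo \<le> hi"
proof -
  obtain x where "x \<in> space R" using not_empty by auto
  from order_trans[OF G_lo[OF this] G_hi[OF this]] show ?thesis .
qed

lemma G_int: "integrable R (G n)"
proof (intro integrable_const_bound[of _ hi] AE_I2)
  show "norm (G n x) \<le> hi" if "x \<in> space R" for x
    using G_lo[OF that, of n] G_hi[OF that, of n] lo by simp
qed measurable

lemma Z_bounds: "lo \<le> Z n" "Z n \<le> hi"
  unfolding Z_def using G_lo G_hi G_int by (auto intro!: integral_ge_const integral_le_const AE_I2)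

lemma Z_pos: "0 < Z n" using Z_bounds(1)[of n] lo by simp

lemma pdens_pos: "x \<in> space R \<Longrightarrow> 0 < pdens n x"
  using G_lo[of x n] lo Z_pos[of n] by (simp add: pdens_def)

lemma pdens_measurable[measurable]: "pdens n \<in> borel_measurable R"
  unfolding pdens_def[abs_def] by measurable

lemma pdens_prob: "prob_space (density R (\<lambda>x. ennreal (pdens n x)))"
proof (rule prob_spaceI)
  have "(\<integral>\<^sup>+ x. ennreal (pdens n x) \<partial>R) = ennreal (\<integral>x. pdens n x \<partial>R)"
    using pdens_pos by (intro nn_integral_eq_integral)
      (auto simp: pdens_def less_imp_le intro!: AE_I2 G_int)
  also have "(\<integral>x. pdens n x \<partial>R) = 1"
    using Z_pos[of n] by (simp add: pdens_def Z_def)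
  finally show "emeasure (density R (\<lambda>x. ennreal (pdens n x)))
      (space (density R (\<lambda>x. ennreal (pdens n x)))) = 1"
    by (simp add: emeasure_density cong: nn_integral_cong)
qed

lemma D_int: "integrable R D"
  by (rule square_integrable_integrable[OF prob_space_axioms D D2])

lemma b_bound: "AE x in R. \<bar>b x\<bar> \<le> D x"
proof -
  have "AE x in R. \<forall>n. \<bar>sqrt (real n) * (G n x - 1)\<bar> \<le> D x"
    using bound by (simp add: AE_all_countable)
  then show ?thesis using lim
  proof eventually_elim
    case (elim x)
    show ?case by (rule tendsto_upperbound[OF tendsto_rabs[OF elim(2)]]) (use elim(1) in auto)
  qed
qed

lemma b_int: "integrable R b"
proof (rule Bochner_Integration.integrable_bound[OF D_int])
  show "AE x in R. norm (b x) \<le> norm (D x)" using b_bound by eventually_elim auto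
qed measurable

lemma expectation_lim:
  assumes [measurable]: "e \<in> borel_measurable R" and e: "integrable R (\<lambda>x. (e x)\<^sup>2)"
  shows "(\<lambda>n. \<integral>x. e x * (sqrt (real n) * (G n x - 1)) \<partial>R) \<longlonglongrightarrow> (\<integral>x. e x * b x \<partial>R)"
proof (rule tendsto_dominated_integral_mult[OF _ _ _ lim bound])
  show "integrable R (\<lambda>x. \<bar>e x\<bar> * D x)"
    by (rule Cauchy_Schwarz_integral(1)) (simp_all add: e D2)
qed measurable

lemma sqrt_Z_lim: "(\<lambda>n. sqrt (real n) * (Z n - 1)) \<longlonglongrightarrow> (\<integral>x. b x \<partial>R)"
proof -
  have *: "(\<integral>x. G n x - 1 \<partial>R) = Z n - 1" for n
    using Bochner_Integration.integral_diff[OF G_int[of n] integrable_const[of 1]]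
    by (simp add: Z_def prob_space)
  have "(\<integral>x. 1 * (sqrt (real n) * (G n x - 1)) \<partial>R) = sqrt (real n) * (Z n - 1)" for n
    by (simp only: mult_1_left integral_mult_right_zero *)
  moreover have "integrable R (\<lambda>x. (1 :: real)\<^sup>2)" by simp
  ultimately show ?thesis using expectation_lim[of "\<lambda>_. 1"]
      by (simp only: mult_1_left borel_measurable_const)
qed

lemma Z_lim: "Z \<longlonglongrightarrow> 1"
  by (rule tendsto_1_of_sqrt[OF sqrt_Z_lim])

lemma G_lim: "AE x in R. (\<lambda>n. G n x) \<longlonglongrightarrow> 1"
  using lim by eventually_elim (rule tendsto_1_of_sqrt)

end

text \<open>The \<open>\<chi>\<^sup>2\<close> divergence between two members is \<open>1 / n\<close> times the variance under \<open>R\<close> of the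
  difference of their scores, up to \<open>o(1 / n)\<close>. The divergence is the integral of \<open>(p - q)\<^sup>2 / q\<close>;
  after multiplication by \<open>n\<close> the integrand converges pointwise to the square of the centred score
  difference, where the centring is the contribution of the normalising constants, and the
  envelopes dominate it.\<close>

lemma local_chi2:
  fixes R :: "'x measure"
  assumes S: "local_family R Gs bs Ds los his" and T: "local_family R Gt bt Dt lot hit"
  shows "\<exists>\<kappa>. (\<forall>n. chi2_le (density R (\<lambda>x. ennreal (local_family.pdens R Gs n x)))
        (density R (\<lambda>x. ennreal (local_family.pdens R Gt n x))) (ennreal (1 + \<kappa> n)) \<and> \<kappa> n \<ge> 0) \<and>
      (\<lambda>n. real n * \<kappa> n) \<longlonglongrightarrow> (\<integral>x. (bt x - bs x - (\<integral>y. bt y - bs y \<partial>R))\<^sup>2 \<partial>R)"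
proof -
  interpret s: local_family R Gs bs Ds los his by fact
  interpret t: local_family R Gt bt Dt lot hit by fact
  let ?p = t.pdens and ?q = s.pdens
  define \<kappa> where "\<kappa> n = (\<integral>x. (?p n x - ?q n x)\<^sup>2 / ?q n x \<partial>R)" for n
  define U where "U n x = sqrt (real n) * (?p n x - ?q n x)" for n x
  define m where "m = (\<integral>y. bt y - bs y \<partial>R)"
  have pb: "?p n x \<le> hit / lot" "0 < ?p n x" if "x \<in> space R" for n x
    using t.G_hi[OF that, of n] t.Z_bounds[of n] t.lo t.pdens_pos[OF that] t.G_lo[OF that, of n]
    unfolding t.pdens_def by (auto intro!: frac_le)
  have qb: "?q n x \<le> his / los" "los / his \<le> ?q n x" if "x \<in> space R" for n x
    using s.G_hi[OF that, of n] s.Z_bounds[of n] s.lo s.pdens_pos[OF that] s.G_lo[OF that, of n]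
    unfolding s.pdens_def by (auto intro!: frac_le)
  have lh: "0 < los / his" using s.lo s.hi by (auto intro!: divide_pos_pos)
  have quot_bd: "\<bar>(?p n x)\<^sup>2 / ?q n x\<bar> \<le> (hit / lot)\<^sup>2 / (los / his)" if "x \<in> space R" for n x
    unfolding abs_divide using pb[OF that, of n] qb[OF that, of n] lh
    by (intro frac_le) (auto intro!: power_mono)
  have i0: "integrable R (\<lambda>x. (?p n x)\<^sup>2 / ?q n x)" for n
  proof (rule s.integrable_const_bound)
    show "AE x in R. norm ((?p n x)\<^sup>2 / ?q n x) \<le> (hit / lot)\<^sup>2 / (los / his)"
      unfolding real_norm_def by (intro AE_I2 quot_bd)
  qed measurable
  have ip: "integrable R (?p n)" and iq: "integrable R (?q n)" for n
    unfolding t.pdens_def s.pdens_def using t.G_int s.G_int by auto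
  have sp: "(\<integral>x. ?p n x \<partial>R) = 1" "(\<integral>x. ?q n x \<partial>R) = 1" for n
    using t.Z_pos[of n] s.Z_pos[of n] by (simp_all add: t.pdens_def t.Z_def s.pdens_def s.Z_def)
  have chi_eq: "(\<integral>x. (?p n x)\<^sup>2 / ?q n x \<partial>R) = 1 + \<kappa> n" for n
  proof -
    have "\<kappa> n = (\<integral>x. (?p n x)\<^sup>2 / ?q n x - 2 * ?p n x + ?q n x \<partial>R)"
      unfolding \<kappa>_def
    proof (intro Bochner_Integration.integral_cong refl)
      fix x assume "x \<in> space R"
      with s.pdens_pos[OF this, of n] show "(?p n x - ?q n x)\<^sup>2 / ?q n x = (?p n x)\<^sup>2 / ?q n x
          - 2 * ?p n x + ?q n x"
        by (simp add: field_simps power2_eq_square)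
    qed
    also have "\<dots> = (\<integral>x. (?p n x)\<^sup>2 / ?q n x \<partial>R) - 1"
      using i0 ip iq sp by simp
    finally show ?thesis by simp
  qed
  have "\<kappa> n \<ge> 0" for n unfolding \<kappa>_def
    using s.pdens_pos by (intro integral_nonneg_AE AE_I2) (auto simp: less_imp_le)
  moreover have "chi2_le (density R (\<lambda>x. ennreal (?q n x))) (density R (\<lambda>x. ennreal (?p n x)))
      (ennreal (1 + \<kappa> n))" for n
    unfolding chi_eq[symmetric] using s.pdens_pos t.pdens_pos i0
    by (intro chi2_le_densities) (auto simp: less_imp_le)
  moreover have "(\<lambda>n. real n * \<kappa> n) \<longlonglongrightarrow> (\<integral>x. (bt x - bs x - m)\<^sup>2 \<partial>R)"
  proof -
    have eq: "real n * \<kappa> n = (\<integral>x. (U n x)\<^sup>2 / ?q n x \<partial>R)" for n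
      unfolding \<kappa>_def U_def by (simp add: power_mult_distrib flip: integral_mult_right_zero)
    (* densities and normalising constants are pulled apart, so that each part has a limit *)
    have U_eq: "U n x = ((sqrt (real n) * (Gt n x - 1)) - sqrt (real n) * (t.Z n - 1)) / t.Z n
        - ((sqrt (real n) * (Gs n x - 1)) - sqrt (real n) * (s.Z n - 1)) / s.Z n" for n x
      using t.Z_pos[of n] s.Z_pos[of n] unfolding U_def t.pdens_def s.pdens_def
          by (simp add: field_simps)
    have m: "m = (\<integral>x. bt x \<partial>R) - (\<integral>x. bs x \<partial>R)"
      unfolding m_def using t.b_int s.b_int by simp
    have limit: "AE x in R. (\<lambda>n. (U n x)\<^sup>2 / ?q n x) \<longlonglongrightarrow> (bt x - bs x - m)\<^sup>2"
      using s.lim t.lim s.G_lim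
    proof eventually_elim
      case (elim x)
      have "(\<lambda>n. U n x) \<longlonglongrightarrow> (bt x - (\<integral>x. bt x \<partial>R)) / 1 - (bs x - (\<integral>x. bs x \<partial>R)) / 1"
        unfolding U_eq by (intro tendsto_intros elim t.sqrt_Z_lim s.sqrt_Z_lim t.Z_lim s.Z_lim) auto
      moreover have "(\<lambda>n. ?q n x) \<longlonglongrightarrow> 1 / 1"
        unfolding s.pdens_def by (intro tendsto_intros elim s.Z_lim) auto
      ultimately have "(\<lambda>n. (U n x)\<^sup>2 / ?q n x) \<longlonglongrightarrow>
          ((bt x - (\<integral>x. bt x \<partial>R)) / 1 - (bs x - (\<integral>x. bs x \<partial>R)) / 1)\<^sup>2 / (1 / 1)"
        by (intro tendsto_intros) auto
      then show ?case by (simp add: m algebra_simps)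
    qed
    obtain Kt where Kt: "\<And>n. \<bar>sqrt (real n) * (t.Z n - 1)\<bar> \<le> Kt"
      using convergent_imp_Bseq[OF convergentI[OF t.sqrt_Z_lim]] by (auto simp: Bseq_def)
    obtain Ks where Ks: "\<And>n. \<bar>sqrt (real n) * (s.Z n - 1)\<bar> \<le> Ks"
      using convergent_imp_Bseq[OF convergentI[OF s.sqrt_Z_lim]] by (auto simp: Bseq_def)
    define W where "W x = (Dt x + Kt) / lot + (Ds x + Ks) / los" for x
    have [measurable]: "U n \<in> borel_measurable R" for n
      unfolding U_def[abs_def] by measurable
    have UW: "AE x in R. \<bar>U n x\<bar> \<le> W x" for n
      using s.bound[of n] t.bound[of n]
    proof eventually_elim
      case (elim x)
      have "\<bar>((sqrt (real n) * (Gt n x - 1)) - sqrt (real n) * (t.Z n - 1)) / t.Z n\<bar>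
          \<le> (Dt x + Kt) / lot"
        unfolding abs_divide using elim Kt[of n] t.Z_bounds[of n] t.lo by (intro frac_le) linarith+
      moreover have "\<bar>((sqrt (real n) * (Gs n x - 1)) - sqrt (real n) * (s.Z n - 1)) / s.Z n\<bar>
          \<le> (Ds x + Ks) / los"
        unfolding abs_divide using elim Ks[of n] s.Z_bounds[of n] s.lo by (intro frac_le) linarith+
      ultimately show ?case unfolding U_eq W_def by linarith
    qed
    have W2: "integrable R (\<lambda>x. (W x)\<^sup>2)"
    proof -
      have *: "integrable R (\<lambda>x. Dt x * Ds x)"
        using t.D2 s.D2 by (rule Cauchy_Schwarz_integral(1)[rotated 2]) auto
      have "(\<lambda>x. (W x)\<^sup>2) = (\<lambda>x. (Dt x)\<^sup>2 / lot\<^sup>2 + (Ds x)\<^sup>2 / los\<^sup>2 + (Kt / lot + Ks / los)\<^sup>2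
          + 2 * (Dt x * Ds x) / (lot * los) + 2 * Dt x / lot * (Kt / lot + Ks / los)
          + 2 * Ds x / los * (Kt / lot + Ks / los))"
        unfolding W_def using t.lo s.lo by (intro ext) (simp add: field_simps power2_eq_square)
      then show ?thesis
        using * t.D2 s.D2 t.D_int s.D_int by (simp del: times_divide_eq_right times_divide_eq_left)
    qed
    show ?thesis unfolding eq
    proof (rule integral_dominated_convergence[OF _ _ _ limit])
      show "integrable R (\<lambda>x. (W x)\<^sup>2 / (los / his))" using W2 by simp
      show "AE x in R. norm ((U n x)\<^sup>2 / ?q n x) \<le> (W x)\<^sup>2 / (los / his)" for n
        using UW[of n] AE_space
      proof eventually_elim
        case (elim x)
        have "(U n x)\<^sup>2 \<le> (W x)\<^sup>2" using power_mono[OF elim(1), of 2] by simp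
        then have "(U n x)\<^sup>2 / ?q n x \<le> (W x)\<^sup>2 / (los / his)"
          using lh qb[OF elim(2), of n] by (intro frac_le) auto
        then show ?case using s.pdens_pos[OF elim(2), of n] by simp
      qed
    qed measurable
  qed
  ultimately show ?thesis unfolding m_def by (intro exI[of _ \<kappa>]) auto
qed

lemma sqrt_scaled_bound:
  assumes "\<And>u. \<bar>g u - 1\<bar> \<le> K * \<bar>u\<bar>" and "K \<ge> (0::real)"
  shows "\<bar>sqrt (real n) * (g (c / sqrt (real n)) - 1)\<bar> \<le> K * \<bar>c\<bar>"
proof (cases "n = 0")
  case False
  then have "\<bar>sqrt (real n) * (g (c / sqrt (real n)) - 1)\<bar>
      \<le> sqrt (real n) * (K * \<bar>c / sqrt (real n)\<bar>)"
    unfolding abs_mult using assms(1)[of "c / sqrt (real n)"] by (intro mult_mono) auto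
  also have "\<dots> = K * \<bar>c\<bar>" using False by (simp add: abs_divide)
  finally show ?thesis .
qed (use assms in simp)

text \<open>The difference quotient of \<open>g\<close> at 0, evaluated along \<open>c / sqrt n\<close>.\<close>

lemma sqrt_scaled_limit:
  fixes g :: "real \<Rightarrow> real"
  assumes g: "(g has_field_derivative 1) (at 0)" and g0: "g 0 = 1"
  shows "(\<lambda>n. sqrt (real n) * (g (c / sqrt (real n)) - 1)) \<longlonglongrightarrow> c"
proof (cases "c = 0")
  case False
  have 0: "(\<lambda>n. c / sqrt (real n)) \<longlonglongrightarrow> 0"
    by (intro tendsto_divide_0[OF tendsto_const] filterlim_at_top_imp_at_infinity
      filterlim_compose[OF sqrt_at_top] filterlim_real_sequentially)
  have "filterlim (\<lambda>n. c / sqrt (real n)) (at 0) sequentially"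
    using 0 False by (auto simp: filterlim_at intro!:
        eventually_mono[OF eventually_gt_at_top[of 0]])
  moreover have "((\<lambda>h. (g h - 1) / h) \<longlongrightarrow> 1) (at 0)"
    using g g0 by (simp add: DERIV_def)
  ultimately have "(\<lambda>n. (g (c / sqrt (real n)) - 1) / (c / sqrt (real n))) \<longlonglongrightarrow> 1"
    by (rule filterlim_compose[rotated])
  from tendsto_mult[OF tendsto_const[of c] this]
  have "(\<lambda>n. c * ((g (c / sqrt (real n)) - 1) / (c / sqrt (real n)))) \<longlonglongrightarrow> c" by simp
  then show ?thesis by (rule Lim_transform_eventually)
    (use False in \<open>auto intro!: eventually_mono[OF eventually_gt_at_top[of 0]]\<close>)
qed (simp add: g0)

lemma exp_scaled_limit: "(\<lambda>n. sqrt (real n) * (exp (c / sqrt (real n)) - 1)) \<longlonglongrightarrow> (c :: real)"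
  by (rule sqrt_scaled_limit) (auto intro!: derivative_eq_intros)

lemma exp_scaled_bound:
  assumes "\<bar>c\<bar> \<le> B"
  shows "\<bar>sqrt (real n) * (exp (c / sqrt (real n)) - 1)\<bar> \<le> B * exp (B :: real)"
proof (cases "n = 0")
  case False
  define u where "u = c / sqrt (real n)"
  have "1 \<le> sqrt (real n)" using False by simp
  then have "\<bar>u\<bar> \<le> \<bar>c\<bar> / 1" unfolding u_def abs_divide by (intro frac_le) auto
  then have uB: "\<bar>u\<bar> \<le> B" using assms by simp
  have "\<bar>exp u - 1\<bar> \<le> \<bar>u\<bar> * exp B"
  proof (cases "u \<ge> 0")
    case True
    have "exp u * (1 - u) \<le> exp u * exp (- u)" using exp_ge_add_one_self[of "- u"]
        by (intro mult_left_mono) auto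
    then have "exp u - 1 \<le> u * exp u" by (simp add: exp_minus algebra_simps)
    also have "\<dots> \<le> u * exp B" using True uB by (intro mult_left_mono) auto
    finally show ?thesis using True by simp
  next
    case False
    have "1 - exp u \<le> - u" using exp_ge_add_one_self[of u] by linarith
    also have "\<dots> \<le> - u * exp B" using False uB by (auto simp: mult_le_cancel_left1)
    finally show ?thesis using False by simp
  qed
  then have "\<bar>sqrt (real n) * (exp u - 1)\<bar> \<le> sqrt (real n) * (\<bar>u\<bar> * exp B)"
    unfolding abs_mult by (auto intro: mult_left_mono)
  also have "\<dots> = \<bar>c\<bar> * exp B" using False by (simp add: u_def abs_divide)
  also have "\<dots> \<le> B * exp B" using assms by simp
  finally show ?thesis by (simp add: u_def)
qed (use assms in simp)

section \<open>The complete sample\<close>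

lemma kfun_bounds: "1 / 2 \<le> kfun u" "kfun u \<le> 3 / 2"
  by (auto simp: kfun_def divide_simps add_pos_pos)

lemma kfun_0: "kfun 0 = 1" by (simp add: kfun_def)

lemma kfun_measurable[measurable]: "kfun \<in> borel_measurable borel"
  unfolding kfun_def[abs_def] by measurable

lemma kfun_deriv: "(kfun has_field_derivative 4 * exp (- 4 * u) / (1 + exp (- 4 * u))\<^sup>2) (at u)"
  unfolding kfun_def
  by (rule derivative_eq_intros refl | simp add: add_pos_pos less_imp_neq[THEN not_sym]
      power2_eq_square)+

text \<open>The derivative \<open>4 y / (1 + y)\<^sup>2\<close> with \<open>y = exp (-4 u)\<close> is at most 1 because \<open>(1 - y)\<^sup>2 \<ge> 0\<close>. The
  bound provides the envelope of the perturbed densities.\<close>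

lemma kfun_lipschitz: "\<bar>kfun u - 1\<bar> \<le> \<bar>u\<bar>"
proof -
  have "norm (kfun u - kfun 0) \<le> 1 * norm (u - 0)"
  proof (rule field_differentiable_bound[of UNIV])
    show "(kfun has_field_derivative 4 * exp (- 4 * z) / (1 + exp (- 4 * z))\<^sup>2)
        (at z within UNIV)" for z
      using kfun_deriv by simp
    show "norm (4 * exp (- 4 * z) / (1 + exp (- 4 * z))\<^sup>2) \<le> 1" for z :: real
    proof -
      define y where "y = exp (- 4 * z)"
      have "y > 0" by (simp add: y_def)
      have "4 * y \<le> (1 + y)\<^sup>2" using zero_le_power2[of "1 - y"]
          by (simp add: power2_eq_square algebra_simps)
      then have "\<bar>4 * y / (1 + y)\<^sup>2\<bar> \<le> 1" using \<open>y > 0\<close> by (simp add: abs_divide)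
      then show ?thesis by (simp add: y_def)
    qed
  qed auto
  then show ?thesis by (simp add: kfun_0)
qed

lemma kfun_scaled_bound: "\<bar>sqrt (real n) * (kfun (c / sqrt (real n)) - 1)\<bar> \<le> \<bar>c\<bar>"
  using sqrt_scaled_bound[of kfun 1 n c] kfun_lipschitz by simp

lemma kfun_scaled_limit: "(\<lambda>n. sqrt (real n) * (kfun (c / sqrt (real n)) - 1)) \<longlonglongrightarrow> c"
  using kfun_deriv[of 0] by (intro sqrt_scaled_limit kfun_0) simp

lemma law_eq_density:
  assumes [measurable]: "g \<in> borel_measurable (Rspace S)" "h \<in> borel_measurable (Rspace S)"
      "p \<in> borel_measurable (Rspace S)"
    and g: "\<And>x. x \<in> space (Rspace S) \<Longrightarrow> 0 \<le> g x"
    and h: "AE x in Rspace S. h x = g x * p x"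
  shows "law S h = density (law S g) (\<lambda>x. ennreal (p x))"
  unfolding law_def
proof (subst density_density_eq, measurable, rule density_cong)
  show "AE x in Rspace S. ennreal (h x) = ennreal (g x) * ennreal (p x)"
    using h AE_space by eventually_elim (simp add: ennreal_mult' g)
qed measurable

(* keeps the coordinate set in the form {1..d} *)
declare One_nat_def [simp del]

locale density_model =
  fixes d :: nat and f :: "(nat \<Rightarrow> real) \<Rightarrow> real"
  assumes f: "prob_density (Rspace {1..d}) f"
begin

abbreviation "E \<equiv> Rspace {1..d}"
abbreviation "P \<equiv> law {1..d} f"

lemma f_measurable[measurable]: "f \<in> borel_measurable E"
  and f_nonneg: "x \<in> space E \<Longrightarrow> 0 \<le> f x"
  and f_int: "integrable E f" "(\<integral>x. f x \<partial>E) = 1"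
proof -
  show 1: "f \<in> borel_measurable E" "x \<in> space E \<Longrightarrow> 0 \<le> f x" for x
    using f by (auto simp: prob_density_def)
  have "(\<integral>\<^sup>+ x. ennreal (f x) \<partial>E) = 1" using f by (auto simp: prob_density_def)
  with 1 show "integrable E f" "(\<integral>x. f x \<partial>E) = 1"
    by (auto intro!: integrableI_nonneg AE_I2 simp: integral_eq_nn_integral)
qed

lemma P_sets[measurable_cong]: "sets P = sets E" by (simp add: law_def)

lemma P_space: "space P = space E" by (simp add: law_def)

sublocale prob_space P
  using f by (auto intro!: prob_spaceI simp: law_def prob_density_def emeasure_density cong:
      nn_integral_cong)

lemma P_integrable: "h \<in> borel_measurable E \<Longrightarrow> integrable P h \<longleftrightarrow> integrable E (\<lambda>x. h x * f x :: real)"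
  unfolding law_def
      by (subst integrable_real_density) (auto intro!: AE_I2 f_nonneg simp: mult.commute)

lemma P_integral: "h \<in> borel_measurable E \<Longrightarrow> (\<integral>x. h x \<partial>P) = (\<integral>x. h x * f x \<partial>E)"
  unfolding law_def
      by (subst integral_real_density) (auto intro!: AE_I2 f_nonneg simp: mult.commute)

lemma X_family:
  assumes [measurable]: "\<phi> \<in> borel_measurable E" and \<phi>2: "integrable P (\<lambda>z. (\<phi> z)\<^sup>2)"
  shows "local_family P (\<lambda>n z. kfun (t * \<phi> z / sqrt (real n))) (\<lambda>z. t * \<phi> z) (\<lambda>z. \<bar>t * \<phi> z\<bar>)
      (1 / 2) (3 / 2)"
proof unfold_locales
  show "integrable P (\<lambda>x. \<bar>t * \<phi> x\<bar>\<^sup>2)" using \<phi>2 by (simp add: power_mult_distrib)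
  show "1 / 2 \<le> kfun (t * \<phi> x / sqrt (real n))" "kfun (t * \<phi> x / sqrt (real n)) \<le> 3 / 2" for n x
    by (rule kfun_bounds)+
qed (auto intro: kfun_scaled_limit kfun_scaled_bound)

lemma X_law:
  assumes [measurable]: "\<phi> \<in> borel_measurable E" and \<phi>2: "integrable P (\<lambda>z. (\<phi> z)\<^sup>2)"
  shows "law {1..d} (local_density d f \<phi> n t)
      = density P (\<lambda>x. ennreal (local_family.pdens P (\<lambda>n z. kfun (t * \<phi> z / sqrt (real n))) n x))"
    (is "_ = density P (\<lambda>x. ennreal (local_family.pdens P ?G n x))")
proof -
  interpret X: local_family P ?G "\<lambda>z. t * \<phi> z" "\<lambda>z. \<bar>t * \<phi> z\<bar>" "1 / 2" "3 / 2"
    by (rule X_family) fact+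
  have "X.Z n = (\<integral>y. ?G n y * f y \<partial>E)" unfolding X.Z_def by (subst P_integral) auto
  then have "local_density d f \<phi> n t x = f x * X.pdens n x" for x
    by (simp add: local_density_def perturbed_def X.pdens_def)
  moreover have [measurable]: "X.pdens n \<in> borel_measurable E"
    using X.pdens_measurable[of n] by (simp cong: measurable_cong_sets add: P_sets)
  moreover have "(\<lambda>x. f x * X.pdens n x) \<in> borel_measurable E" by measurable
  ultimately show ?thesis
    by (intro law_eq_density) (auto simp: f_nonneg cong: measurable_cong)
qed

text \<open>The functional at the perturbed density, centred at its value at \<open>f\<close>, is the integral of
  \<open>(a - \<theta>) (G - 1)\<close> divided by the normalising constant, so that its rescaled limit is \<open>t\<close> times
  the covariance of \<open>a\<close> and \<open>\<phi>\<close>.\<close>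

lemma theta_limit:
  assumes [measurable]: "\<phi> \<in> borel_measurable E" "a \<in> borel_measurable E"
    and \<phi>2: "integrable P (\<lambda>z. (\<phi> z)\<^sup>2)" and a2: "integrable P (\<lambda>z. (a z)\<^sup>2)"
    and \<phi>0: "(\<integral>z. \<phi> z \<partial>P) = 0"
  shows "(\<lambda>n. sqrt (real n) * (theta d a (local_density d f \<phi> n t) - theta d a f))
    \<longlonglongrightarrow> t * (\<integral>z. a z * \<phi> z \<partial>P)"
proof -
  let ?G = "\<lambda>n z. kfun (t * \<phi> z / sqrt (real n))"
  interpret X: local_family P ?G "\<lambda>z. t * \<phi> z" "\<lambda>z. \<bar>t * \<phi> z\<bar>" "1 / 2" "3 / 2"
    by (rule X_family) fact+
  define th where "th = theta d a f"
  have th: "th = (\<integral>z. a z \<partial>P)" unfolding th_def theta_def by (simp add: P_integral)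
  have ia: "integrable P a" by (rule square_integrable_integrable[OF prob_space_axioms _ a2])
      measurable
  have i\<phi>: "integrable P \<phi>" by (rule square_integrable_integrable[OF prob_space_axioms _ \<phi>2])
      measurable
  have iaG: "integrable P (\<lambda>z. a z * ?G n z)" for n
  proof (rule Bochner_Integration.integrable_bound)
    show "integrable P (\<lambda>z. 3 / 2 * a z)" using ia by simp
    show "AE z in P. norm (a z * ?G n z) \<le> norm (3 / 2 * a z)"
    proof (rule AE_I2)
      fix z
      have "\<bar>a z\<bar> * \<bar>?G n z\<bar> \<le> \<bar>a z\<bar> * (3 / 2)"
        using kfun_bounds[of "t * \<phi> z / sqrt (real n)"] by (intro mult_left_mono) auto
      then show "norm (a z * ?G n z) \<le> norm (3 / 2 * a z)" by (simp add: abs_mult)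
    qed
  qed measurable
  have th_n: "theta d a (local_density d f \<phi> n t) = (\<integral>z. a z * ?G n z \<partial>P) / X.Z n" for n
  proof -
    have "theta d a (local_density d f \<phi> n t) = (\<integral>z. (a z * ?G n z) * f z / X.Z n \<partial>E)"
      unfolding theta_def local_density_def perturbed_def X.Z_def
      by (subst P_integral, measurable, intro Bochner_Integration.integral_cong refl) simp
    then show ?thesis by (simp add: P_integral)
  qed
  have eq: "sqrt (real n) * (theta d a (local_density d f \<phi> n t) - th)
      = (\<integral>z. (a z - th) * (sqrt (real n) * (?G n z - 1)) \<partial>P) / X.Z n" for n
  proof -
    have "(\<integral>z. (a z - th) * (sqrt (real n) * (?G n z - 1)) \<partial>P)
        = (\<integral>z. sqrt (real n) * (a z * ?G n z - th * ?G n z - (a z - th)) \<partial>P)"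
      by (intro Bochner_Integration.integral_cong refl) (simp add: algebra_simps)
    also have "\<dots> = sqrt (real n) * ((\<integral>z. a z * ?G n z \<partial>P) - th * X.Z n)"
      using iaG X.G_int ia th prob_space by (simp add: X.Z_def)
    finally show ?thesis unfolding th_n using X.Z_pos[of n] by (simp add: field_simps)
  qed
  have "integrable P (\<lambda>z. (a z - th)\<^sup>2)"
    using a2 ia by (simp add: power2_diff)
  then have "(\<lambda>n. (\<integral>z. (a z - th) * (sqrt (real n) * (?G n z - 1)) \<partial>P) / X.Z n)
      \<longlonglongrightarrow> (\<integral>z. (a z - th) * (t * \<phi> z) \<partial>P) / 1"
    by (intro tendsto_divide X.expectation_lim X.Z_lim) auto
  moreover have "(\<integral>z. (a z - th) * (t * \<phi> z) \<partial>P) = t * (\<integral>z. a z * \<phi> z \<partial>P)"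
  proof -
    have "integrable P (\<lambda>z. a z * \<phi> z)"
      by (rule Cauchy_Schwarz_integral(1)) (use a2 \<phi>2 in auto)
    moreover have "(\<integral>z. (a z - th) * (t * \<phi> z) \<partial>P) = (\<integral>z. t * (a z * \<phi> z) - t * th * \<phi> z \<partial>P)"
      by (intro Bochner_Integration.integral_cong refl) (simp add: algebra_simps)
    ultimately show ?thesis using i\<phi> \<phi>0 by simp
  qed
  ultimately show ?thesis unfolding th_def[symmetric] eq by simp
qed

lemma X_chi2:
  assumes \<phi>: "sq_integrable P \<phi>" and \<phi>0: "(\<integral>x. \<phi> x \<partial>P) = 0"
  shows "\<exists>\<kappa>. (\<forall>n. chi2_le (law {1..d} (local_density d f \<phi> n s))
      (law {1..d} (local_density d f \<phi> n t)) (ennreal (1 + \<kappa> n))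
        \<and> \<kappa> n \<ge> 0) \<and> (\<lambda>n. real n * \<kappa> n) \<longlonglongrightarrow> (t - s)\<^sup>2 * (\<integral>x. (\<phi> x)\<^sup>2 \<partial>P)"
proof -
  have \<phi>m[measurable]: "\<phi> \<in> borel_measurable E" and \<phi>2: "integrable P (\<lambda>z. (\<phi> z)\<^sup>2)"
    using \<phi> by (auto simp: sq_integrable_def)
  have m: "(\<integral>y. t * \<phi> y - s * \<phi> y \<partial>P) = 0"
    unfolding left_diff_distrib[symmetric] by (simp add: \<phi>0)
  have "(\<integral>x. (t * \<phi> x - s * \<phi> x - (\<integral>y. t * \<phi> y - s * \<phi> y \<partial>P))\<^sup>2 \<partial>P) = (\<integral>x. (t - s)\<^sup>2 * (\<phi> x)\<^sup>2 \<partial>P)"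
    unfolding m by (intro Bochner_Integration.integral_cong refl)
      (simp only: left_diff_distrib[symmetric] diff_0_right power_mult_distrib)
  then have V: "(\<integral>x. (t * \<phi> x - s * \<phi> x - (\<integral>y. t * \<phi> y - s * \<phi> y \<partial>P))\<^sup>2 \<partial>P)
      = (t - s)\<^sup>2 * (\<integral>x. (\<phi> x)\<^sup>2 \<partial>P)"
    by simp
  show ?thesis
    using local_chi2[OF X_family[OF \<phi>m \<phi>2, of s] X_family[OF \<phi>m \<phi>2, of t]]
        unfolding V X_law[OF \<phi>m \<phi>2] .
qed

lemma X_prob:
  assumes "sq_integrable P \<phi>" shows "prob_space (law {1..d} (local_density d f \<phi> n t))"
proof -
  have \<phi>m: "\<phi> \<in> borel_measurable E" and \<phi>2: "integrable P (\<lambda>z. (\<phi> z)\<^sup>2)"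
    using assms by (auto simp: sq_integrable_def)
  show ?thesis unfolding X_law[OF \<phi>m \<phi>2] by (rule local_family.pdens_prob[OF X_family[OF \<phi>m \<phi>2]])
qed

end

section \<open>Conditioning on a block of coordinates\<close>

text \<open>Points of the full space are pairs of a point of \<open>\<real>\<^sup>S\<close> and a point of the complementary block,
  and integration over the second component is the operator \<open>m\<close>.\<close>

locale marginal_model = density_model +
  fixes S :: "nat set"
  assumes S: "S \<subseteq> {1..d}"
begin

abbreviation "C \<equiv> {1..d} - S"
abbreviation "m g \<equiv> marginal d g S"
abbreviation "PS \<equiv> law S (marginal d f S)"

sublocale lb: product_sigma_finite "\<lambda>_::nat. lborel :: real measure" by standard

lemma sigma_finite_blocks: "sigma_finite_measure (Rspace S)" "sigma_finite_measure (Rspace C)"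
  unfolding Rspace_def using S finite_subset[OF S] by (auto intro!: lb.sigma_finite)

lemma merge_measurable[measurable]: "merge S C \<in> measurable (Rspace S \<Otimes>\<^sub>M Rspace C) E"
  using measurable_merge[of S C "\<lambda>_. lborel"] S by (simp add: Rspace_def Un_absorb1)

lemma restrict_measurable[measurable]: "(\<lambda>x. restrict x S) \<in> measurable E (Rspace S)"
  unfolding Rspace_def by (rule measurable_restrict_subset[OF S])

lemma merge_space: "x \<in> space (Rspace S) \<Longrightarrow> y \<in> space (Rspace C) \<Longrightarrow> merge S C (x, y) \<in> space E"
  using measurable_space[OF merge_measurable, of "(x, y)"] by (simp add: space_pair_measure)

lemma restrict_merge: "x \<in> space (Rspace S) \<Longrightarrow> restrict (merge S C (x, y)) S = x"
  by (auto simp: Rspace_def space_PiM PiE_restrict)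

lemma slice_measurable[measurable]:
  assumes "g \<in> borel_measurable E" "x \<in> space (Rspace S)"
  shows "(\<lambda>y. g (merge S C (x, y))) \<in> borel_measurable (Rspace C)"
  using assms by measurable

lemma m_measurable[measurable]:
  fixes g :: "(nat \<Rightarrow> real) \<Rightarrow> real"
  assumes [measurable]: "g \<in> borel_measurable E" shows "m g \<in> borel_measurable (Rspace S)"
proof -
  interpret C: sigma_finite_measure "Rspace C" by (rule sigma_finite_blocks)
  show ?thesis unfolding marginal_def[abs_def] by measurable
qed

lemma
  fixes g :: "(nat \<Rightarrow> real) \<Rightarrow> real"
  assumes g: "integrable E g"
  shows slice_integrable: "AE x in Rspace S. integrable (Rspace C) (\<lambda>y. g (merge S C (x, y)))"
    and m_integrable: "integrable (Rspace S) (m g)"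
    and m_integral: "(\<integral>x. m g x \<partial>Rspace S) = (\<integral>x. g x \<partial>E)"
proof -
  interpret pair_sigma_finite "Rspace S" "Rspace C"
    by (intro pair_sigma_finite.intro sigma_finite_blocks)
  have SC: "S \<inter> C = {}" "S \<union> C = {1..d}" "finite S" "finite C" using S finite_subset[OF S] by auto
  have [measurable]: "g \<in> borel_measurable E" using g by auto
  have D: "distr (Rspace S \<Otimes>\<^sub>M Rspace C) E (merge S C) = E"
    using lb.distr_merge[of S C] SC by (simp add: Rspace_def)
  have gi: "integrable (Rspace S \<Otimes>\<^sub>M Rspace C) (\<lambda>z. g (merge S C z))"
    by (rule integrable_distr[OF merge_measurable]) (simp add: D g)
  show "AE x in Rspace S. integrable (Rspace C) (\<lambda>y. g (merge S C (x, y)))"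
    by (rule AE_integrable_fst'[OF gi])
  show "integrable (Rspace S) (m g)"
    unfolding marginal_def[abs_def] by (rule integrable_fst'[OF gi])
  have "(\<integral>x. m g x \<partial>Rspace S) = (\<integral>z. g (merge S C z) \<partial>(Rspace S \<Otimes>\<^sub>M Rspace C))"
    unfolding marginal_def[abs_def] by (rule integral_fst'[OF gi])
  also have "\<dots> = (\<integral>x. g x \<partial>E)"
    using integral_distr[OF merge_measurable, of g] by (simp add: D)
  finally show "(\<integral>x. m g x \<partial>Rspace S) = (\<integral>x. g x \<partial>E)" .
qed

lemma m_nonneg: "(\<And>z. z \<in> space E \<Longrightarrow> 0 \<le> g z) \<Longrightarrow> x \<in> space (Rspace S) \<Longrightarrow> 0 \<le> m g x"
  unfolding marginal_def by (intro integral_nonneg_AE AE_I2) (simp add: merge_space)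

lemma m_mult:
  assumes x: "x \<in> space (Rspace S)"
  shows "m (\<lambda>z. \<phi> (restrict z S) * g z) x = \<phi> x * m g x"
  unfolding marginal_def using restrict_merge[OF x] by simp

lemma PS_distr: "PS = distr P (Rspace S) (\<lambda>x. restrict x S)"
  by (rule distr_law_marginal[OF f S, symmetric])

lemma PS_sets[measurable_cong]: "sets PS = sets (Rspace S)" by (simp add: law_def)

lemma PS_space: "space PS = space (Rspace S)" by (simp add: law_def)

lemma PS_prob: "prob_space PS"
  unfolding PS_distr by (intro prob_space_distr) measurable

lemma PS_integrable: "h \<in> borel_measurable (Rspace S) \<Longrightarrow>
    integrable PS h \<longleftrightarrow> integrable P (\<lambda>x. h (restrict x S) :: real)"
  unfolding PS_distr by (rule integrable_distr_eq) measurable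

lemma PS_integral: "h \<in> borel_measurable (Rspace S) \<Longrightarrow>
    (\<integral>x. h x \<partial>PS) = (\<integral>x. h (restrict x S) \<partial>P :: real)"
  unfolding PS_distr by (rule integral_distr) measurable

lemma mf_nonneg: "x \<in> space (Rspace S) \<Longrightarrow> 0 \<le> m f x"
  by (rule m_nonneg[OF f_nonneg])

lemma PS_integrable_density: "h \<in> borel_measurable (Rspace S) \<Longrightarrow>
    integrable PS h \<longleftrightarrow> integrable (Rspace S) (\<lambda>x. m f x * h x :: real)"
  unfolding law_def by (subst integrable_real_density) (auto intro!: AE_I2 mf_nonneg)

lemma PS_integral_density: "h \<in> borel_measurable (Rspace S) \<Longrightarrow>
    (\<integral>x. h x \<partial>PS) = (\<integral>x. m f x * h x \<partial>Rspace S :: real)"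
  unfolding law_def by (subst integral_real_density) (auto intro!: AE_I2 mf_nonneg)

text \<open>A version of the conditional expectation of \<open>h(X)\<close> given \<open>X\<^sub>S\<close>, as a function on \<open>\<real>\<^sup>S\<close>. It is 0
  where the marginal density vanishes. Being an explicit ratio of integrals, it admits pointwise
  dominated convergence.\<close>

definition cond :: "((nat \<Rightarrow> real) \<Rightarrow> real) \<Rightarrow> (nat \<Rightarrow> real) \<Rightarrow> real" where
  "cond h x = m (\<lambda>z. h z * f z) x / m f x"

lemma cond_measurable[measurable]:
  "h \<in> borel_measurable E \<Longrightarrow> cond h \<in> borel_measurable (Rspace S)"
  unfolding cond_def[abs_def]
  by (intro borel_measurable_divide m_measurable borel_measurable_times f_measurable)

text \<open>Where the marginal density is 0, the nonnegative slice of \<open>f\<close> vanishes almost everywhere, and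
  with it the slice of \<open>h f\<close>.\<close>

lemma mult_cond:
  assumes h[measurable]: "h \<in> borel_measurable E"
  shows "AE x in Rspace S. m f x * cond h x = m (\<lambda>z. h z * f z) x"
  using slice_integrable[OF f_int(1)] AE_space
proof eventually_elim
  case (elim x)
  show ?case
  proof (cases "m f x = 0")
    case True
    have "AE y in Rspace C. f (merge S C (x, y)) = 0"
      using True elim unfolding marginal_def
      by (subst (asm) integral_nonneg_eq_0_iff_AE) (auto intro!: AE_I2 f_nonneg merge_space)
    then have "m (\<lambda>z. h z * f z) x = (\<integral>y. 0 \<partial>Rspace C)"
      unfolding marginal_def
          using slice_measurable[OF h elim(2)] slice_measurable[OF f_measurable elim(2)]
      by (intro integral_cong_AE) auto
    then show ?thesis using True by simp
  qed (simp add: cond_def)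
qed

text \<open>The defining property of a conditional expectation: integrate \<open>m (h f \<phi>) = \<phi> m (h f)\<close> over \<open>\<real>\<^sup>S\<close>.\<close>

lemma
  assumes [measurable]: "h \<in> borel_measurable E" "\<phi> \<in> borel_measurable (Rspace S)"
    and i: "integrable P (\<lambda>x. h x * \<phi> (restrict x S))"
  shows cond_integrable: "integrable PS (\<lambda>x. cond h x * \<phi> x)"
    and cond_integral: "(\<integral>x. cond h x * \<phi> x \<partial>PS) = (\<integral>x. h x * \<phi> (restrict x S) \<partial>P)"
proof -
  have g: "integrable E (\<lambda>x. \<phi> (restrict x S) * (h x * f x))"
    using i by (subst (asm) P_integrable) (auto simp: ac_simps)
  have eq: "AE x in Rspace S. m f x * (cond h x * \<phi> x) = m (\<lambda>x. \<phi> (restrict x S) * (h x * f x)) x"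
    using mult_cond[OF assms(1)] AE_space
  proof eventually_elim
    case (elim x)
    show ?case unfolding m_mult[OF elim(2), of \<phi> "\<lambda>x. h x * f x"] elim(1)[symmetric]
        by (simp add: ac_simps)
  qed
  show "integrable PS (\<lambda>x. cond h x * \<phi> x)"
    using m_integrable[OF g] eq
        by (subst PS_integrable_density, measurable, subst integrable_cong_AE) auto
  have "(\<integral>x. cond h x * \<phi> x \<partial>PS) = (\<integral>x. m (\<lambda>x. \<phi> (restrict x S) * (h x * f x)) x \<partial>Rspace S)"
    using eq by (subst PS_integral_density, measurable, intro integral_cong_AE) auto
  also have "\<dots> = (\<integral>x. h x * \<phi> (restrict x S) \<partial>P)"
    by (subst m_integral[OF g], subst P_integral) (auto simp: ac_simps)
  finally show "(\<integral>x. cond h x * \<phi> x \<partial>PS) = (\<integral>x. h x * \<phi> (restrict x S) \<partial>P)" .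
qed

text \<open>Almost every \<open>X\<^sub>S\<close> lies where conditional expectations behave as ordinary integrals.\<close>

lemma PS_AE_slice:
  assumes g: "integrable P h" and [measurable]: "h \<in> borel_measurable E"
  shows "AE x in PS. 0 < m f x
      \<and> integrable (Rspace C) (\<lambda>y. h (merge S C (x, y)) * f (merge S C (x, y)))"
proof -
  have "integrable E (\<lambda>x. h x * f x)" using g by (simp add: P_integrable)
  from slice_integrable[OF this] show ?thesis
    unfolding law_def by (subst AE_density) auto
qed

text \<open>Jensen's inequality for the square, from the nonnegativity of the conditional variance.\<close>

lemma cond_sq_le:
  assumes [measurable]: "h \<in> borel_measurable E" and h2: "integrable P (\<lambda>x. (h x)\<^sup>2)"
  shows "AE x in PS. (cond h x)\<^sup>2 \<le> cond (\<lambda>z. (h z)\<^sup>2) x"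
proof -
  have "integrable P h" by (rule square_integrable_integrable[OF prob_space_axioms _ h2]) simp
  from PS_AE_slice[OF this] PS_AE_slice[OF h2] PS_AE_slice[of "\<lambda>_. 1"]
  have "AE x in PS. 0 < m f x
      \<and> integrable (Rspace C) (\<lambda>y. h (merge S C (x, y)) * f (merge S C (x, y)))
      \<and> integrable (Rspace C) (\<lambda>y. (h (merge S C (x, y)))\<^sup>2 * f (merge S C (x, y)))
      \<and> integrable (Rspace C) (\<lambda>y. f (merge S C (x, y)))" by auto
  then show ?thesis using AE_space
  proof eventually_elim
    case (elim x)
    let ?A = "cond h x" and ?f = "\<lambda>y. f (merge S C (x, y))" and ?h = "\<lambda>y. h (merge S C (x, y))"
    have x: "x \<in> space (Rspace S)" using elim(2) by (simp add: PS_space)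
    have mh: "m (\<lambda>z. h z * f z) x = ?A * m f x" using elim(1) by (simp add: cond_def)
    have "0 \<le> (\<integral>y. (?h y - ?A)\<^sup>2 * ?f y \<partial>Rspace C)"
      by (intro integral_nonneg_AE AE_I2) (auto intro!: mult_nonneg_nonneg f_nonneg merge_space x)
    also have "\<dots> = (\<integral>y. (?h y)\<^sup>2 * ?f y - 2 * ?A * (?h y * ?f y) + ?A\<^sup>2 * ?f y \<partial>Rspace C)"
      by (intro Bochner_Integration.integral_cong refl) (simp add: power2_diff algebra_simps)
    also have "\<dots> = m (\<lambda>z. (h z)\<^sup>2 * f z) x - 2 * ?A * m (\<lambda>z. h z * f z) x + ?A\<^sup>2 * m f x"
      using elim(1) unfolding marginal_def by simp
    also have "\<dots> = m (\<lambda>z. (h z)\<^sup>2 * f z) x - ?A\<^sup>2 * m f x"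
      unfolding mh by (simp add: power2_eq_square)
    finally show ?case using elim(1) by (simp add: cond_def field_simps)
  qed
qed

lemma cond_sq_integrable:
  assumes [measurable]: "h \<in> borel_measurable E" and h2: "integrable P (\<lambda>x. (h x)\<^sup>2)"
  shows "integrable PS (\<lambda>x. (cond h x)\<^sup>2)"
proof (rule Bochner_Integration.integrable_bound)
  show "integrable PS (\<lambda>x. cond (\<lambda>z. (h z)\<^sup>2) x)"
    using cond_integrable[of "\<lambda>z. (h z)\<^sup>2" "\<lambda>_. 1"] h2 by simp
  show "AE x in PS. norm ((cond h x)\<^sup>2) \<le> norm (cond (\<lambda>z. (h z)\<^sup>2) x)"
    using cond_sq_le[OF assms] by eventually_elim auto
qed measurable

lemma cond_dominated_lim:
  assumes [measurable]: "\<And>n. h n \<in> borel_measurable E" "g \<in> borel_measurable E" "D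
      \<in> borel_measurable E"
    and D: "integrable P D"
    and lim: "\<And>z. z \<in> space E \<Longrightarrow> (\<lambda>n. h n z) \<longlonglongrightarrow> g z"
    and bound: "\<And>n z. z \<in> space E \<Longrightarrow> \<bar>h n z\<bar> \<le> D z"
  shows "AE x in PS. (\<lambda>n. cond (h n) x) \<longlonglongrightarrow> cond g x"
    and "AE x in PS. \<forall>n. \<bar>cond (h n) x\<bar> \<le> cond D x"
proof -
  have fm[measurable]: "(\<lambda>y. f (merge S C (x, y))) \<in> borel_measurable (Rspace C)"
    and hm[measurable]: "(\<lambda>y. h n (merge S C (x, y))) \<in> borel_measurable (Rspace C)"
    and gm[measurable]: "(\<lambda>y. g (merge S C (x, y))) \<in> borel_measurable (Rspace C)"
    if "x \<in> space (Rspace S)" for x n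
    using that by (auto intro: slice_measurable)
  have dom: "norm (h n (merge S C (x, y)) * f (merge S C (x, y)))
      \<le> D (merge S C (x, y)) * f (merge S C (x, y))"
    if "x \<in> space (Rspace S)" "y \<in> space (Rspace C)" for x y n
    using bound[OF merge_space[OF that], of n] f_nonneg[OF merge_space[OF that]]
    by (simp add: abs_mult mult_right_mono)
  show "AE x in PS. (\<lambda>n. cond (h n) x) \<longlonglongrightarrow> cond g x"
    using PS_AE_slice[OF D assms(3)] AE_space
  proof eventually_elim
    case (elim x)
    then have x: "x \<in> space (Rspace S)" by (simp add: PS_space)
    note [measurable] = fm[OF x] hm[OF x] gm[OF x]
    have "(\<lambda>n. m (\<lambda>z. h n z * f z) x) \<longlonglongrightarrow> m (\<lambda>z. g z * f z) x"
      unfolding marginal_def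
    proof (rule integral_dominated_convergence)
      show "integrable (Rspace C) (\<lambda>y. D (merge S C (x, y)) * f (merge S C (x, y)))" using elim
          by simp
      show "AE y in Rspace C. (\<lambda>n. h n (merge S C (x, y)) * f (merge S C (x, y)))
          \<longlonglongrightarrow> g (merge S C (x, y)) * f (merge S C (x, y))"
        by (intro AE_I2 tendsto_intros lim merge_space x)
      show "AE y in Rspace C. norm (h n (merge S C (x, y)) * f (merge S C (x, y)))
          \<le> D (merge S C (x, y)) * f (merge S C (x, y))" for n
        by (intro AE_I2 dom x)
    qed measurable
    then show ?case unfolding cond_def using elim by (intro tendsto_divide tendsto_const) auto
  qed
  show "AE x in PS. \<forall>n. \<bar>cond (h n) x\<bar> \<le> cond D x"
    using PS_AE_slice[OF D assms(3)] AE_space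
  proof eventually_elim
    case (elim x)
    then have x: "x \<in> space (Rspace S)" by (simp add: PS_space)
    note [measurable] = fm[OF x] hm[OF x]
    have "\<bar>m (\<lambda>z. h n z * f z) x\<bar> \<le> m (\<lambda>z. D z * f z) x" for n
    proof -
      have "norm (m (\<lambda>z. h n z * f z) x) \<le> m (\<lambda>z. D z * f z) x"
        unfolding marginal_def
      proof (rule order_trans[OF integral_norm_bound integral_mono])
        show D': "integrable (Rspace C) (\<lambda>y. D (merge S C (x, y)) * f (merge S C (x, y)))"
            using elim by simp
        show *: "norm (h n (merge S C (x, y)) * f (merge S C (x, y)))
            \<le> D (merge S C (x, y)) * f (merge S C (x, y))"
          if "y \<in> space (Rspace C)" for y by (rule dom[OF x that])
        show "integrable (Rspace C) (\<lambda>y. norm (h n (merge S C (x, y)) * f (merge S C (x, y))))"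
        proof (rule Bochner_Integration.integrable_bound[OF D'])
          show "AE y in Rspace C. norm (norm (h n (merge S C (x, y)) * f (merge S C (x, y))))
              \<le> norm (D (merge S C (x, y)) * f (merge S C (x, y)))"
            using order_trans[OF * abs_ge_self] by (intro AE_I2) simp
        qed measurable
      qed
      then show ?thesis by simp
    qed
    then show ?case using elim by (auto simp: cond_def abs_divide intro!: divide_right_mono)
  qed
qed

lemma sq_measurable: "sq_integrable P h \<Longrightarrow> h \<in> borel_measurable E"
  unfolding sq_integrable_def measurable_cong_sets[OF P_sets refl] by simp

text \<open>The factor is \<open>\<alpha>\<close> itself, with an arbitrary fixed point inserted in the complementary block.\<close>

lemma depends_on_S_factor:
  fixes \<alpha> :: "(nat \<Rightarrow> real) \<Rightarrow> real"
  assumes [measurable]: "\<alpha> \<in> borel_measurable E"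
    and dep: "\<And>x y. x \<in> space E \<Longrightarrow> y \<in> space E \<Longrightarrow> restrict x S = restrict y S \<Longrightarrow> \<alpha> x = \<alpha> y"
  obtains \<rho> where "\<rho> \<in> borel_measurable (Rspace S)" "\<And>x. x \<in> space E \<Longrightarrow> \<alpha> x = \<rho> (restrict x S)"
proof
  define y0 :: "nat \<Rightarrow> real" where "y0 = (\<lambda>_\<in>C. 0)"
  have y0: "y0 \<in> space (Rspace C)" by (simp add: y0_def Rspace_def space_PiM)
  show "(\<lambda>x. \<alpha> (merge S C (x, y0))) \<in> borel_measurable (Rspace S)"
    using measurable_compose[OF measurable_Pair2'[OF y0] measurable_compose[OF merge_measurable
        assms(1)]] .
  show "\<alpha> x = \<alpha> (merge S C (restrict x S, y0))" if x: "x \<in> space E" for x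
  proof (rule dep[OF x])
    have r: "restrict x S \<in> space (Rspace S)" using measurable_space[OF restrict_measurable x] .
    show "merge S C (restrict x S, y0) \<in> space E" by (rule merge_space[OF r y0])
    show "restrict x S = restrict (merge S C (restrict x S, y0)) S" using restrict_merge[OF r]
        by simp
  qed
qed

lemma cond_tower:
  assumes h: "sq_integrable P h" and \<rho>: "sq_integrable P \<rho>"
    and dep: "\<And>x y. x \<in> space E \<Longrightarrow> y \<in> space E \<Longrightarrow> restrict x S = restrict y S \<Longrightarrow> \<rho> x = \<rho> y"
  shows "(\<integral>x. \<rho> x * cond h (restrict x S) \<partial>P) = (\<integral>x. \<rho> x * h x \<partial>P)"
proof -
  have [measurable]: "h \<in> borel_measurable E" and \<rho>m: "\<rho> \<in> borel_measurable E"
    using sq_measurable[OF h] sq_measurable[OF \<rho>] by auto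
  obtain \<rho>' where [measurable]: "\<rho>' \<in> borel_measurable (Rspace S)"
    and \<rho>': "\<And>x. x \<in> space E \<Longrightarrow> \<rho> x = \<rho>' (restrict x S)"
    using depends_on_S_factor[OF \<rho>m dep] by metis
  have i: "integrable P (\<lambda>x. h x * \<rho>' (restrict x S))"
    using sq_integrable_mult[OF h \<rho>]
    by (subst Bochner_Integration.integrable_cong[OF refl]) (auto simp: P_space \<rho>')
  have "(\<integral>x. \<rho> x * cond h (restrict x S) \<partial>P) = (\<integral>x. cond h (restrict x S) * \<rho>' (restrict x S) \<partial>P)"
    by (intro Bochner_Integration.integral_cong refl) (simp add: P_space \<rho>' mult.commute)
  also have "\<dots> = (\<integral>x. cond h x * \<rho>' x \<partial>PS)" by (subst PS_integral) auto
  also have "\<dots> = (\<integral>x. h x * \<rho>' (restrict x S) \<partial>P)" by (rule cond_integral[OF _ _ i]) measurable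
  also have "\<dots> = (\<integral>x. \<rho> x * h x \<partial>P)"
    by (intro Bochner_Integration.integral_cong refl) (simp add: P_space \<rho>' mult.commute)
  finally show ?thesis .
qed

lemma cond_sq_integrable_P:
  assumes h: "sq_integrable P h" shows "sq_integrable P (\<lambda>x. cond h (restrict x S))"
proof -
  have [measurable]: "h \<in> borel_measurable E" by (rule sq_measurable[OF h])
  have "integrable PS (\<lambda>x. (cond h x)\<^sup>2)"
    using h by (intro cond_sq_integrable \<open>h \<in> borel_measurable E\<close>) (auto simp: sq_integrable_def)
  then have "integrable P (\<lambda>x. (cond h (restrict x S))\<^sup>2)" by (subst (asm) PS_integrable) auto
  then show ?thesis by (simp add: sq_integrable_def)
qed

end

section \<open>The incomplete samples\<close>

text \<open>Bounded \<open>\<Psi>\<^sub>S\<close> make every tilt bounded away from 0 and infinity.\<close>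

lemma lin_comb_bounded:
  assumes "\<And>j. j \<in> {1..k} \<Longrightarrow> bounded (psi j ` X)"
  shows "\<exists>B\<ge>0. \<forall>x\<in>X. \<bar>lin_comb k u psi x\<bar> \<le> B"
proof -
  have "\<exists>B. \<forall>x\<in>X. \<bar>psi j x\<bar> \<le> B" if "j \<in> {1..k}" for j
    using assms[OF that] by (auto simp: bounded_iff)
  then obtain b where b: "\<And>j x. j \<in> {1..k} \<Longrightarrow> x \<in> X \<Longrightarrow> \<bar>psi j x\<bar> \<le> b j" by metis
  show ?thesis
  proof (intro exI[of _ "\<Sum>j=1..k. \<bar>u j\<bar> * \<bar>b j\<bar>"] conjI ballI)
    fix x assume x: "x \<in> X"
    have "\<bar>lin_comb k u psi x\<bar> \<le> (\<Sum>j=1..k. \<bar>u j * psi j x\<bar>)"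
      unfolding lin_comb_def by (rule sum_abs)
    also have "\<dots> \<le> (\<Sum>j=1..k. \<bar>u j\<bar> * \<bar>b j\<bar>)"
      unfolding abs_mult
          by (intro sum_mono mult_left_mono order_trans[OF b[OF _ x] abs_ge_self]) auto
    finally show "\<bar>lin_comb k u psi x\<bar> \<le> (\<Sum>j=1..k. \<bar>u j\<bar> * \<bar>b j\<bar>)" .
  qed (auto intro: sum_nonneg)
qed

lemma lin_comb_measurable[measurable (raw)]:
  "(\<And>j. j \<in> {1..k} \<Longrightarrow> psi j \<in> borel_measurable M) \<Longrightarrow> lin_comb k u psi \<in> borel_measurable M"
  unfolding lin_comb_def[abs_def] by (intro borel_measurable_sum borel_measurable_times) auto

text \<open>\<open>R\<close> is the distribution of one incomplete observation in the unperturbed model.\<close>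

locale tilted_model = marginal_model +
  fixes k :: nat and psi :: "nat \<Rightarrow> (nat \<Rightarrow> real) \<Rightarrow> real" and w :: "nat \<Rightarrow> real"
  assumes psi: "\<And>j. j \<in> {1..k} \<Longrightarrow> psi j \<in> borel_measurable (Rspace S)"
    and psi_bounded: "\<And>j. j \<in> {1..k} \<Longrightarrow> bounded (psi j ` space (Rspace S))"
begin

abbreviation "rbar \<equiv> normalised_tilt d f S k w psi"
abbreviation "R \<equiv> law S (\<lambda>x. rbar x * marginal d f S x)"

lemma lc_measurable[measurable]: "lin_comb k u psi \<in> borel_measurable (Rspace S)"
  by (rule lin_comb_measurable[OF psi])

lemma tilt_measurable[measurable]: "tilt k u psi \<in> borel_measurable (Rspace S)"
  unfolding tilt_def[abs_def] by measurable

lemma rbar_measurable[measurable]: "normalised_tilt d g S k u psi \<in> borel_measurable (Rspace S)"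
  unfolding normalised_tilt_def[abs_def] by measurable

definition W where "W = (\<integral>y. tilt k w psi y * m f y \<partial>Rspace S)"

lemma W: "W = (\<integral>y. tilt k w psi y \<partial>PS)"
  unfolding W_def by (subst PS_integral_density) (simp_all add: mult.commute)

lemma tilt_bounds: "\<exists>B\<ge>0. \<forall>x\<in>space (Rspace S). exp (- B) \<le> tilt k u psi x \<and> tilt k u psi x \<le> exp B"
proof -
  obtain B where "B \<ge> 0" "\<And>x. x \<in> space (Rspace S) \<Longrightarrow> \<bar>lin_comb k u psi x\<bar> \<le> B"
    using lin_comb_bounded[of k psi, OF psi_bounded] by blast
  then show ?thesis by (intro exI[of _ B]) (force simp: tilt_def abs_le_iff)
qed

lemma tilt_int: "integrable PS (tilt k u psi)"
proof -
  interpret PS: prob_space PS by (rule PS_prob)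
  obtain B where "\<And>x. x \<in> space (Rspace S) \<Longrightarrow> tilt k u psi x \<le> exp B"
    using tilt_bounds[of u] by blast
  then show ?thesis
    by (intro PS.integrable_const_bound[of _ "exp B"] AE_I2) (auto simp: PS_space tilt_def)
qed

lemma rbar_bounds:
  obtains lo hi where "0 < lo" "\<And>x. x \<in> space (Rspace S) \<Longrightarrow> lo \<le> rbar x"
    "\<And>x. x \<in> space (Rspace S) \<Longrightarrow> rbar x \<le> hi" and "0 < W"
proof -
  interpret PS: prob_space PS by (rule PS_prob)
  obtain B where B: "\<And>x. x \<in> space (Rspace S) \<Longrightarrow> exp (- B) \<le> tilt k w psi x"
      "\<And>x. x \<in> space (Rspace S) \<Longrightarrow> tilt k w psi x \<le> exp B"
    using tilt_bounds[of w] by blast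
  have "exp (- B) \<le> W" unfolding W
    using B by (intro PS.integral_ge_const tilt_int AE_I2) (auto simp: PS_space)
  then have "0 < W" using less_le_trans[OF exp_gt_zero] by blast
  then show ?thesis
    by (intro that[of "exp (- B) / W" "exp B / W"])
      (auto simp: normalised_tilt_def W_def[symmetric] intro!: divide_right_mono B)
qed

lemma W_pos: "0 < W" using rbar_bounds by metis

lemma rbar_pos: "x \<in> space (Rspace S) \<Longrightarrow> 0 < rbar x"
  using rbar_bounds by (metis less_le_trans)

lemma rbar_eq: "rbar x = tilt k w psi x / W"
  by (simp add: normalised_tilt_def W_def)

lemma R_eq: "R = density PS (\<lambda>x. ennreal (rbar x))"
  unfolding law_def
  by (subst density_density_eq) (auto intro!: density_cong AE_I2 simp: ennreal_mult' mf_nonneg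
      less_imp_le[OF rbar_pos] mult.commute)

lemma R_sets[measurable_cong]: "sets R = sets (Rspace S)" by (simp add: law_def)

lemma R_space: "space R = space (Rspace S)" by (simp add: law_def)

lemma R_integrable: "h \<in> borel_measurable (Rspace S) \<Longrightarrow>
    integrable R h \<longleftrightarrow> integrable PS (\<lambda>x. rbar x * h x :: real)"
  unfolding R_eq by (subst integrable_real_density) (auto intro!: AE_I2 less_imp_le[OF rbar_pos]
      simp: PS_space)

lemma R_integral: "h \<in> borel_measurable (Rspace S) \<Longrightarrow> (\<integral>x. h x \<partial>R) = (\<integral>x. rbar x * h x \<partial>PS :: real)"
  unfolding R_eq by (subst integral_real_density) (auto intro!: AE_I2 less_imp_le[OF rbar_pos]
      simp: PS_space)

lemma R_integrable_bounded:
  assumes [measurable]: "h \<in> borel_measurable (Rspace S)" and h: "integrable PS h"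
  shows "integrable R (h :: _ \<Rightarrow> real)"
proof -
  obtain hi where hi: "\<And>x. x \<in> space (Rspace S) \<Longrightarrow> rbar x \<le> hi" using rbar_bounds by metis
  show ?thesis
  proof (subst R_integrable, measurable, rule Bochner_Integration.integrable_bound)
    show "integrable PS (\<lambda>x. hi * h x)" using h by simp
    show "AE x in PS. norm (rbar x * h x) \<le> norm (hi * h x)"
    proof (rule AE_I2)
      fix x assume "x \<in> space PS"
      then have "\<bar>rbar x\<bar> \<le> \<bar>hi\<bar>" using hi[of x] rbar_pos[of x] by (auto simp: PS_space)
      then show "norm (rbar x * h x) \<le> norm (hi * h x)" by (simp add: abs_mult mult_right_mono)
    qed
  qed measurable
qed

lemma R_AE: "(AE x in PS. Q x) \<Longrightarrow> AE x in R. Q x"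
  unfolding R_eq by (subst AE_density) auto

lemma R_prob: "prob_space R"
proof (rule prob_spaceI)
  have "(\<integral>\<^sup>+ x. ennreal (rbar x) \<partial>PS) = ennreal (\<integral>x. rbar x \<partial>PS)"
    using tilt_int by (intro nn_integral_eq_integral AE_I2)
      (auto simp: rbar_eq[abs_def] PS_space rbar_pos[unfolded rbar_eq] less_imp_le)
  also have "(\<integral>x. rbar x \<partial>PS) = 1" unfolding rbar_eq using W_pos by (simp add: W[symmetric])
  finally show "emeasure R (space R) = 1"
    unfolding R_eq by (simp add: emeasure_density cong: nn_integral_cong)
qed

context
  fixes \<phi> :: "(nat \<Rightarrow> real) \<Rightarrow> real" and u :: "nat \<Rightarrow> real" and t :: real
  assumes \<phi>[measurable]: "\<phi> \<in> borel_measurable E" and \<phi>2: "integrable P (\<lambda>z. (\<phi> z)\<^sup>2)"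
begin

abbreviation "pert \<equiv> \<lambda>n z. kfun (t * \<phi> z / sqrt (real n))"

text \<open>The perturbed marginal density relative to the unperturbed one. The value 1 where the latter
  vanishes keeps the ratio within the bounds of \<open>kfun\<close> everywhere.\<close>

definition "\<kappa> n x = (if 0 < m f x then cond (pert n) x else 1)"

text \<open>The density of an incomplete observation in the perturbed model relative to \<open>R\<close>, up to
  normalisation: the change of the tilt times the change of the marginal.\<close>

definition "G n x = exp (t * lin_comb k u psi x / sqrt (real n)) * \<kappa> n x"

lemma G_measurable[measurable]: "G n \<in> borel_measurable (Rspace S)"
  unfolding G_def[abs_def] \<kappa>_def[abs_def] by measurable

lemma kappa_bounds:
  assumes x: "x \<in> space (Rspace S)"
  shows "1 / 2 \<le> \<kappa> n x" "\<kappa> n x \<le> 3 / 2"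
proof -
  let ?f = "\<lambda>y. f (merge S C (x, y))" and ?k = "\<lambda>y. pert n (merge S C (x, y))"
  have "1 / 2 \<le> cond (pert n) x \<and> cond (pert n) x \<le> 3 / 2" if pos: "0 < m f x"
  proof -
    have fi: "integrable (Rspace C) ?f"
      using pos not_integrable_integral_eq unfolding marginal_def by fastforce
    have fnn: "0 \<le> ?f y" if "y \<in> space (Rspace C)" for y using f_nonneg merge_space x that by blast
    have bd: "1 / 2 * ?f y \<le> ?k y * ?f y" "?k y * ?f y \<le> 3 / 2 * ?f y" if "y
        \<in> space (Rspace C)" for y
      by (intro mult_right_mono kfun_bounds fnn[OF that])+
    have km: "(\<lambda>z. pert n z * f z) \<in> borel_measurable E" by measurable
    have ki: "integrable (Rspace C) (\<lambda>y. ?k y * ?f y)"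
    proof (rule Bochner_Integration.integrable_bound)
      show "integrable (Rspace C) (\<lambda>y. 3 / 2 * ?f y)" using fi by simp
      show "(\<lambda>y. ?k y * ?f y) \<in> borel_measurable (Rspace C)" by (rule slice_measurable[OF km x])
      show "AE y in Rspace C. norm (?k y * ?f y) \<le> norm (3 / 2 * ?f y)"
      proof (rule AE_I2)
        fix y assume "y \<in> space (Rspace C)"
        from bd[OF this] fnn[OF this] show "norm (?k y * ?f y) \<le> norm (3 / 2 * ?f y)" by simp
      qed
    qed
    have "(\<integral>y. 1 / 2 * ?f y \<partial>Rspace C) \<le> m (\<lambda>z. pert n z * f z) x"
      unfolding marginal_def using fi ki bd by (intro integral_mono) auto
    moreover have "m (\<lambda>z. pert n z * f z) x \<le> (\<integral>y. 3 / 2 * ?f y \<partial>Rspace C)"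
      unfolding marginal_def using fi ki bd by (intro integral_mono) auto
    ultimately have "1 / 2 * m f x \<le> m (\<lambda>z. pert n z * f z) x \<and> m (\<lambda>z. pert n z * f z) x
        \<le> 3 / 2 * m f x"
      unfolding integral_mult_right_zero by (simp add: marginal_def)
    then show ?thesis using pos by (auto simp: cond_def field_simps)
  qed
  then show "1 / 2 \<le> \<kappa> n x" "\<kappa> n x \<le> 3 / 2" by (auto simp: \<kappa>_def)
qed

lemma mult_kappa: "AE x in Rspace S. m f x * \<kappa> n x = m (\<lambda>z. pert n z * f z) x"
proof -
  have "pert n \<in> borel_measurable E" by measurable
  from mult_cond[OF this] AE_space show ?thesis
  proof eventually_elim
    case (elim x)
    then show ?case using mf_nonneg[OF elim(2)] by (cases "m f x = 0") (auto simp: \<kappa>_def)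
  qed
qed

lemma kappa_scaled: "AE x in PS. sqrt (real n) * (\<kappa> n x - 1)
    = cond (\<lambda>z. sqrt (real n) * (pert n z - 1)) x"
proof -
  have k: "pert n \<in> borel_measurable E" by measurable
  have ki: "integrable P (pert n)"
  proof (rule integrable_const_bound[of _ "3 / 2"])
    have "\<bar>kfun v\<bar> \<le> 3 / 2" for v using kfun_bounds[of v] by linarith
    then show "AE z in P. norm (pert n z) \<le> 3 / 2" unfolding real_norm_def by (intro AE_I2)
  qed measurable
  from PS_AE_slice[OF ki k] PS_AE_slice[of "\<lambda>_. 1"]
  have "AE x in PS. 0 < m f x
      \<and> integrable (Rspace C) (\<lambda>y. pert n (merge S C (x, y)) * f (merge S C (x, y)))
      \<and> integrable (Rspace C) (\<lambda>y. f (merge S C (x, y)))" by auto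
  then show ?thesis
  proof eventually_elim
    case (elim x)
    have "m (\<lambda>z. sqrt (real n) * (pert n z - 1) * f z) x
        = (\<integral>y. sqrt (real n) * (pert n (merge S C (x, y)) * f (merge S C (x, y)) - f
            (merge S C (x, y))) \<partial>Rspace C)"
      unfolding marginal_def
          by (intro Bochner_Integration.integral_cong refl) (simp add: algebra_simps)
    also have "\<dots> = sqrt (real n) * (m (\<lambda>z. pert n z * f z) x - m f x)"
      using elim unfolding marginal_def by simp
    finally show ?case using elim by (simp add: cond_def \<kappa>_def field_simps)
  qed
qed

text \<open>The score of an incomplete observation. The perturbation of the full density enters through its
  conditional expectation given \<open>X\<^sub>S\<close>, whose rescaled limit is \<open>t E(\<phi>(X) | X\<^sub>S)\<close> by conditional
  dominated convergence, and the perturbation of the tilt adds the linear combination of \<open>\<Psi>\<^sub>S\<close>.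
  The envelope is square integrable by Jensen's inequality.\<close>

lemma S_family:
  "\<exists>D lo hi. local_family R G (\<lambda>x. t * (cond \<phi> x + lin_comb k u psi x)) D lo hi"
proof -
  obtain B where B0: "B \<ge> 0" and B: "\<And>x. x \<in> space (Rspace S) \<Longrightarrow> \<bar>t * lin_comb k u psi x\<bar> \<le> B"
  proof -
    obtain B where "B \<ge> 0" "\<And>x. x \<in> space (Rspace S) \<Longrightarrow> \<bar>lin_comb k u psi x\<bar> \<le> B"
      using lin_comb_bounded[of k psi, OF psi_bounded] by blast
    then show ?thesis by (intro that[of "\<bar>t\<bar> * B"]) (auto simp: abs_mult mult_left_mono)
  qed
  have eB: "exp (- B) \<le> exp (t * lin_comb k u psi x / sqrt (real n))"
      "exp (t * lin_comb k u psi x / sqrt (real n)) \<le> exp B" if "x \<in> space (Rspace S)" for x n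
  proof -
    have "\<bar>t * lin_comb k u psi x / sqrt (real n)\<bar> \<le> B"
    proof (cases "n = 0")
      case False
      then have "1 \<le> sqrt (real n)" by simp
      then have "\<bar>t * lin_comb k u psi x\<bar> / \<bar>sqrt (real n)\<bar> \<le> B / 1"
        using B[OF that] B0 by (intro frac_le) auto
      moreover have "\<bar>sqrt (real n)\<bar> = sqrt (real n)" by simp
      ultimately show ?thesis by (simp only: abs_divide div_by_1)
    qed (use B0 in simp)
    then have "- B \<le> t * lin_comb k u psi x / sqrt (real n)" "t
        * lin_comb k u psi x / sqrt (real n) \<le> B"
      by (simp_all only: abs_le_iff) linarith+
    then show "exp (- B) \<le> exp (t * lin_comb k u psi x / sqrt (real n))"
      "exp (t * lin_comb k u psi x / sqrt (real n)) \<le> exp B" by simp_all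
  qed
  define D where "D x = B * exp B * (3 / 2) + cond (\<lambda>z. \<bar>t * \<phi> z\<bar>) x" for x
  interpret R: prob_space R by (rule R_prob)
  interpret PS: prob_space PS by (rule PS_prob)
  have i\<phi>: "integrable P (\<lambda>z. \<bar>t * \<phi> z\<bar>)"
    using square_integrable_integrable[OF prob_space_axioms _ \<phi>2] by (simp add: abs_mult)
  have lim_bound: "AE x in PS. (\<lambda>n. cond (\<lambda>z. sqrt (real n) * (pert n z - 1)) x)
      \<longlonglongrightarrow> cond (\<lambda>z. t * \<phi> z) x"
    "AE x in PS. \<forall>n. \<bar>cond (\<lambda>z. sqrt (real n) * (pert n z - 1)) x\<bar> \<le> cond (\<lambda>z. \<bar>t * \<phi> z\<bar>) x"
    by (rule cond_dominated_lim[where D = "\<lambda>z. \<bar>t * \<phi> z\<bar>" and g = "\<lambda>z. t * \<phi> z"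
      and h = "\<lambda>n z. sqrt (real n) * (pert n z - 1)"]; use kfun_scaled_limit kfun_scaled_bound i\<phi>
          in simp)+
  have ks: "AE x in PS. \<forall>n. sqrt (real n) * (\<kappa> n x - 1)
      = cond (\<lambda>z. sqrt (real n) * (pert n z - 1)) x"
    unfolding AE_all_countable using kappa_scaled by auto
  have ct: "cond (\<lambda>z. t * \<phi> z) x = t * cond \<phi> x" for x
    by (simp add: cond_def marginal_def mult.assoc)
  have split: "sqrt (real n) * (G n x - 1) =
      sqrt (real n) * (exp (t * lin_comb k u psi x / sqrt (real n)) - 1) * \<kappa> n x + sqrt (real n)
          * (\<kappa> n x - 1)" for n x
    by (simp add: G_def algebra_simps)
  have "local_family R G (\<lambda>x. t * (cond \<phi> x + lin_comb k u psi x)) D (exp (- B) * (1 / 2)) (exp B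
      * (3 / 2))"
  proof
    show "G n \<in> borel_measurable R" for n by measurable
    show "(\<lambda>x. t * (cond \<phi> x + lin_comb k u psi x)) \<in> borel_measurable R" by measurable
    show "D \<in> borel_measurable R" unfolding D_def[abs_def] by measurable
    show "0 < exp (- B) * (1 / 2)" by simp
    show "exp (- B) * (1 / 2) \<le> G n x" "G n x \<le> exp B * (3 / 2)" if "x \<in> space R" for n x
    proof -
      have x: "x \<in> space (Rspace S)" using that by (simp add: R_space)
      show "exp (- B) * (1 / 2) \<le> G n x" unfolding G_def
        using eB[OF x, of n] kappa_bounds[OF x, of n] by (intro mult_mono) auto
      show "G n x \<le> exp B * (3 / 2)" unfolding G_def
        using eB[OF x, of n] kappa_bounds[OF x, of n] by (intro mult_mono) auto
    qed
    show "AE x in R. (\<lambda>n. sqrt (real n) * (G n x - 1)) \<longlonglongrightarrow> t * (cond \<phi> x + lin_comb k u psi x)"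
      using R_AE[OF lim_bound(1)] R_AE[OF ks]
    proof eventually_elim
      case (elim x)
      have k: "(\<lambda>n. sqrt (real n) * (\<kappa> n x - 1)) \<longlonglongrightarrow> t * cond \<phi> x"
        using elim by (simp add: ct)
      have "(\<lambda>n. sqrt (real n) * (G n x - 1)) \<longlonglongrightarrow> (t * lin_comb k u psi x) * 1 + t * cond \<phi> x"
        unfolding split by (intro tendsto_add tendsto_mult[OF exp_scaled_limit] k
            tendsto_1_of_sqrt[OF k])
      then show ?case by (simp add: algebra_simps)
    qed
    show "AE x in R. \<bar>sqrt (real n) * (G n x - 1)\<bar> \<le> D x" for n
      using R_AE[OF lim_bound(2)] R_AE[OF ks] AE_space
    proof eventually_elim
      case (elim x)
      have x: "x \<in> space (Rspace S)" using elim by (simp add: R_space)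
      have "\<bar>sqrt (real n) * (exp (t * lin_comb k u psi x / sqrt (real n)) - 1) * \<kappa> n x\<bar>
          \<le> B * exp B * (3 / 2)"
        unfolding abs_mult[of _ "\<kappa> n x"]
        using exp_scaled_bound[OF B[OF x], of n] kappa_bounds[OF x, of n] B0
            by (intro mult_mono) auto
      moreover have "\<bar>sqrt (real n) * (\<kappa> n x - 1)\<bar> \<le> cond (\<lambda>z. \<bar>t * \<phi> z\<bar>) x" using elim by simp
      ultimately show ?case unfolding split D_def by linarith
    qed
    show "integrable R (\<lambda>x. (D x)\<^sup>2)"
    proof (rule R_integrable_bounded)
      have sq: "integrable PS (\<lambda>x. (cond (\<lambda>z. \<bar>t * \<phi> z\<bar>) x)\<^sup>2)"
        by (rule cond_sq_integrable) (use \<phi>2 in \<open>auto simp: power_mult_distrib\<close>)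
      moreover have "integrable PS (cond (\<lambda>z. \<bar>t * \<phi> z\<bar>))"
        by (rule square_integrable_integrable[OF PS_prob _ sq]) measurable
      ultimately show "integrable PS (\<lambda>x. (D x)\<^sup>2)" unfolding D_def by (simp add: power2_sum)
    qed (simp add: D_def[abs_def])
  qed
  then show ?thesis by blast
qed

text \<open>All normalising constants, that of \<open>f\<^sub>h\<close> and those of the tilts, cancel except the mass of \<open>G n\<close>
  under \<open>R\<close>, which is the normalisation of the local family.\<close>

lemma S_law:
  "law S (\<lambda>x. normalised_tilt d (local_density d f \<phi> n t) S k (\<lambda>j. w j
      + t * u j / sqrt (real n)) psi x
        * marginal d (local_density d f \<phi> n t) S x)
    = density R (\<lambda>x. ennreal (local_family.pdens R G n x))"
proof -
  obtain D lo hi where "local_family R G (\<lambda>x. t * (cond \<phi> x + lin_comb k u psi x)) D lo hi"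
    using S_family by blast
  then interpret F: local_family R G "\<lambda>x. t * (cond \<phi> x + lin_comb k u psi x)" D lo hi .
  let ?g = "local_density d f \<phi> n t" and ?u = "\<lambda>j. w j + t * u j / sqrt (real n)"
  define ZX where "ZX = (\<integral>y. pert n y * f y \<partial>E)"
  have mg: "m ?g x = m (\<lambda>z. pert n z * f z) x / ZX" for x
    unfolding marginal_def local_density_def perturbed_def ZX_def by simp
  have ZX: "ZX > 0"
  proof -
    interpret X: local_family P pert "\<lambda>z. t * \<phi> z" "\<lambda>z. \<bar>t * \<phi> z\<bar>" "1 / 2" "3 / 2"
      by (rule X_family) (use \<phi>2 in auto)
    show ?thesis using X.Z_pos[of n] unfolding X.Z_def ZX_def by (subst (asm) P_integral) auto
  qed
  have tu: "tilt k ?u psi x = tilt k w psi x * exp (t * lin_comb k u psi x / sqrt (real n))" for x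
    unfolding tilt_def exp_add[symmetric] lin_comb_def
    by (simp add: sum_distrib_left sum_divide_distrib sum.distrib[symmetric] algebra_simps)
  have AE1: "AE x in Rspace S. tilt k ?u psi x * m ?g x = tilt k w psi x * m f x * G n x / ZX"
    using mult_kappa[of n]
  proof eventually_elim
    case (elim x)
    show ?case unfolding mg elim[symmetric] tu G_def by simp
  qed
  have "(\<lambda>x. pert n x * f x / ZX) \<in> borel_measurable E" by measurable
  then have [measurable]: "?g \<in> borel_measurable E"
    by (simp add: local_density_def perturbed_def[abs_def] ZX_def)
  have Zg: "(\<integral>y. tilt k ?u psi y * m ?g y \<partial>Rspace S) = W * F.Z n / ZX"
  proof -
    have "(\<integral>y. tilt k ?u psi y * m ?g y \<partial>Rspace S)
        = (\<integral>x. W * (m f x * (rbar x * G n x)) / ZX \<partial>Rspace S)"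
      using AE1 W_pos by (intro integral_cong_AE) (auto simp: rbar_eq algebra_simps)
    also have "\<dots> = W * F.Z n / ZX"
      unfolding F.Z_def by (simp add: R_integral PS_integral_density)
    finally show ?thesis .
  qed
  have eq: "AE x in Rspace S. normalised_tilt d ?g S k ?u psi x * m ?g x
      = (rbar x * m f x) * F.pdens n x"
    using AE1
  proof eventually_elim
    case (elim x)
    have "normalised_tilt d ?g S k ?u psi x * m ?g x = tilt k ?u psi x * m ?g x / (W * F.Z n / ZX)"
      unfolding normalised_tilt_def Zg by simp
    also have "\<dots> = (rbar x * m f x) * F.pdens n x"
      unfolding elim F.pdens_def rbar_eq[of x] using ZX W_pos F.Z_pos[of n]
          by (simp add: field_simps)
    finally show ?case .
  qed
  have "F.pdens n \<in> borel_measurable (Rspace S)"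
    using F.pdens_measurable[of n] by (simp cong: measurable_cong_sets add: R_sets)
  then show ?thesis
    using eq by (intro law_eq_density) (auto simp: less_imp_le[OF rbar_pos] mf_nonneg)
qed

end

lemma S_prob:
  assumes [measurable]: "\<phi> \<in> borel_measurable E" and \<phi>2: "integrable P (\<lambda>z. (\<phi> z)\<^sup>2)"
  shows "prob_space (law S (\<lambda>x. normalised_tilt d (local_density d f \<phi> n t) S k (\<lambda>j. w j
      + t * u j / sqrt (real n)) psi x
        * marginal d (local_density d f \<phi> n t) S x))"
proof -
  obtain D lo hi where F:
      "local_family R (G \<phi> u t) (\<lambda>x. t * (cond \<phi> x + lin_comb k u psi x)) D lo hi"
    using S_family[OF assms] by blast
  show ?thesis unfolding S_law[OF assms] by (rule local_family.pdens_prob[OF F])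
qed

text \<open>When the score equals \<open>\<alpha> / (\<lambda> r)\<close> plus a constant, with \<open>r\<close> the density ratio of the tilt, its
  mean under the tilted distribution is that constant because \<open>\<alpha>\<close> has mean zero under \<open>f\<close>, and one
  factor \<open>r\<close> cancels in its variance. This is where the weight \<open>1 / (\<lambda> r)\<close> of the objective arises
  as a Fisher information.\<close>

lemma S_chi2:
  assumes \<phi>: "sq_integrable P \<phi>" and \<alpha>: "sq_integrable P \<alpha>" and lam: "lam > 0"
    and \<alpha>0: "(\<integral>x. \<alpha> x \<partial>P) = 0"
    and score: "AE x in P. cond \<phi> (restrict x S) + lin_comb k u psi (restrict x S)
       = \<alpha> x / (lam * rbar (restrict x S)) + c"
  defines "law' \<equiv> \<lambda>n t. law S (\<lambda>x. normalised_tilt d (local_density d f \<phi> n t) S k (\<lambda>j. w j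
      + t * u j / sqrt (real n)) psi x
        * marginal d (local_density d f \<phi> n t) S x)"
  shows "\<exists>\<kappa>. (\<forall>n. chi2_le (law' n s) (law' n t) (ennreal (1 + \<kappa> n)) \<and> \<kappa> n \<ge> 0) \<and>
      (\<lambda>n. real n * \<kappa> n) \<longlonglongrightarrow> (t - s)\<^sup>2 * (\<integral>x. (\<alpha> x)\<^sup>2 / (lam * rbar (restrict x S)) \<partial>P) / lam"
proof -
  have \<phi>m[measurable]: "\<phi> \<in> borel_measurable E" and \<phi>2: "integrable P (\<lambda>z. (\<phi> z)\<^sup>2)"
    using \<phi> by (auto simp: sq_integrable_def)
  have \<alpha>m[measurable]: "\<alpha> \<in> borel_measurable E" by (rule sq_measurable[OF \<alpha>])
  let ?b = "\<lambda>x. cond \<phi> x + lin_comb k u psi x"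
  have RP: "(\<integral>x. h x \<partial>R) = (\<integral>x. rbar (restrict x S) * h (restrict x S) \<partial>P)"
    if "h \<in> borel_measurable (Rspace S)" for h :: "_ \<Rightarrow> real"
    using that by (simp add: R_integral PS_integral)
  have rp: "0 < rbar (restrict x S)" if "x \<in> space P" for x
    using that measurable_space[OF restrict_measurable] by (auto simp: P_space intro: rbar_pos)
  interpret R: prob_space R by (rule R_prob)
  have r1: "(\<integral>x. rbar (restrict x S) \<partial>P) = 1" using RP[of "\<lambda>_. 1"] R.prob_space by simp
  have ri: "integrable P (\<lambda>x. rbar (restrict x S))"
    using r1 not_integrable_integral_eq by fastforce
  have mean: "(\<integral>x. ?b x \<partial>R) = c"
  proof -
    have "(\<integral>x. ?b x \<partial>R) = (\<integral>x. \<alpha> x / lam + c * rbar (restrict x S) \<partial>P)"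
    proof (subst RP, measurable, rule integral_cong_AE)
      show "AE x in P. rbar (restrict x S) * ?b (restrict x S) = \<alpha> x / lam
          + c * rbar (restrict x S)"
        using score AE_space
      proof eventually_elim
        case (elim x)
        show ?case unfolding elim(1) using rp[OF elim(2)] lam by (simp add: field_simps)
      qed
    qed measurable
    also have "\<dots> = c" using sq_integrable_int[OF \<alpha>] \<alpha>0 ri r1 by simp
    finally show ?thesis .
  qed
  have var: "(\<integral>x. (?b x - c)\<^sup>2 \<partial>R) = (\<integral>x. (\<alpha> x)\<^sup>2 / (lam * rbar (restrict x S)) \<partial>P) / lam"
  proof -
    have "(\<integral>x. (?b x - c)\<^sup>2 \<partial>R) = (\<integral>x. (\<alpha> x)\<^sup>2 / (lam * rbar (restrict x S)) / lam \<partial>P)"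
    proof (subst RP, measurable, rule integral_cong_AE)
      show "AE x in P. rbar (restrict x S) * (?b (restrict x S) - c)\<^sup>2
          = (\<alpha> x)\<^sup>2 / (lam * rbar (restrict x S)) / lam"
        using score AE_space
      proof eventually_elim
        case (elim x)
        show ?case unfolding elim(1) using rp[OF elim(2)] lam
            by (simp add: field_simps power2_eq_square)
      qed
    qed measurable
    then show ?thesis by (simp only: integral_divide_zero)
  qed
  obtain Ds los his where Fs: "local_family R (G \<phi> u s) (\<lambda>x. s * ?b x) Ds los his"
    using S_family[OF \<phi>m \<phi>2] by blast
  obtain Dt lot hit where Ft: "local_family R (G \<phi> u t) (\<lambda>x. t * ?b x) Dt lot hit"
    using S_family[OF \<phi>m \<phi>2] by blast
  have m: "(\<integral>y. t * ?b y - s * ?b y \<partial>R) = (t - s) * c"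
    unfolding left_diff_distrib[symmetric] by (simp add: mean)
  have "(\<integral>x. (t * ?b x - s * ?b x - (\<integral>y. t * ?b y - s * ?b y \<partial>R))\<^sup>2 \<partial>R)
      = (\<integral>x. (t - s)\<^sup>2 * (?b x - c)\<^sup>2 \<partial>R)"
    unfolding m by (intro Bochner_Integration.integral_cong refl)
      (simp only: left_diff_distrib[symmetric] right_diff_distrib[symmetric] power_mult_distrib)
  also have "\<dots> = (t - s)\<^sup>2 * (\<integral>x. (\<alpha> x)\<^sup>2 / (lam * rbar (restrict x S)) \<partial>P) / lam"
      by (simp add: var)
  finally have V: "(\<integral>x. (t * ?b x - s * ?b x - (\<integral>y. t * ?b y - s * ?b y \<partial>R))\<^sup>2 \<partial>R)
      = (t - s)\<^sup>2 * (\<integral>x. (\<alpha> x)\<^sup>2 / (lam * rbar (restrict x S)) \<partial>P) / lam" .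
  show ?thesis
    using local_chi2[OF Fs Ft] unfolding V law'_def S_law[OF \<phi>m \<phi>2] .
qed

end

section \<open>Least squares over a product of function spaces\<close>

context prob_space
begin

text \<open>The completeness of \<open>L\<^sup>2\<close> in the form that a minimisation argument needs. Geometrically small
  increments are summable in \<open>L\<^sup>1\<close>, hence absolutely summable almost everywhere, and the sum of
  their absolute values dominates the sequence.\<close>

lemma rapidly_Cauchy_limit:
  assumes g: "\<And>n. sq_integrable M (g n)"
    and rapid: "\<And>n. expectation (\<lambda>x. (g n x - g (Suc n) x)\<^sup>2) \<le> K * (1 / 4) ^ n"
  shows "AE x in M. (\<lambda>n. g n x) \<longlonglongrightarrow> lim (\<lambda>n. g n x)"
    and "\<exists>D. integrable M D \<and> (\<forall>n. AE x in M. \<bar>g n x\<bar> \<le> D x)"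
proof -
  have gm[measurable]: "g n \<in> borel_measurable M" for n using g by (simp add: sq_integrable_def)
  let ?e = "\<lambda>n x. \<bar>g n x - g (Suc n) x\<bar>"
  have e: "sq_integrable M (\<lambda>x. g n x - g (Suc n) x)" for n by (intro sq_integrable_diff g)
  have ei: "integrable M (?e n)" for n using sq_integrable_int[OF e] by simp
  have le: "expectation (?e n) \<le> sqrt K * (1 / 2) ^ n" for n
  proof -
    have "sqrt (K * (1 / 4) ^ n) = sqrt K * (1 / 2) ^ n"
    proof -
      have "(1 / 4 :: real) ^ n
          = ((1 / 2) ^ n)\<^sup>2" by (simp add: power2_eq_square flip: power_mult_distrib)
      then show ?thesis by (simp add: real_sqrt_mult)
    qed
    moreover have "expectation (?e n) \<le> sqrt (K * (1 / 4) ^ n)"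
      by (rule order_trans[OF abs_expectation_le_sqrt[OF e] real_sqrt_le_mono[OF rapid]])
    ultimately show ?thesis by (simp only:)
  qed
  have "summable (\<lambda>n. sqrt K * (1 / 2) ^ n)" by (intro summable_mult summable_geometric) simp
  then have sm: "summable (\<lambda>n. expectation (?e n))"
    by (rule summable_comparison_test') (use le in auto)
  have "(\<integral>\<^sup>+x. (\<Sum>n. ennreal (?e n x)) \<partial>M) = (\<Sum>n. ennreal (expectation (?e n)))"
    by (subst nn_integral_suminf) (auto intro!: suminf_cong nn_integral_eq_integral ei)
  also have "\<dots> = ennreal (\<Sum>n. expectation (?e n))"
    by (rule suminf_ennreal2) (use sm in auto)
  finally have "AE x in M. (\<Sum>n. ennreal (?e n x)) \<noteq> \<infinity>"
    by (intro nn_integral_noteq_infinite) auto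
  then have summ: "AE x in M. summable (\<lambda>n. ?e n x)"
    by eventually_elim (auto intro: summable_suminf_not_top)
  have tele: "g n x = g 0 x - (\<Sum>i<n. g i x - g (Suc i) x)" for n x
    by (induction n) auto
  show "AE x in M. (\<lambda>n. g n x) \<longlonglongrightarrow> lim (\<lambda>n. g n x)"
    using summ
  proof eventually_elim
    case (elim x)
    then have "summable (\<lambda>i. g i x - g (Suc i) x)" by (rule summable_rabs_cancel)
    from tendsto_diff[OF tendsto_const[of "g 0 x"] summable_LIMSEQ[OF this]]
    have "convergent (\<lambda>n. g 0 x - (\<Sum>i<n. g i x - g (Suc i) x))" by (rule convergentI)
    then have "convergent (\<lambda>n. g n x)" by (simp only: tele[symmetric])
    then show ?case by (simp add: convergent_LIMSEQ_iff)
  qed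
  show "\<exists>D. integrable M D \<and> (\<forall>n. AE x in M. \<bar>g n x\<bar> \<le> D x)"
  proof (intro exI conjI allI)
    have "integrable M (\<lambda>x. \<Sum>n. ?e n x)"
      using summ sm by (intro integrable_suminf ei) auto
    then show "integrable M (\<lambda>x. \<bar>g 0 x\<bar> + (\<Sum>n. ?e n x))"
      using sq_integrable_int[OF g] by simp
    show "AE x in M. \<bar>g n x\<bar> \<le> \<bar>g 0 x\<bar> + (\<Sum>n. ?e n x)" for n
      using summ
    proof eventually_elim
      case (elim x)
      have "\<bar>\<Sum>i<n. g i x - g (Suc i) x\<bar> \<le> (\<Sum>i<n. ?e i x)" by (rule sum_abs)
      also have "\<dots> \<le> (\<Sum>n. ?e n x)" by (intro sum_le_suminf elim) auto
      finally show ?case using tele[of n x] by linarith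
    qed
  qed
qed

end

text \<open>Otherwise \<open>e = - b / (\<bar>q\<bar> + 1)\<close> makes the quadratic negative.\<close>

lemma quadratic_min_zero:
  fixes b q :: real
  assumes "\<And>e. 0 \<le> 2 * e * b + e\<^sup>2 * q" shows "b = 0"
proof (rule ccontr)
  assume b: "b \<noteq> 0"
  define r where "r = \<bar>q\<bar> + 1"
  have r: "0 < r" by (simp add: r_def)
  have "0 \<le> 2 * (- b / r) * b + (- b / r)\<^sup>2 * q" by (rule assms)
  also have "\<dots> \<le> 2 * (- b / r) * b + (- b / r)\<^sup>2 * r"
    by (intro add_left_mono mult_left_mono) (auto simp: r_def)
  also have "\<dots> = - (b\<^sup>2 / r)" using r by (simp add: power2_eq_square field_simps)
  also have "\<dots> < 0" using b r by simp
  finally show False by simp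
qed

text \<open>The variational problem without its statistical content: approximate \<open>a0\<close> by a sum of functions
  from linear spaces \<open>K S\<close>, with a weighted quadratic penalty. The closedness of the spaces is
  only stated for dominated almost everywhere limits, with \<open>lim\<close> as the limit function: a
  pointwise limit inherits from the sequence any identity between values, such as dependence on a
  block of coordinates.\<close>

locale least_squares = prob_space M for M :: "'x measure" +
  fixes SS :: "'i set" and K :: "'i \<Rightarrow> ('x \<Rightarrow> real) set"
    and wt :: "'i \<Rightarrow> 'x \<Rightarrow> real" and a0 :: "'x \<Rightarrow> real"
  assumes fin: "finite SS"
    and K_sq: "\<And>S \<alpha>. S \<in> SS \<Longrightarrow> \<alpha> \<in> K S \<Longrightarrow> sq_integrable M \<alpha>"
    and K_zero: "\<And>S. S \<in> SS \<Longrightarrow> (\<lambda>_. 0) \<in> K S"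
    and K_lin: "\<And>S \<alpha> \<beta> c e. S \<in> SS \<Longrightarrow> \<alpha> \<in> K S \<Longrightarrow> \<beta> \<in> K S \<Longrightarrow> (\<lambda>x. c * \<alpha> x + e * \<beta> x) \<in> K S"
    and K_closed: "\<And>S g D. S \<in> SS \<Longrightarrow> (\<And>n :: nat. g n \<in> K S) \<Longrightarrow>
      AE x in M. (\<lambda>n. g n x) \<longlonglongrightarrow> lim (\<lambda>n. g n x) \<Longrightarrow> integrable M D \<Longrightarrow>
      (\<And>n. AE x in M. \<bar>g n x\<bar> \<le> D x) \<Longrightarrow> sq_integrable M (\<lambda>x. lim (\<lambda>n. g n x)) \<Longrightarrow>
      (\<lambda>x. lim (\<lambda>n. g n x)) \<in> K S"
    and wt[measurable]: "\<And>S. S \<in> SS \<Longrightarrow> wt S \<in> borel_measurable M"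
    and wt_bounds: "\<And>S. S \<in> SS \<Longrightarrow> \<exists>l h. 0 < l \<and> (\<forall>x\<in>space M. l \<le> wt S x \<and> wt S x \<le> h)"
    and a0: "sq_integrable M a0"
begin

definition family where "family = PiE SS K"

definition loss where "loss \<alpha> x = (a0 x - (\<Sum>S\<in>SS. \<alpha> S x))\<^sup>2 + (\<Sum>S\<in>SS. (\<alpha> S x)\<^sup>2 * wt S x)"

text \<open>The quadratic part of \<open>loss\<close>.\<close>

definition energy where "energy \<alpha> x = (\<Sum>S\<in>SS. \<alpha> S x)\<^sup>2 + (\<Sum>S\<in>SS. (\<alpha> S x)\<^sup>2 * wt S x)"

definition mean_loss where "mean_loss \<alpha> = expectation (loss \<alpha>)"

definition wt_min where "wt_min S = (INF x\<in>space M. wt S x)"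

lemma
  assumes S: "S \<in> SS"
  shows wt_min_pos: "0 < wt_min S" and wt_min_le: "x \<in> space M \<Longrightarrow> wt_min S \<le> wt S x"
proof -
  obtain l where l: "0 < l" "\<And>x. x \<in> space M \<Longrightarrow> l \<le> wt S x" using wt_bounds[OF S] by blast
  have "l \<le> wt_min S" unfolding wt_min_def using not_empty l(2) by (intro cINF_greatest)
  then show "0 < wt_min S" using l(1) by simp
  show "wt_min S \<le> wt S x" if "x \<in> space M"
    unfolding wt_min_def using l(2) that by (intro cINF_lower) (auto intro: bdd_belowI2[of _ l])
qed

lemma wt_nonneg: "S \<in> SS \<Longrightarrow> x \<in> space M \<Longrightarrow> 0 \<le> wt S x"
  using wt_min_pos wt_min_le by (meson less_imp_le order_trans)

lemma weighted_sq:
  assumes S: "S \<in> SS" and \<alpha>: "sq_integrable M \<alpha>" shows "sq_integrable M (\<lambda>x. wt S x * \<alpha> x)"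
proof -
  obtain h where "\<And>x. x \<in> space M \<Longrightarrow> wt S x \<le> h" using wt_bounds[OF S] by blast
  then show ?thesis
    using wt_nonneg[OF S] by (intro sq_integrable_bounded_mult[OF \<alpha> wt[OF S], of h]) auto
qed

lemma weighted_mult_integrable:
  assumes S: "S \<in> SS" and \<alpha>: "sq_integrable M \<alpha>" "sq_integrable M \<beta>"
  shows "integrable M (\<lambda>x. \<alpha> x * \<beta> x * wt S x)"
  using sq_integrable_mult[OF \<alpha>(1) weighted_sq[OF S \<alpha>(2)]] by (simp add: ac_simps)

lemma family_sq: "\<alpha> \<in> family \<Longrightarrow> S \<in> SS \<Longrightarrow> sq_integrable M (\<alpha> S)"
  unfolding family_def using K_sq by auto

lemma resid_sq: "\<alpha> \<in> family \<Longrightarrow> sq_integrable M (\<lambda>x. a0 x - (\<Sum>S\<in>SS. \<alpha> S x))"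
  by (intro sq_integrable_diff a0 sq_integrable_sum family_sq)

lemma loss_integrable:
  assumes "\<alpha> \<in> family" shows "integrable M (loss \<alpha>)"
proof -
  have "integrable M (\<lambda>x. (\<alpha> S x)\<^sup>2 * wt S x)" if "S \<in> SS" for S
    using weighted_mult_integrable[OF that family_sq[OF assms that] family_sq[OF assms that]]
        by (simp add: power2_eq_square)
  moreover have "integrable M (\<lambda>x. (a0 x - (\<Sum>S\<in>SS. \<alpha> S x))\<^sup>2)"
    using resid_sq[OF assms] by (simp add: sq_integrable_def)
  ultimately show ?thesis
    unfolding loss_def[abs_def]
        by (intro Bochner_Integration.integrable_add Bochner_Integration.integrable_sum)
qed

lemma loss_nonneg: "x \<in> space M \<Longrightarrow> 0 \<le> loss \<alpha> x"
  unfolding loss_def by (auto intro!: add_nonneg_nonneg sum_nonneg mult_nonneg_nonneg wt_nonneg)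

lemma mean_loss_nonneg: "0 \<le> mean_loss \<alpha>"
  unfolding mean_loss_def by (intro integral_nonneg_AE AE_I2 loss_nonneg)

lemma family_lin:
  assumes "\<alpha> \<in> family" "\<beta> \<in> family" shows "(\<lambda>S\<in>SS. \<lambda>x. c * \<alpha> S x + e * \<beta> S x) \<in> family"
  using assms unfolding family_def by (auto intro!: K_lin dest: PiE_mem)

lemma family_component:
  assumes S: "S \<in> SS" and \<beta>: "\<beta> \<in> K S" shows "(\<lambda>T\<in>SS. if T = S then \<beta> else (\<lambda>_. 0)) \<in> family"
  using assms K_zero unfolding family_def by auto

lemma loss_parallelogram:
  fixes \<alpha> \<beta> :: "'i \<Rightarrow> 'x \<Rightarrow> real"
  defines "\<mu> \<equiv> \<lambda>S\<in>SS. \<lambda>x. 1 / 2 * \<alpha> S x + 1 / 2 * \<beta> S x"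
  shows "energy (\<lambda>S x. \<alpha> S x - \<beta> S x) x = 2 * loss \<alpha> x + 2 * loss \<beta> x - 4 * loss \<mu> x"
proof -
  have 1: "(\<Sum>S\<in>SS. \<mu> S x) = ((\<Sum>S\<in>SS. \<alpha> S x) + (\<Sum>S\<in>SS. \<beta> S x)) / 2"
    by (simp add: \<mu>_def sum.distrib sum_divide_distrib add_divide_distrib)
  have "(\<Sum>S\<in>SS. (\<mu> S x)\<^sup>2 * wt S x) * 4
      = (\<Sum>S\<in>SS. 2 * ((\<alpha> S x)\<^sup>2 * wt S x) + 2 * ((\<beta> S x)\<^sup>2 * wt S x) - (\<alpha> S x - \<beta> S x)\<^sup>2 * wt S x)"
    unfolding sum_distrib_right
        by (intro sum.cong refl) (simp add: \<mu>_def power2_eq_square algebra_simps)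
  then have 2: "(\<Sum>S\<in>SS. (\<mu> S x)\<^sup>2 * wt S x) * 4 = 2 * (\<Sum>S\<in>SS. (\<alpha> S x)\<^sup>2 * wt S x)
      + 2 * (\<Sum>S\<in>SS. (\<beta> S x)\<^sup>2 * wt S x) - (\<Sum>S\<in>SS. (\<alpha> S x - \<beta> S x)\<^sup>2 * wt S x)"
    by (simp add: sum.distrib sum_subtractf sum_distrib_left)
  show ?thesis unfolding energy_def loss_def 1 sum_subtractf
    using 2 by (simp add: power2_eq_square field_simps)
qed

lemma component_le:
  assumes "S \<in> SS" "x \<in> space M"
  shows "wt_min S * (\<alpha> S x)\<^sup>2 \<le> energy \<alpha> x" and "wt_min S * (\<alpha> S x)\<^sup>2 \<le> loss \<alpha> x"
proof -
  have "wt_min S * (\<alpha> S x)\<^sup>2 \<le> (\<alpha> S x)\<^sup>2 * wt S x"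
    using wt_min_le[OF assms] by (subst mult.commute) (intro mult_left_mono, auto)
  also have "\<dots> \<le> (\<Sum>S\<in>SS. (\<alpha> S x)\<^sup>2 * wt S x)"
    using wt_nonneg assms by (intro member_le_sum[OF assms(1) _ fin]) auto
  finally show "wt_min S * (\<alpha> S x)\<^sup>2 \<le> energy \<alpha> x" "wt_min S * (\<alpha> S x)\<^sup>2 \<le> loss \<alpha> x"
    unfolding energy_def loss_def by (smt (verit) zero_le_power2)+
qed

text \<open>By the parallelogram identity, functions whose values are close to the infimum \<open>c\<close> are close to
  each other, since their midpoint cannot fall below \<open>c\<close>.\<close>

lemma near_minimisers_close:
  assumes \<alpha>: "\<alpha> \<in> family" and \<beta>: "\<beta> \<in> family" and S: "S \<in> SS"
    and inf: "\<And>\<gamma>. \<gamma> \<in> family \<Longrightarrow> c \<le> mean_loss \<gamma>"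
  shows "wt_min S * expectation (\<lambda>x. (\<alpha> S x - \<beta> S x)\<^sup>2) \<le> 2 * (mean_loss \<alpha> - c)
      + 2 * (mean_loss \<beta> - c)"
proof -
  define \<mu> where "\<mu> = (\<lambda>S\<in>SS. \<lambda>x. 1 / 2 * \<alpha> S x + 1 / 2 * \<beta> S x)"
  have \<mu>: "\<mu> \<in> family" unfolding \<mu>_def by (rule family_lin[OF \<alpha> \<beta>])
  have Qe: "energy (\<lambda>S x. \<alpha> S x - \<beta> S x) = (\<lambda>x. 2 * loss \<alpha> x + 2 * loss \<beta> x - 4 * loss \<mu> x)"
    unfolding \<mu>_def by (intro ext loss_parallelogram)
  have Qi: "integrable M (energy (\<lambda>S x. \<alpha> S x - \<beta> S x))"
    unfolding Qe using loss_integrable \<alpha> \<beta> \<mu> by auto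
  have "wt_min S * expectation (\<lambda>x. (\<alpha> S x - \<beta> S x)\<^sup>2)
      = expectation (\<lambda>x. wt_min S * (\<alpha> S x - \<beta> S x)\<^sup>2)" by simp
  also have "\<dots> \<le> expectation (energy (\<lambda>S x. \<alpha> S x - \<beta> S x))"
  proof (rule integral_mono)
    show "integrable M (\<lambda>x. wt_min S * (\<alpha> S x - \<beta> S x)\<^sup>2)"
      using sq_integrable_diff[OF family_sq[OF \<alpha> S] family_sq[OF \<beta> S]]
          by (simp add: sq_integrable_def)
  qed (use Qi component_le(1)[OF S, of _ "\<lambda>S x. \<alpha> S x - \<beta> S x"] in auto)
  also have "\<dots> = 2 * mean_loss \<alpha> + 2 * mean_loss \<beta> - 4 * mean_loss \<mu>"
    unfolding Qe mean_loss_def using loss_integrable \<alpha> \<beta> \<mu> by simp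
  also have "\<dots> \<le> 2 * mean_loss \<alpha> + 2 * mean_loss \<beta> - 4 * c" using inf[OF \<mu>] by simp
  finally show ?thesis by (simp add: algebra_simps)
qed

lemma minimiser_unique:
  assumes \<alpha>: "\<alpha> \<in> family" and \<beta>: "\<beta> \<in> family" and S: "S \<in> SS"
    and min: "\<And>\<gamma>. \<gamma> \<in> family \<Longrightarrow> mean_loss \<alpha> \<le> mean_loss \<gamma>" "\<And>\<gamma>. \<gamma> \<in> family \<Longrightarrow>
        mean_loss \<beta> \<le> mean_loss \<gamma>"
  shows "AE x in M. \<alpha> S x = \<beta> S x"
proof -
  have "wt_min S * expectation (\<lambda>x. (\<alpha> S x - \<beta> S x)\<^sup>2) \<le> 2 * (mean_loss \<alpha> - mean_loss \<alpha>)
      + 2 * (mean_loss \<beta> - mean_loss \<alpha>)"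
    using near_minimisers_close[OF \<alpha> \<beta> S min(1)] by blast
  also have "\<dots> = 0" using min(1)[OF \<beta>] min(2)[OF \<alpha>] by simp
  finally have "expectation (\<lambda>x. (\<alpha> S x - \<beta> S x)\<^sup>2) \<le> 0" using wt_min_pos[OF S]
      by (simp add: mult_le_0_iff)
  then have "expectation (\<lambda>x. (\<alpha> S x - \<beta> S x)\<^sup>2) = 0" by (simp add: order_antisym)
  then have "AE x in M. (\<alpha> S x - \<beta> S x)\<^sup>2 = 0"
    using sq_integrable_diff[OF family_sq[OF \<alpha> S] family_sq[OF \<beta> S]]
    by (subst (asm) integral_nonneg_eq_0_iff_AE) (auto simp: sq_integrable_def)
  then show ?thesis by simp
qed

text \<open>A minimising sequence whose values approach the infimum geometrically has geometrically small
  increments in every component, so that it converges almost everywhere. Fatou's lemma, applied to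
  the pointwise loss, shows that the limit attains the infimum and that its components are square
  integrable.\<close>

lemma minimiser_exists: "\<exists>\<alpha>\<in>family. \<forall>\<beta>\<in>family. mean_loss \<alpha> \<le> mean_loss \<beta>"
proof -
  define c where "c = (INF \<alpha>\<in>family. mean_loss \<alpha>)"
  have ne: "family \<noteq> {}" unfolding family_def using K_zero by (auto simp: PiE_eq_empty_iff)
  have bdd: "bdd_below (mean_loss ` family)"
      by (rule bdd_belowI[of _ 0]) (auto intro: mean_loss_nonneg)
  have c: "c \<le> mean_loss \<gamma>" if "\<gamma> \<in> family" for \<gamma> unfolding c_def by (rule cINF_lower[OF bdd that])
  have c0: "0 \<le> c" unfolding c_def by (rule cINF_greatest[OF ne mean_loss_nonneg])
  have "\<exists>\<alpha>\<in>family. mean_loss \<alpha> < c + (1 / 4) ^ n" for n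
    using cInf_lessD[of "mean_loss ` family" "c + (1 / 4) ^ n"] ne unfolding c_def by auto
  then obtain g where g: "\<And>n. g n \<in> family" "\<And>n. mean_loss (g n) < c + (1 / 4) ^ n" by metis
  have rapid: "expectation (\<lambda>x. (g n S x - g (Suc n) S x)\<^sup>2) \<le> 4 / wt_min S * (1 / 4) ^ n" if S:
      "S \<in> SS" for n S
  proof -
    have "wt_min S * expectation (\<lambda>x. (g n S x - g (Suc n) S x)\<^sup>2) \<le> 2 * (mean_loss (g n) - c)
        + 2 * (mean_loss (g (Suc n)) - c)"
      by (rule near_minimisers_close[OF g(1) g(1) S c])
    also have "\<dots>
        \<le> 4 * (1 / 4) ^ n" using g(2)[of n] g(2)[of "Suc n"] zero_le_power[of "1 / 4 :: real" n]
        unfolding power_Suc by argo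
    finally show ?thesis using wt_min_pos[OF S] by (simp add: field_simps)
  qed
  define h where "h = (\<lambda>S\<in>SS. \<lambda>x. lim (\<lambda>n. g n S x))"
  have lims: "AE x in M. (\<lambda>n. g n S x) \<longlonglongrightarrow> lim (\<lambda>n. g n S x)"
      "\<exists>D. integrable M D \<and> (\<forall>n. AE x in M. \<bar>g n S x\<bar> \<le> D x)" if S: "S \<in> SS" for S
    using rapidly_Cauchy_limit[where g = "\<lambda>n. g n S", OF family_sq[OF g(1) S] rapid[OF S]] by auto
  have gm[measurable]: "S \<in> SS \<Longrightarrow> g n S \<in> borel_measurable M" for n S
    using family_sq[OF g(1)] by (auto simp: sq_integrable_def)
  have hm[measurable]: "S \<in> SS \<Longrightarrow> h S \<in> borel_measurable M" for S
    unfolding h_def by (auto intro!: borel_measurable_lim_metric)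
  have a0m[measurable]: "a0 \<in> borel_measurable M" using a0 by (simp add: sq_integrable_def)
  have Lm[measurable]: "loss h \<in> borel_measurable M"
    unfolding loss_def[abs_def]
        by (intro borel_measurable_add borel_measurable_power borel_measurable_diff
      borel_measurable_sum borel_measurable_times a0m hm wt)
  have conv: "AE x in M. \<forall>S\<in>SS. (\<lambda>n. g n S x) \<longlonglongrightarrow> h S x"
    using fin lims(1) by (intro AE_finite_allI) (auto simp: h_def)
  have "(\<integral>\<^sup>+x. ennreal (loss h x) \<partial>M) = (\<integral>\<^sup>+x. liminf (\<lambda>n. ennreal (loss (g n) x)) \<partial>M)"
  proof (rule nn_integral_cong_AE)
    show "AE x in M. ennreal (loss h x) = liminf (\<lambda>n. ennreal (loss (g n) x))"
      using conv
    proof eventually_elim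
      case (elim x)
      have "(\<lambda>n. loss (g n) x) \<longlonglongrightarrow> loss h x"
        unfolding loss_def by (intro tendsto_intros) (use elim in auto)
      then have "(\<lambda>n. ennreal (loss (g n) x)) \<longlonglongrightarrow> ennreal (loss h x)" by (intro tendsto_ennrealI)
      then show ?case by (simp add: lim_imp_Liminf)
    qed
  qed
  also have "\<dots> \<le> liminf (\<lambda>n. \<integral>\<^sup>+x. ennreal (loss (g n) x) \<partial>M)"
    using loss_integrable[OF g(1)] by (intro nn_integral_liminf) auto
  also have "(\<lambda>n. \<integral>\<^sup>+x. ennreal (loss (g n) x) \<partial>M) = (\<lambda>n. ennreal (mean_loss (g n)))"
    unfolding mean_loss_def using loss_nonneg
        by (intro ext nn_integral_eq_integral loss_integrable g AE_I2) auto
  also have "liminf (\<lambda>n. ennreal (mean_loss (g n))) = ennreal c"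
  proof (intro lim_imp_Liminf tendsto_ennrealI)
    have up: "(\<lambda>n. c + (1 / 4) ^ n) \<longlonglongrightarrow> c + 0"
      by (intro tendsto_add tendsto_const LIMSEQ_power_zero) simp
    show "(\<lambda>n. mean_loss (g n)) \<longlonglongrightarrow> c"
      by (rule tendsto_sandwich[of "\<lambda>_. c"]) (use up c[OF g(1)] less_imp_le[OF g(2)] in auto)
  qed simp
  finally have Lh: "(\<integral>\<^sup>+x. ennreal (loss h x) \<partial>M) \<le> ennreal c" .
  have Lhi: "integrable M (loss h)"
    using Lh loss_nonneg by (intro integrableI_nonneg) (auto simp: less_top[symmetric] top_unique)
  have h: "h S \<in> K S" if S: "S \<in> SS" for S
  proof -
    obtain D where D: "integrable M D" "\<And>n. AE x in M. \<bar>g n S x\<bar> \<le> D x"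
      using lims(2)[OF S] by blast
    have "integrable M (\<lambda>x. (h S x)\<^sup>2)"
    proof (rule Bochner_Integration.integrable_bound)
      show "integrable M (\<lambda>x. 1 / wt_min S * loss h x)" using Lhi by simp
      show "AE x in M. norm ((h S x)\<^sup>2) \<le> norm (1 / wt_min S * loss h x)"
      proof (rule AE_I2)
        fix x assume x: "x \<in> space M"
        show "norm ((h S x)\<^sup>2) \<le> norm (1 / wt_min S * loss h x)"
          using component_le(2)[OF S x, of h] loss_nonneg[OF x, of h] wt_min_pos[OF S]
              by (simp add: field_simps)
      qed
    qed (use hm[OF S] in measurable)
    then have "sq_integrable M (\<lambda>x. lim (\<lambda>n. g n S x))"
      using S hm[OF S] by (simp add: sq_integrable_def h_def)
    from K_closed[OF S _ lims(1)[OF S] D this] have "(\<lambda>x. lim (\<lambda>n. g n S x)) \<in> K S"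
      using g(1) S unfolding family_def by (auto dest: PiE_mem)
    then show ?thesis using S by (simp add: h_def)
  qed
  then have hF: "h \<in> family" unfolding family_def by (auto simp: h_def)
  have "mean_loss h \<le> c"
    using Lh c0 nn_integral_eq_integral[OF Lhi] loss_nonneg by (simp add: mean_loss_def AE_I2)
  then show ?thesis using hF c by (intro bexI[of _ h]) (auto intro: order_trans)
qed

text \<open>The first variation in the direction that adds a multiple of \<open>\<beta>\<close> to the component \<open>S\<close>.\<close>

lemma minimiser_stationary:
  assumes \<alpha>: "\<alpha> \<in> family" and min: "\<And>\<gamma>. \<gamma> \<in> family \<Longrightarrow> mean_loss \<alpha> \<le> mean_loss \<gamma>"
    and S: "S \<in> SS" and \<beta>: "\<beta> \<in> K S"
  shows "expectation (\<lambda>x. \<beta> x * (a0 x - (\<Sum>T\<in>SS. \<alpha> T x))) = expectation (\<lambda>x. \<alpha> S x * \<beta> x * wt S x)"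
proof -
  define r where "r x = a0 x - (\<Sum>T\<in>SS. \<alpha> T x)" for x
  have \<beta>s: "sq_integrable M \<beta>" by (rule K_sq[OF S \<beta>])
  have i1: "integrable M (\<lambda>x. \<beta> x * r x)" unfolding r_def
    by (intro sq_integrable_mult \<beta>s resid_sq \<alpha>)
  have i2: "integrable M (\<lambda>x. \<alpha> S x * \<beta> x * wt S x)"
    by (intro weighted_mult_integrable S \<beta>s family_sq \<alpha>)
  have i3: "integrable M (\<lambda>x. (\<beta> x)\<^sup>2)" "integrable M (\<lambda>x. (\<beta> x)\<^sup>2 * wt S x)"
    using \<beta>s weighted_mult_integrable[OF S \<beta>s \<beta>s] by (auto simp: sq_integrable_def power2_eq_square)
  define b where "b = expectation (\<lambda>x. \<alpha> S x * \<beta> x * wt S x) - expectation (\<lambda>x. \<beta> x * r x)"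
  define q where "q = expectation (\<lambda>x. (\<beta> x)\<^sup>2) + expectation (\<lambda>x. (\<beta> x)\<^sup>2 * wt S x)"
  have "0 \<le> 2 * e * b + e\<^sup>2 * q" for e
  proof -
    define \<gamma> where "\<gamma> = (\<lambda>T\<in>SS. \<lambda>x. 1 * \<alpha> T x + e * (\<lambda>T\<in>SS. if T = S then \<beta> else (\<lambda>_. 0)) T x)"
    have \<gamma>: "\<gamma> \<in> family" unfolding \<gamma>_def by (intro family_lin \<alpha> family_component S \<beta>)
    have \<gamma>x: "\<gamma> T x = \<alpha> T x + (if T = S then e * \<beta> x else 0)" if "T \<in> SS" for T x
      using that by (simp add: \<gamma>_def)
    have s1: "(\<Sum>T\<in>SS. \<gamma> T x) = (\<Sum>T\<in>SS. \<alpha> T x) + e * \<beta> x" for x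
      using fin S by (simp add: \<gamma>x sum.distrib sum.delta' cong: sum.cong)
    have s2: "(\<Sum>T\<in>SS. (\<gamma> T x)\<^sup>2 * wt T x) = (\<Sum>T\<in>SS. (\<alpha> T x)\<^sup>2 * wt T x)
        + (2 * e * (\<alpha> S x * \<beta> x * wt S x) + e\<^sup>2 * ((\<beta> x)\<^sup>2 * wt S x))" for x
    proof -
      have "(\<Sum>T\<in>SS. (\<gamma> T x)\<^sup>2 * wt T x) = (\<Sum>T\<in>SS. (\<alpha> T x)\<^sup>2 * wt T x +
          (if T = S then 2 * e * (\<alpha> S x * \<beta> x * wt S x) + e\<^sup>2 * ((\<beta> x)\<^sup>2 * wt S x) else 0))"
        by (intro sum.cong refl) (auto simp: \<gamma>x power2_eq_square algebra_simps)
      then show ?thesis using fin S by (simp add: sum.distrib)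
    qed
    have "loss \<gamma> x = loss \<alpha> x + (2 * e * (\<alpha> S x * \<beta> x * wt S x) - 2 * e * (\<beta> x * r x)
        + (e\<^sup>2 * (\<beta> x)\<^sup>2 + e\<^sup>2 * ((\<beta> x)\<^sup>2 * wt S x)))" for x
      unfolding loss_def s1 s2 r_def by (simp add: power2_eq_square algebra_simps)
    then have "loss \<gamma>
        = (\<lambda>x. loss \<alpha> x + (2 * e * (\<alpha> S x * \<beta> x * wt S x) - 2 * e * (\<beta> x * r x)
        + (e\<^sup>2 * (\<beta> x)\<^sup>2 + e\<^sup>2 * ((\<beta> x)\<^sup>2 * wt S x))))" by auto
    then have "mean_loss \<gamma> = mean_loss \<alpha> + (2 * e * b + e\<^sup>2 * q)"
      unfolding mean_loss_def b_def q_def using loss_integrable[OF \<alpha>] i1 i2 i3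
      by (simp only: Bochner_Integration.integral_add Bochner_Integration.integral_diff
          Bochner_Integration.integrable_add Bochner_Integration.integrable_diff
          integrable_mult_right integral_mult_right_zero) (simp add: algebra_simps)
    then show ?thesis using min[OF \<gamma>] by simp
  qed
  then have "b = 0" by (rule quadratic_min_zero)
  then show ?thesis by (simp add: b_def r_def)
qed

end

context prob_space
begin

text \<open>The projection onto the span of finitely many functions, by Gram-Schmidt. Adding \<open>\<phi> i\<close> subtracts
  the projection onto its residual \<open>e\<close>; if \<open>e\<close> is null, which happens when the functions are
  linearly dependent under \<open>M\<close>, nothing is subtracted.\<close>

lemma finite_projection:
  assumes "finite I" "\<And>i. i \<in> I \<Longrightarrow> sq_integrable M (\<phi> i)" "sq_integrable M h"
  shows "\<exists>u. \<forall>i\<in>I. expectation (\<lambda>x. (h x - (\<Sum>j\<in>I. u j * \<phi> j x)) * \<phi> i x) = 0"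
  using assms
proof (induction I arbitrary: h rule: finite_induct)
  case (insert i I)
  have sq: "sq_integrable M (\<phi> j)" if "j \<in> insert i I" for j using insert.prems that by auto
  obtain uh where uh: "\<And>j. j \<in> I \<Longrightarrow> expectation (\<lambda>x. (h x - (\<Sum>j\<in>I. uh j * \<phi> j x)) * \<phi> j x) = 0"
    using insert.IH[of h] insert.prems by auto
  obtain ue where ue: "\<And>j. j \<in> I \<Longrightarrow> expectation (\<lambda>x. (\<phi> i x - (\<Sum>j\<in>I. ue j * \<phi> j x)) * \<phi> j x) = 0"
    using insert.IH[of "\<phi> i"] insert.prems by auto
  define g where "g x = h x - (\<Sum>j\<in>I. uh j * \<phi> j x)" for x
  define e where "e x = \<phi> i x - (\<Sum>j\<in>I. ue j * \<phi> j x)" for x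
  have gs: "sq_integrable M g" and es: "sq_integrable M e"
    unfolding g_def[abs_def] e_def[abs_def] using insert.prems
    by (auto intro!: sq_integrable_diff sq_integrable_sum sq_integrable_cmult)
  define c where "c
      = (if expectation (\<lambda>x. e x * e x) = 0 then 0 else expectation (\<lambda>x. g x * e x) / expectation
      (\<lambda>x. e x * e x))"
  define r where "r x = g x - c * e x" for x
  have rs: "sq_integrable M r" unfolding r_def[abs_def]
      by (intro sq_integrable_diff gs sq_integrable_cmult es)
  have rI: "expectation (\<lambda>x. r x * \<phi> j x) = 0" if "j \<in> I" for j
  proof -
    have "expectation (\<lambda>x. r x * \<phi> j x) = expectation (\<lambda>x. g x * \<phi> j x - c * (e x * \<phi> j x))"
      by (simp add: r_def algebra_simps)
    also have "\<dots> = 0"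
      using uh[OF that] ue[OF that] sq_integrable_mult[OF gs sq] sq_integrable_mult[OF es sq] that
      by (simp add: g_def e_def)
    finally show ?thesis .
  qed
  have re: "expectation (\<lambda>x. r x * e x) = 0"
  proof (cases "expectation (\<lambda>x. e x * e x) = 0")
    case True
    then have "AE x in M. e x * e x = 0"
      using sq_integrable_mult[OF es es] by (subst (asm) integral_nonneg_eq_0_iff_AE) auto
    then have "expectation (\<lambda>x. r x * e x) = expectation (\<lambda>x. 0)"
      using sq_integrable_mult[OF rs es] by (intro integral_cong_AE) auto
    then show ?thesis by simp
  next
    case False
    have "expectation (\<lambda>x. r x * e x) = expectation (\<lambda>x. g x * e x - c * (e x * e x))"
      by (simp add: r_def algebra_simps)
    also have "\<dots> = 0"
      using sq_integrable_mult[OF gs es] sq_integrable_mult[OF es es] False by (simp add: c_def)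
    finally show ?thesis .
  qed
  have ri: "expectation (\<lambda>x. r x * \<phi> i x) = 0"
  proof -
    have "expectation (\<lambda>x. r x * \<phi> i x)
        = expectation (\<lambda>x. r x * e x + (\<Sum>j\<in>I. ue j * (r x * \<phi> j x)))"
      by (intro Bochner_Integration.integral_cong refl)
        (simp add: e_def algebra_simps sum_distrib_left)
    also have "\<dots> = 0"
      using sq_integrable_mult[OF rs es] sq_integrable_mult[OF rs sq] re rI
      by (subst Bochner_Integration.integral_add) auto
    finally show ?thesis .
  qed
  define u where "u j = (if j = i then c else uh j - c * ue j)" for j
  have "r x = h x - (\<Sum>j\<in>insert i I. u j * \<phi> j x)" for x
  proof -
    have "(\<Sum>j\<in>I. u j * \<phi> j x) = (\<Sum>j\<in>I. uh j * \<phi> j x) - c * (\<Sum>j\<in>I. ue j * \<phi> j x)"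
      unfolding sum_distrib_left sum_subtractf[symmetric] using insert.hyps(2)
      by (intro sum.cong) (auto simp: u_def algebra_simps)
    then show ?thesis using insert.hyps by (simp add: r_def g_def e_def u_def algebra_simps)
  qed
  then show ?case using rI ri by (intro exI[of _ u]) auto
qed auto

end

section \<open>The orthogonal complement of the constraint spaces\<close>

context tilted_model
begin

lemma H_perp_iff:
  "\<alpha> \<in> H_perp d f k psi S \<longleftrightarrow> sq_integrable P \<alpha> \<and>
     (\<forall>x\<in>space E. \<forall>y\<in>space E. restrict x S = restrict y S \<longrightarrow> \<alpha> x = \<alpha> y) \<and>
     (\<integral>x. \<alpha> x \<partial>P) = 0 \<and> (\<forall>j\<in>{1..k}. (\<integral>x. \<alpha> x * psi j (restrict x S) \<partial>P) = 0)"
proof (cases "\<alpha> \<in> borel_measurable E")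
  case True
  then show ?thesis
    unfolding H_perp_def H_def L2_def sq_integrable_def by (auto simp: P_integrable P_integral)
qed (auto simp: H_perp_def H_def L2_def sq_integrable_def)

lemma psi_restrict_measurable: "j \<in> {1..k} \<Longrightarrow> (\<lambda>x. psi j (restrict x S)) \<in> borel_measurable E"
  by (rule measurable_compose[OF restrict_measurable psi])

lemma psi_bound:
  assumes "j \<in> {1..k}" obtains B where "\<And>x. x \<in> space E \<Longrightarrow> \<bar>psi j (restrict x S)\<bar> \<le> B"
proof -
  obtain B where "\<And>y. y \<in> space (Rspace S) \<Longrightarrow> \<bar>psi j y\<bar> \<le> B"
    using psi_bounded[OF assms] by (auto simp: bounded_iff)
  then show ?thesis using that[of B] measurable_space[OF restrict_measurable] by blast
qed

lemma psi_sq: assumes j: "j \<in> {1..k}" shows "sq_integrable P (\<lambda>x. psi j (restrict x S))"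
proof -
  obtain B where "\<And>x. x \<in> space E \<Longrightarrow> \<bar>psi j (restrict x S)\<bar> \<le> B" using psi_bound[OF j] by metis
  then have "sq_integrable P (\<lambda>x. psi j (restrict x S) * 1)"
    using psi_restrict_measurable[OF j]
        by (intro sq_integrable_bounded_mult sq_integrable_const) (auto simp: P_space)
  then show ?thesis by simp
qed

lemma H_perp_zero: "(\<lambda>_. 0) \<in> H_perp d f k psi S"
  by (auto simp: H_perp_iff sq_integrable_const)

lemma H_perp_lin:
  assumes "\<alpha> \<in> H_perp d f k psi S" "\<beta> \<in> H_perp d f k psi S"
  shows "(\<lambda>x. c * \<alpha> x + e * \<beta> x) \<in> H_perp d f k psi S"
proof -
  have \<alpha>: "sq_integrable P \<alpha>" and \<beta>: "sq_integrable P \<beta>" using assms by (auto simp: H_perp_iff)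
  have 1: "sq_integrable P (\<lambda>x. c * \<alpha> x + e * \<beta> x)"
      by (intro sq_integrable_add sq_integrable_cmult \<alpha> \<beta>)
  have 2: "(\<integral>x. c * \<alpha> x + e * \<beta> x \<partial>P) = 0"
    using assms sq_integrable_int[OF \<alpha>] sq_integrable_int[OF \<beta>] by (simp add: H_perp_iff)
  have 3: "(\<integral>x. (c * \<alpha> x + e * \<beta> x) * psi j (restrict x S) \<partial>P) = 0" if j: "j \<in> {1..k}" for j
  proof -
    have "(\<integral>x. (c * \<alpha> x + e * \<beta> x) * psi j (restrict x S) \<partial>P)
        = (\<integral>x. c * (\<alpha> x * psi j (restrict x S)) + e * (\<beta> x * psi j (restrict x S)) \<partial>P)"
      by (intro Bochner_Integration.integral_cong refl) (simp add: algebra_simps)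
    also have "\<dots> = 0"
      using assms j sq_integrable_mult[OF \<alpha> psi_sq[OF j]] sq_integrable_mult[OF \<beta> psi_sq[OF j]]
      by (simp add: H_perp_iff)
    finally show ?thesis .
  qed
  have 4: "c * \<alpha> x + e * \<beta> x = c * \<alpha> y + e * \<beta> y"
    if "x \<in> space E" "y \<in> space E" "restrict x S = restrict y S" for x y
  proof -
    have "\<alpha> x = \<alpha> y" "\<beta> x = \<beta> y" using assms that unfolding H_perp_iff by blast+
    then show ?thesis by simp
  qed
  show ?thesis unfolding H_perp_iff using 1 2 3 4 by blast
qed

text \<open>Both families of linear constraints are integrals against bounded functions and pass to
  dominated limits.\<close>

lemma H_perp_closed:
  assumes g: "\<And>n :: nat. g n \<in> H_perp d f k psi S"
    and lim: "AE x in P. (\<lambda>n. g n x) \<longlonglongrightarrow> lim (\<lambda>n. g n x)" and D: "integrable P D"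
    and bd: "\<And>n. AE x in P. \<bar>g n x\<bar> \<le> D x" and sq: "sq_integrable P (\<lambda>x. lim (\<lambda>n. g n x))"
  shows "(\<lambda>x. lim (\<lambda>n. g n x)) \<in> H_perp d f k psi S"
proof -
  have gm: "g n \<in> borel_measurable P" for n using g[of n]
      by (simp add: H_perp_iff sq_integrable_def)
  have lm: "(\<lambda>x. lim (\<lambda>n. g n x)) \<in> borel_measurable P" using sq by (simp add: sq_integrable_def)
  have key: "(\<integral>x. e x * lim (\<lambda>n. g n x) \<partial>P) = 0"
    if e: "e \<in> borel_measurable P" and B: "\<And>x. x \<in> space E \<Longrightarrow> \<bar>e x\<bar> \<le> B"
      and z: "\<And>n. (\<integral>x. e x * g n x \<partial>P) = 0" for e B
  proof -
    have "integrable P (\<lambda>x. \<bar>e x\<bar> * D x)"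
    proof (rule Bochner_Integration.integrable_bound)
      show "integrable P (\<lambda>x. B * D x)" using D by simp
      show "(\<lambda>x. \<bar>e x\<bar> * D x) \<in> borel_measurable P" using e D by measurable
      show "AE x in P. norm (\<bar>e x\<bar> * D x) \<le> norm (B * D x)"
      proof (rule AE_I2)
        fix x assume "x \<in> space P"
        then have "\<bar>e x\<bar> \<le> \<bar>B\<bar>" using B[of x] by (simp add: P_space)
        then show "norm (\<bar>e x\<bar> * D x) \<le> norm (B * D x)" by (simp add: abs_mult mult_right_mono)
      qed
    qed
    from tendsto_dominated_integral_mult[OF gm lm e lim bd this] show ?thesis
      by (simp add: z LIMSEQ_const_iff)
  qed
  have 1: "(\<integral>x. lim (\<lambda>n. g n x) \<partial>P) = 0"
    using key[of "\<lambda>_. 1" 1] g by (simp add: H_perp_iff)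
  have 2: "(\<integral>x. lim (\<lambda>n. g n x) * psi j (restrict x S) \<partial>P) = 0" if j: "j \<in> {1..k}" for j
  proof -
    obtain B where B: "\<And>x. x \<in> space E \<Longrightarrow> \<bar>psi j (restrict x S)\<bar> \<le> B" using psi_bound[OF j] by metis
    have "(\<integral>x. psi j (restrict x S) * lim (\<lambda>n. g n x) \<partial>P) = 0"
      using g j psi_sq[OF j]
          by (intro key[OF _ B]) (auto simp: H_perp_iff sq_integrable_def mult.commute)
    then show ?thesis by (simp add: mult.commute)
  qed
  have 3: "lim (\<lambda>n. g n x) = lim (\<lambda>n. g n y)"
    if "x \<in> space E" "y \<in> space E" "restrict x S = restrict y S" for x y
  proof -
    have "g n x = g n y" for n using g[of n] that unfolding H_perp_iff by blast
    then show ?thesis by simp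
  qed
  show ?thesis unfolding H_perp_iff using sq 1 2 3 by blast
qed

text \<open>Subtract from \<open>h\<close> its projection onto the span of 1 and the \<open>\<Psi>\<^sub>S\<close>. The residual belongs to
  \<open>H\<^sub>S\<^sup>\<bottom>\<close>, so it is orthogonal to \<open>h\<close> and to the projection, hence to itself.\<close>

lemma orthogonal_complement_H_perp:
  assumes h: "sq_integrable P h"
    and dep: "\<And>x y. x \<in> space E \<Longrightarrow> y \<in> space E \<Longrightarrow> restrict x S = restrict y S \<Longrightarrow> h x = h y"
    and orth: "\<And>\<beta>. \<beta> \<in> H_perp d f k psi S \<Longrightarrow> (\<integral>x. \<beta> x * h x \<partial>P) = 0"
  shows "\<exists>c u. AE x in P. h x = c + lin_comb k u psi (restrict x S)"
proof -
  define \<phi> where "\<phi> j x = (if j = 0 then 1 else psi j (restrict x S))" for j x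
  have \<phi>sq: "sq_integrable P (\<phi> j)" if "j \<in> {0..k}" for j
    using that psi_sq[of j] sq_integrable_const[of 1] unfolding \<phi>_def[abs_def]
        by (cases "j = 0") auto
  obtain u where u: "\<And>i. i \<in> {0..k} \<Longrightarrow> (\<integral>x. (h x - (\<Sum>j\<in>{0..k}. u j * \<phi> j x)) * \<phi> i x \<partial>P) = 0"
    using finite_projection[of "{0..k}" \<phi> h, OF finite_atLeastAtMost \<phi>sq h] by blast
  define r where "r x = h x - (\<Sum>j\<in>{0..k}. u j * \<phi> j x)" for x
  have rsq: "sq_integrable P r" unfolding r_def[abs_def]
    by (intro sq_integrable_diff h sq_integrable_sum sq_integrable_cmult \<phi>sq)
  have r\<phi>: "(\<integral>x. r x * \<phi> i x \<partial>P) = 0" if "i \<in> {0..k}" for i using u[OF that] by (simp add: r_def)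
  have "r x = r y" if "x \<in> space E" "y \<in> space E" "restrict x S = restrict y S" for x y
    unfolding r_def \<phi>_def using dep[OF that] that(3) by (simp only:)
  moreover have "(\<integral>x. r x \<partial>P) = 0" using r\<phi>[of 0] by (simp add: \<phi>_def)
  moreover have "(\<integral>x. r x * psi j (restrict x S) \<partial>P) = 0" if "j \<in> {1..k}" for j
    using r\<phi>[of j] that by (simp add: \<phi>_def)
  ultimately have rH: "r \<in> H_perp d f k psi S" unfolding H_perp_iff using rsq by blast
  have "(\<integral>x. r x * r x \<partial>P) = (\<integral>x. r x * h x - (\<Sum>j\<in>{0..k}. u j * (r x * \<phi> j x)) \<partial>P)"
  proof (intro Bochner_Integration.integral_cong refl)
    fix x
    have "(\<Sum>j\<in>{0..k}. u j * (r x * \<phi> j x)) = r x * (\<Sum>j\<in>{0..k}. u j * \<phi> j x)"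
      by (simp add: sum_distrib_left ac_simps)
    also have "(\<Sum>j\<in>{0..k}. u j * \<phi> j x) = h x - r x" by (simp add: r_def)
    finally show "r x * r x = r x * h x - (\<Sum>j\<in>{0..k}. u j * (r x * \<phi> j x))"
        by (simp add: algebra_simps)
  qed
  also have "\<dots> = 0"
    using sq_integrable_mult[OF rsq h] sq_integrable_mult[OF rsq \<phi>sq] orth[OF rH] r\<phi>
    by (subst Bochner_Integration.integral_diff) (auto simp del: sum.atLeast0_atMost_Suc)
  finally have "AE x in P. r x * r x = 0"
    using sq_integrable_mult[OF rsq rsq] by (subst (asm) integral_nonneg_eq_0_iff_AE) auto
  then have "AE x in P. h x = u 0 + lin_comb k u psi (restrict x S)"
  proof eventually_elim
    case (elim x)
    have "(\<Sum>j\<in>{0..k}. u j * \<phi> j x) = u 0 + lin_comb k u psi (restrict x S)"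
      unfolding lin_comb_def
          by (subst sum.atLeast_Suc_atMost) (auto simp: \<phi>_def One_nat_def intro!: sum.cong)
    then show ?case using elim by (simp add: r_def)
  qed
  then show ?thesis by blast
qed

end

section \<open>The lower bound along the least favourable path\<close>

text \<open>For small \<open>\<delta>\<close> the left-hand side is close to \<open>\<delta> sqrt (M L)\<close>, which is smaller than \<open>\<delta> L\<close>. The
  choice \<open>exp (2 \<delta>\<^sup>2 L) = L / M\<close> is small enough.\<close>

lemma step_size:
  fixes M L :: real
  assumes "0 < M" "M < L"
  obtains \<delta> where "0 < \<delta>" "sqrt (M * (exp (\<delta>\<^sup>2 * L) - 1)) < \<delta> * L"
proof -
  define q where "q = ln (L / M)"
  have q: "0 < q" using assms by (simp add: q_def)
  define \<delta> where "\<delta> = sqrt (q / (2 * L))"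
  have L: "0 < L" using assms by simp
  have \<delta>: "0 < \<delta>" "\<delta>\<^sup>2 * L = q / 2" using q L by (simp_all add: \<delta>_def)
  define y where "y = q / 2"
  have y: "0 < y" using q by (simp add: y_def)
  have "exp y * (1 - y) \<le> exp y * exp (- y)" using exp_ge_add_one_self[of "- y"]
      by (intro mult_left_mono) auto
  then have "exp y - 1 \<le> y * exp y" by (simp add: exp_minus algebra_simps)
  also have "\<dots> < y * exp q" using y by (simp add: y_def)
  also have "exp q = L / M" using assms by (simp add: q_def)
  finally have "M * (exp (\<delta>\<^sup>2 * L) - 1) < M * (y * (L / M))"
    using assms unfolding \<delta>(2) y_def[symmetric] by (intro mult_strict_left_mono)
  also have "\<dots> = (\<delta> * L)\<^sup>2" using assms \<delta>(2)
      by (simp add: y_def power_mult_distrib power2_eq_square)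
  finally have "sqrt (M * (exp (\<delta>\<^sup>2 * L) - 1)) < \<delta> * L" using \<delta>(1) L by (intro real_less_lsqrt) auto
  then show ?thesis using \<delta>(1) that by blast
qed

locale study = density_model +
  fixes a :: "(nat \<Rightarrow> real) \<Rightarrow> real"
    and SS :: "nat set set"
    and k :: "nat set \<Rightarrow> nat"
    and Psi :: "nat set \<Rightarrow> nat \<Rightarrow> (nat \<Rightarrow> real) \<Rightarrow> real"
    and w :: "nat set \<Rightarrow> nat \<Rightarrow> real"
    and N :: "nat set \<Rightarrow> nat \<Rightarrow> nat"
    and lam :: "nat set \<Rightarrow> real"
  assumes SS: "SS \<subseteq> Pow {1..d}"
    and Psi: "\<And>S j. S \<in> SS \<Longrightarrow> j \<in> {1..k S} \<Longrightarrow> Psi S j \<in> borel_measurable (Rspace S)"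
    and Psi_bounded: "\<And>S j. S \<in> SS \<Longrightarrow> j \<in> {1..k S} \<Longrightarrow> bounded (Psi S j ` space (Rspace S))"
    and a: "a \<in> borel_measurable E"
    and a2: "integrable E (\<lambda>x. (a x)\<^sup>2 * f x)"
    and lam: "\<And>S. S \<in> SS \<Longrightarrow> lam S > 0"
    and N: "\<And>S. S \<in> SS \<Longrightarrow> (\<lambda>n. real (N S n) / real n) \<longlonglongrightarrow> lam S"
begin

lemma tilted: "S \<in> SS \<Longrightarrow> tilted_model d f S (k S) (Psi S)"
  using SS Psi Psi_bounded by unfold_locales auto

lemma finite_SS: "finite SS"
  using SS by (rule finite_subset) simp

definition "wt S x = 1 / (lam S * normalised_tilt d f S (k S) (w S) (Psi S) (restrict x S))"

abbreviation "K S \<equiv> H_perp d f (k S) (Psi S) S"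

abbreviation "th \<equiv> theta d a f"

abbreviation "a0 \<equiv> \<lambda>x. a x - th"

abbreviation "obj \<equiv> objective d f SS k Psi w lam a"

lemma a_sq: "sq_integrable P a"
  using a a2 unfolding sq_integrable_def by (auto simp: P_integrable)

lemma th_eq: "th = (\<integral>x. a x \<partial>P)"
  unfolding theta_def using a by (simp add: P_integral)

lemma wt_measurable: "S \<in> SS \<Longrightarrow> wt S \<in> borel_measurable P"
proof -
  assume "S \<in> SS"
  then interpret tilted_model d f S "k S" "Psi S" "w S" by (rule tilted)
  show ?thesis unfolding wt_def[abs_def] by measurable
qed

lemma wt_bounded:
  assumes SI: "S \<in> SS"
  shows "\<exists>l h. 0 < l \<and> (\<forall>x\<in>space P. l \<le> wt S x \<and> wt S x \<le> h)"
proof -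
  interpret tilted_model d f S "k S" "Psi S" "w S" by (rule tilted[OF SI])
  obtain lo hi where lo: "0 < lo" and b: "\<And>x. x \<in> space (Rspace S) \<Longrightarrow> lo \<le> rbar x"
      "\<And>x. x \<in> space (Rspace S) \<Longrightarrow> rbar x \<le> hi"
    using rbar_bounds by metis
  have bx: "lo \<le> rbar (restrict x S)" "rbar (restrict x S) \<le> hi" if "x \<in> space P" for x
    using b measurable_space[OF restrict_measurable] that by (auto simp: P_space)
  obtain z where "z \<in> space P" using not_empty by auto
  then have "0 < hi" using bx[of z] lo by linarith
  have "1 / (lam S * hi) \<le> wt S x \<and> wt S x \<le> 1 / (lam S * lo)" if "x \<in> space P" for x
    using bx[OF that] lo lam[OF SI] unfolding wt_def
        by (auto intro!: divide_left_mono mult_pos_pos mult_left_mono)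
  then show ?thesis using \<open>0 < hi\<close> lam[OF SI]
      by (intro exI[of _ "1 / (lam S * hi)"] exI[of _ "1 / (lam S * lo)"]) auto
qed

sublocale ls: least_squares P SS K wt a0
proof unfold_locales
  fix S assume S: "S \<in> SS"
  interpret tilted_model d f S "k S" "Psi S" "w S" by (rule tilted[OF S])
  show "sq_integrable P \<alpha>" if "\<alpha> \<in> K S" for \<alpha> using that by (simp add: H_perp_iff)
  show "(\<lambda>_. 0) \<in> K S" by (rule H_perp_zero)
  show "(\<lambda>x. c * \<alpha> x + e * \<beta> x) \<in> K S" if "\<alpha> \<in> K S" "\<beta> \<in> K S" for \<alpha> \<beta> c e
    by (rule H_perp_lin[OF that])
  show "(\<lambda>x. lim (\<lambda>n. g n x)) \<in> K S"
    if "\<And>n :: nat. g n \<in> K S" "AE x in P. (\<lambda>n. g n x) \<longlonglongrightarrow> lim (\<lambda>n. g n x)" "integrable P D"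
      "\<And>n. AE x in P. \<bar>g n x\<bar> \<le> D x" "sq_integrable P (\<lambda>x. lim (\<lambda>n. g n x))" for g D
    by (rule H_perp_closed[OF that])
qed (use wt_bounded finite_SS wt_measurable a_sq in \<open>auto intro: sq_integrable_diff
    sq_integrable_const\<close>)

lemma family_eq: "H_perp_prod d f SS k Psi = ls.family"
  by (simp add: H_perp_prod_def ls.family_def)

lemma K_mean: "S \<in> SS \<Longrightarrow> \<beta> \<in> K S \<Longrightarrow> (\<integral>x. \<beta> x \<partial>P) = 0"
proof -
  assume S: "S \<in> SS" and b: "\<beta> \<in> K S"
  interpret tilted_model d f S "k S" "Psi S" "w S" by (rule tilted[OF S])
  show ?thesis using b by (simp add: H_perp_iff)
qed

lemma family_K: "\<alpha> \<in> ls.family \<Longrightarrow> S \<in> SS \<Longrightarrow> \<alpha> S \<in> K S"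
  by (auto simp: ls.family_def)

lemma objective_eq: assumes \<alpha>: "\<alpha> \<in> ls.family" shows "obj \<alpha> = ls.mean_loss \<alpha>"
proof -
  have "expectation (\<lambda>x. a x - (\<Sum>S\<in>SS. \<alpha> S x)) = th"
    using sq_integrable_int[OF a_sq] sq_integrable_int[OF ls.family_sq[OF \<alpha>]] K_mean family_K[OF \<alpha>]
    by (simp add: th_eq)
  then have "obj \<alpha> = (\<integral>x. (a0 x - (\<Sum>S\<in>SS. \<alpha> S x))\<^sup>2 \<partial>P) + (\<Sum>S\<in>SS. \<integral>x. (\<alpha> S x)\<^sup>2 * wt S x \<partial>P)"
    by (simp add: objective_def wt_def algebra_simps)
  also have "\<dots> = ls.mean_loss \<alpha>"
    unfolding ls.mean_loss_def ls.loss_def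
    using ls.resid_sq[OF \<alpha>] ls.weighted_mult_integrable[OF _ ls.family_sq[OF \<alpha>] ls.family_sq[OF \<alpha>]]
    by (subst Bochner_Integration.integral_add) (auto simp: sq_integrable_def power2_eq_square)
  finally show ?thesis .
qed

lemma minimiser_iff:
  "minimiser d f SS k Psi w lam a \<alpha> \<longleftrightarrow> \<alpha> \<in> ls.family
      \<and> (\<forall>\<beta>\<in>ls.family. ls.mean_loss \<alpha> \<le> ls.mean_loss \<beta>)"
  unfolding minimiser_def is_arg_min_def family_eq using objective_eq by (force simp: not_less)

context
  fixes \<alpha> assumes \<alpha>: "\<alpha> \<in> ls.family" and min: "\<And>\<beta>. \<beta> \<in> ls.family \<Longrightarrow> ls.mean_loss \<alpha> \<le> ls.mean_loss \<beta>"
begin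

definition "\<phi> = influence d f SS a \<alpha>"

lemma phi_eq: "\<phi> x = a0 x - (\<Sum>S\<in>SS. \<alpha> S x)"
  by (simp add: \<phi>_def influence_def)

lemma phi_sq: "sq_integrable P \<phi>"
  using ls.resid_sq[OF \<alpha>] unfolding phi_eq[abs_def] .

lemma phi_mean: "(\<integral>x. \<phi> x \<partial>P) = 0"
  unfolding phi_eq using sq_integrable_int[OF a_sq] sq_integrable_int[OF ls.family_sq[OF \<alpha>]]
      K_mean family_K[OF \<alpha>]
  by (simp add: th_eq prob_space)

lemma stationary:
  "S \<in> SS \<Longrightarrow> \<beta> \<in> K S \<Longrightarrow> (\<integral>x. \<beta> x * \<phi> x \<partial>P) = (\<integral>x. \<alpha> S x * \<beta> x * wt S x \<partial>P)"
  unfolding phi_eq by (rule ls.minimiser_stationary[OF \<alpha> min])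

definition "tilted_information S = (\<integral>x. (\<alpha> S x)\<^sup>2 * wt S x \<partial>P)"

text \<open>The Fisher information of the path below: the complete observations contribute the variance of
  \<open>\<phi>\<close>, the incomplete ones on \<open>S\<close> the term \<open>tilted_information S\<close>.\<close>

lemma information: "(\<integral>x. (\<phi> x)\<^sup>2 \<partial>P) + (\<Sum>S\<in>SS. tilted_information S) = ls.mean_loss \<alpha>"
  unfolding ls.mean_loss_def ls.loss_def tilted_information_def phi_eq
  using ls.resid_sq[OF \<alpha>] ls.weighted_mult_integrable[OF _ ls.family_sq[OF \<alpha>] ls.family_sq[OF \<alpha>]]
  by (subst Bochner_Integration.integral_add) (auto simp: sq_integrable_def power2_eq_square)

text \<open>The speed of the functional along the path. Writing \<open>a = \<phi> + \<theta> + \<Sum>\<^sub>S \<alpha>\<^sub>S\<close> and applying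
  stationarity to \<open>\<beta> = \<alpha>\<^sub>S\<close> turns it into the minimal value, the same number as the information.\<close>

lemma derivative: "(\<integral>x. a x * \<phi> x \<partial>P) = ls.mean_loss \<alpha>"
proof -
  have "(\<integral>x. a x * \<phi> x \<partial>P) = (\<integral>x. (\<phi> x)\<^sup>2 + (th * \<phi> x + (\<Sum>S\<in>SS. \<alpha> S x * \<phi> x)) \<partial>P)"
  proof (intro Bochner_Integration.integral_cong refl)
    fix x
    have "a x = \<phi> x + th + (\<Sum>S\<in>SS. \<alpha> S x)" by (simp add: phi_eq)
    then show "a x * \<phi> x = (\<phi> x)\<^sup>2 + (th * \<phi> x + (\<Sum>S\<in>SS. \<alpha> S x * \<phi> x))"
      by (simp add: power2_eq_square algebra_simps flip: sum_distrib_right)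
  qed
  also have "\<dots> = (\<integral>x. (\<phi> x)\<^sup>2 \<partial>P) + (\<Sum>S\<in>SS. \<integral>x. \<alpha> S x * \<phi> x \<partial>P)"
    using phi_sq sq_integrable_int[OF phi_sq] sq_integrable_mult[OF ls.family_sq[OF \<alpha>] phi_sq]
        phi_mean
    by (simp add: sq_integrable_def)
  also have "(\<Sum>S\<in>SS. \<integral>x. \<alpha> S x * \<phi> x \<partial>P) = (\<Sum>S\<in>SS. tilted_information S)"
    by (intro sum.cong refl) (simp add: stationary family_K[OF \<alpha>] tilted_information_def
        power2_eq_square)
  finally show ?thesis by (simp add: information)
qed

text \<open>The tilt direction \<open>u\<close> cancels the part of the score \<open>E(\<phi>(X) | X\<^sub>S)\<close> that the unknown parameter
  of the tilt can absorb; what is left is the component \<open>\<alpha>\<^sub>S\<close> of the minimiser, weighted.\<close>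

definition least_favourable :: "nat set \<Rightarrow> (nat \<Rightarrow> real) \<Rightarrow> bool" where
  "least_favourable S u \<longleftrightarrow> (\<exists>c. AE x in P.
     marginal_model.cond d f S \<phi> (restrict x S) + lin_comb (k S) u (Psi S) (restrict x S)
       = \<alpha> S x / (lam S * normalised_tilt d f S (k S) (w S) (Psi S) (restrict x S)) + c)"

text \<open>By stationarity and the tower property, \<open>E(\<phi>(X) | X\<^sub>S) - \<alpha>\<^sub>S / (\<lambda>\<^sub>S r\<^sub>S)\<close> is orthogonal to
  \<open>H\<^sub>S\<^sup>\<bottom>\<close>, so it is a constant plus a linear combination of \<open>\<Psi>\<^sub>S\<close>; take the negative of its
  coefficients.\<close>

lemma least_favourable_direction:
  assumes SI: "S \<in> SS"
  shows "\<exists>u. least_favourable S u"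
proof -
  interpret tilted_model d f S "k S" "Psi S" "w S" by (rule tilted[OF SI])
  define h where "h x = cond \<phi> (restrict x S) - wt S x * \<alpha> S x" for x
  have \<alpha>S: "sq_integrable P (\<alpha> S)" by (rule ls.family_sq[OF \<alpha> SI])
  have \<alpha>dep: "\<alpha> S x = \<alpha> S y" if "x \<in> space E" "y \<in> space E" "restrict x S = restrict y S" for x y
    using family_K[OF \<alpha> SI] that unfolding H_perp_iff by blast
  have csq: "sq_integrable P (\<lambda>x. cond \<phi> (restrict x S))" by (rule cond_sq_integrable_P[OF phi_sq])
  have hsq: "sq_integrable P h"
    unfolding h_def[abs_def] by (intro sq_integrable_diff csq ls.weighted_sq SI \<alpha>S)
  have hdep: "h x = h y" if "x \<in> space E" "y \<in> space E" "restrict x S = restrict y S" for x y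
    unfolding h_def wt_def using \<alpha>dep[OF that] that(3) by (simp only:)
  have orth: "(\<integral>x. \<beta> x * h x \<partial>P) = 0" if \<beta>: "\<beta> \<in> K S" for \<beta>
  proof -
    have \<beta>sq: "sq_integrable P \<beta>" and \<beta>dep: "\<And>x y. x \<in> space E \<Longrightarrow> y \<in> space E \<Longrightarrow>
        restrict x S = restrict y S \<Longrightarrow> \<beta> x = \<beta> y"
      using \<beta> unfolding H_perp_iff by blast+
    have "(\<integral>x. \<beta> x * h x \<partial>P) = (\<integral>x. \<beta> x * cond \<phi> (restrict x S) - \<alpha> S x * \<beta> x * wt S x \<partial>P)"
      by (intro Bochner_Integration.integral_cong refl) (simp add: h_def algebra_simps)
    also have "\<dots> = (\<integral>x. \<beta> x * cond \<phi> (restrict x S) \<partial>P) - (\<integral>x. \<alpha> S x * \<beta> x * wt S x \<partial>P)"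
      by (rule Bochner_Integration.integral_diff[OF sq_integrable_mult[OF \<beta>sq csq]
          ls.weighted_mult_integrable[OF SI \<alpha>S \<beta>sq]])
    also have "\<dots> = 0"
    proof -
      have "(\<integral>x. \<beta> x * cond \<phi> (restrict x S) \<partial>P) = (\<integral>x. \<beta> x * \<phi> x \<partial>P)"
        by (rule cond_tower[OF phi_sq \<beta>sq]) (rule \<beta>dep)
      then show ?thesis using stationary[OF SI \<beta>] by (simp only: diff_self)
    qed
    finally show ?thesis .
  qed
  obtain c u where "AE x in P. h x = c + lin_comb (k S) u (Psi S) (restrict x S)"
    using orthogonal_complement_H_perp[OF hsq hdep orth] by blast
  then have "AE x in P. cond \<phi> (restrict x S) + lin_comb (k S) (\<lambda>j. - u j) (Psi S) (restrict x S)
       = \<alpha> S x / (lam S * rbar (restrict x S)) + c"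
  proof eventually_elim
    case (elim x)
    have "lin_comb (k S) (\<lambda>j. - u j) (Psi S) (restrict x S)
        = - lin_comb (k S) u (Psi S) (restrict x S)"
      by (simp add: lin_comb_def sum_negf)
    then show ?case using elim by (simp add: h_def wt_def algebra_simps)
  qed
  then show ?thesis unfolding least_favourable_def by blast
qed

context
  fixes dir :: "nat set \<Rightarrow> nat \<Rightarrow> real"
  assumes dir: "\<And>S. S \<in> SS \<Longrightarrow> least_favourable S (dir S)"
begin

definition "vpath t = (\<lambda>S\<in>SS. \<lambda>j\<in>{1..k S}. t * dir S j)"

lemma vpath: "vpath t \<in> vec_families SS k"
  by (auto simp: vpath_def vec_families_def vecs_def)

abbreviation "Q n t \<equiv> local_law d f SS k Psi w N \<phi> n t (vpath t)"

abbreviation "QS n t S \<equiv> law S (\<lambda>x. normalised_tilt d (local_density d f \<phi> n t) S (k S)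
    (\<lambda>j. w S j + t * dir S j / sqrt (real n)) (Psi S) x
        * marginal d (local_density d f \<phi> n t) S x)"

lemma Q_eq: "Q n t = PiM {1..n} (\<lambda>_. law {1..d} (local_density d f \<phi> n t)) \<Otimes>\<^sub>M
    PiM SS (\<lambda>S. PiM {1..N S n} (\<lambda>_. QS n t S))"
proof -
  have *: "lin_comb (k S) (\<lambda>j. w S j + vpath t S j / sqrt (real n)) (Psi S)
      = lin_comb (k S) (\<lambda>j. w S j + t * dir S j / sqrt (real n)) (Psi S)" if "S \<in> SS" for S
    using that unfolding lin_comb_def[abs_def] by (intro ext sum.cong) (auto simp: vpath_def)
  then have "normalised_tilt d g S (k S) (\<lambda>j. w S j + vpath t S j / sqrt (real n)) (Psi S)
      = normalised_tilt d g S (k S) (\<lambda>j. w S j + t * dir S j / sqrt (real n)) (Psi S)" if "S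
          \<in> SS" for S g
    using *[OF that] unfolding normalised_tilt_def[abs_def] tilt_def[abs_def] by (simp only:)
  then show ?thesis unfolding local_law_def data_law_def
    by (intro arg_cong2[where f = pair_measure] refl PiM_cong) simp_all
qed

lemma QS_prob: assumes S: "S \<in> SS" shows "prob_space (QS n t S)"
proof -
  interpret tilted_model d f S "k S" "Psi S" "w S" by (rule tilted[OF S])
  show ?thesis using phi_sq sq_measurable[OF phi_sq]
      by (intro S_prob) (auto simp: sq_integrable_def)
qed

lemma Q_prob: "prob_space (Q n t)"
  unfolding Q_eq by (intro prob_space_pair prob_space_PiM X_prob phi_sq QS_prob)

lemma Q_sets: "sets (Q n t) = sets (data_space d SS n (\<lambda>S. N S n))"
  unfolding Q_eq data_space_def
      by (intro sets_pair_measure_cong sets_PiM_cong refl) (auto simp: law_def)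

text \<open>The second moments multiply over the observations, and \<open>(1 + \<kappa>)\<^sup>n \<le> exp (n \<kappa>)\<close>. The factor \<open>\<lambda>\<^sub>S\<close>
  gained from the sample sizes cancels the \<open>\<lambda>\<^sub>S\<close> in the variance of the score, so that the
  exponents add up to the information.\<close>

lemma data_chi2:
  "\<exists>C. (\<forall>n. chi2_le (Q n s) (Q n t) (ennreal (C n))) \<and> C \<longlonglongrightarrow> exp ((t - s)\<^sup>2 * ls.mean_loss \<alpha>)"
proof -
  obtain \<kappa> where \<kappa>: "\<And>n. chi2_le (law {1..d} (local_density d f \<phi> n s))
      (law {1..d} (local_density d f \<phi> n t)) (ennreal (1 + \<kappa> n))"
      "\<And>n. \<kappa> n \<ge> 0" and \<kappa>_lim: "(\<lambda>n. real n * \<kappa> n) \<longlonglongrightarrow> (t - s)\<^sup>2 * (\<integral>x. (\<phi> x)\<^sup>2 \<partial>P)"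
    using X_chi2[OF phi_sq phi_mean, of s t] by blast
  have each: "\<exists>\<kappa>. (\<forall>n. chi2_le (QS n s S) (QS n t S) (ennreal (1 + \<kappa> n)) \<and> \<kappa> n \<ge> 0) \<and>
      (\<lambda>n. real n * \<kappa> n) \<longlonglongrightarrow> (t - s)\<^sup>2 * tilted_information S / lam S" if SI: "S \<in> SS" for S
  proof -
    interpret tilted_model d f S "k S" "Psi S" "w S" by (rule tilted[OF SI])
    obtain c where c: "AE x in P. cond \<phi> (restrict x S)
        + lin_comb (k S) (dir S) (Psi S) (restrict x S)
       = \<alpha> S x / (lam S * rbar (restrict x S))
           + c" using dir[OF SI] unfolding least_favourable_def by blast
    have info: "tilted_information S = (\<integral>x. (\<alpha> S x)\<^sup>2 / (lam S * rbar (restrict x S)) \<partial>P)"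
      by (simp add: tilted_information_def wt_def)
    show ?thesis unfolding info
      by (rule S_chi2[OF phi_sq ls.family_sq[OF \<alpha> SI] lam[OF SI] K_mean[OF SI family_K[OF \<alpha> SI]] c])
  qed
  have "\<exists>\<kappa>. \<forall>S\<in>SS. (\<forall>n. chi2_le (QS n s S) (QS n t S) (ennreal (1 + \<kappa> S n)) \<and> \<kappa> S n \<ge> 0) \<and>
      (\<lambda>n. real n * \<kappa> S n) \<longlonglongrightarrow> (t - s)\<^sup>2 * tilted_information S / lam S"
    by (rule bchoice) (intro ballI each)
  then obtain \<kappa>S where \<kappa>S: "\<And>S n. S \<in> SS \<Longrightarrow> chi2_le (QS n s S) (QS n t S) (ennreal (1 + \<kappa>S S n))"
      "\<And>S n. S \<in> SS \<Longrightarrow> \<kappa>S S n \<ge> 0"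
    and \<kappa>S_lim: "\<And>S. S \<in> SS \<Longrightarrow> (\<lambda>n. real n * \<kappa>S S n) \<longlonglongrightarrow> (t - s)\<^sup>2 * tilted_information S / lam S"
    by blast
  define C where "C n = exp (real n * \<kappa> n + (\<Sum>S\<in>SS. real (N S n) * \<kappa>S S n))" for n
  have pow: "ennreal (1 + q) ^ m \<le> ennreal (exp (real m * q))" if "q \<ge> 0" for q m
  proof -
    have "(1 + q) ^ m \<le> exp q ^ m" using that by (intro power_mono) auto
    also have "\<dots> = exp (real m * q)" by (simp add: exp_of_nat_mult)
    finally show ?thesis using that by (subst ennreal_power) auto
  qed
  have "chi2_le (Q n s) (Q n t) (ennreal (C n))" for n
  proof -
    have 1: "chi2_le (PiM {1..n} (\<lambda>_. law {1..d} (local_density d f \<phi> n s)))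
        (PiM {1..n} (\<lambda>_. law {1..d} (local_density d f \<phi> n t)))
        (ennreal (exp (real n * \<kappa> n)))"
      by (rule chi2_le_mono[OF chi2_le_iid[OF X_prob[OF phi_sq] X_prob[OF phi_sq] \<kappa>(1)]
          pow[OF \<kappa>(2)]])
    have 2: "chi2_le (PiM SS (\<lambda>S. PiM {1..N S n} (\<lambda>_. QS n s S)))
        (PiM SS (\<lambda>S. PiM {1..N S n} (\<lambda>_. QS n t S)))
        (\<Prod>S\<in>SS. ennreal (exp (real (N S n) * \<kappa>S S n)))"
      by (intro chi2_le_PiM finite_SS prob_space_PiM QS_prob
        chi2_le_mono[OF chi2_le_iid[OF QS_prob QS_prob \<kappa>S(1)] pow[OF \<kappa>S(2)]])
    have "chi2_le (Q n s) (Q n t) (ennreal (exp (real n * \<kappa> n))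
        * (\<Prod>S\<in>SS. ennreal (exp (real (N S n) * \<kappa>S S n))))"
      unfolding Q_eq by (intro chi2_le_pair 1 2 prob_space_PiM QS_prob)
    also have "(ennreal (exp (real n * \<kappa> n)) * (\<Prod>S\<in>SS. ennreal (exp (real (N S n) * \<kappa>S S n))))
        = ennreal (C n)"
      unfolding C_def exp_add exp_sum[OF finite_SS] by (simp add: ennreal_mult' prod_ennreal)
    finally show ?thesis .
  qed
  moreover have "C \<longlonglongrightarrow> exp ((t - s)\<^sup>2 * ls.mean_loss \<alpha>)"
  proof -
    have "(\<lambda>n. real (N S n) * \<kappa>S S n) \<longlonglongrightarrow> (t - s)\<^sup>2 * tilted_information S" if S: "S \<in> SS" for S
    proof -
      have "(\<lambda>n. real (N S n) / real n * (real n * \<kappa>S S n))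
          \<longlonglongrightarrow> lam S * ((t - s)\<^sup>2 * tilted_information S / lam S)"
        by (intro tendsto_mult N \<kappa>S_lim S)
      then have "(\<lambda>n. real (N S n) * \<kappa>S S n) \<longlonglongrightarrow> lam S * ((t - s)\<^sup>2 * tilted_information S / lam S)"
      proof (rule Lim_transform_eventually)
        show "\<forall>\<^sub>F n in sequentially. real (N S n) / real n * (real n * \<kappa>S S n)
            = real (N S n) * \<kappa>S S n"
          using eventually_gt_at_top[of 0] by eventually_elim simp
      qed
      then show ?thesis using lam[OF S] by simp
    qed
    then have "C \<longlonglongrightarrow> exp ((t - s)\<^sup>2 * (\<integral>x. (\<phi> x)\<^sup>2 \<partial>P) + (\<Sum>S\<in>SS. (t - s)\<^sup>2 * tilted_information S))"
      unfolding C_def[abs_def] by (intro tendsto_exp tendsto_add tendsto_sum \<kappa>_lim)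
    also have "(t - s)\<^sup>2 * (\<integral>x. (\<phi> x)\<^sup>2 \<partial>P) + (\<Sum>S\<in>SS. (t - s)\<^sup>2 * tilted_information S)
        = (t - s)\<^sup>2 * ls.mean_loss \<alpha>"
      unfolding information[symmetric] by (simp add: algebra_simps sum_distrib_left)
    finally show ?thesis .
  qed
  ultimately show ?thesis by blast
qed

text \<open>Walk along the grid \<open>j \<delta>\<close>, \<open>j \<le> m\<close>. For large \<open>n\<close> the rescaled target moves by nearly \<open>\<delta> L\<close> in
  one step and the bound on the movement of the mean is nearly \<open>sqrt (M (exp (\<delta>\<^sup>2 L) - 1))\<close>, with
  \<open>L\<close> the minimal value of the objective. The gap between the two is \<open>2 e\<close>, so that \<open>e\<close> is
  available for all large \<open>n\<close>, and \<open>m\<close> is chosen to contradict \<open>bias_walk\<close> if all risks on the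
  grid were at most \<open>M\<close>.\<close>

lemma risk_lower_bound_along_path:
  assumes est: "\<And>n. n \<ge> 1 \<Longrightarrow> est n \<in> borel_measurable (data_space d SS n (\<lambda>S. N S n))"
    and M: "0 < M" "M < ls.mean_loss \<alpha>"
  shows "\<exists>I J. finite I \<and> I \<noteq> {} \<and> finite J \<and> J \<noteq> {} \<and> J \<subseteq> vec_families SS k \<and>
     ennreal M \<le> liminf
         (\<lambda>n. Max ((\<lambda>(t, v). local_risk d f SS k Psi w N a (influence d f SS a \<alpha>) est n t v) `
         (I \<times> J)))"
proof -
  obtain \<delta> where \<delta>: "0 < \<delta>" "sqrt (M * (exp (\<delta>\<^sup>2 * ls.mean_loss \<alpha>) - 1)) < \<delta> * ls.mean_loss \<alpha>"
    by (rule step_size[OF M])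
  define e where "e = (\<delta> * ls.mean_loss \<alpha> - sqrt (M * (exp (\<delta>\<^sup>2 * ls.mean_loss \<alpha>) - 1))) / 2"
  have e: "0 < e" using \<delta>(2) by (simp add: e_def)
  obtain m where m: "2 * sqrt M < real m * e" using reals_Archimedean3[OF e] by blast
  define t where "t j = real j * \<delta>" for j
  define I where "I = t ` {..m}"
  define \<theta> where "\<theta> n j = sqrt (real n) * (theta d a (local_density d f \<phi> n (t j)) - th)" for n j
  have "\<exists>C. (\<forall>n. chi2_le (Q n (t j)) (Q n (t (Suc j))) (ennreal (C n))) \<and> C
      \<longlonglongrightarrow> exp (\<delta>\<^sup>2 * ls.mean_loss \<alpha>)" for j
    using data_chi2[of "t j" "t (Suc j)"] by (simp add: t_def algebra_simps)
  then obtain C where C: "\<And>j n. chi2_le (Q n (t j)) (Q n (t (Suc j))) (ennreal (C j n))"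
    and C_lim: "\<And>j. C j \<longlonglongrightarrow> exp (\<delta>\<^sup>2 * ls.mean_loss \<alpha>)" by metis
  have "\<forall>\<^sub>F n in sequentially. sqrt (M * (C j n - 1)) + e \<le> \<theta> n (Suc j) - \<theta> n j" for j
  proof -
    have \<theta>: "(\<lambda>n. \<theta> n j) \<longlonglongrightarrow> t j * ls.mean_loss \<alpha>" for j
      unfolding \<theta>_def derivative[symmetric]
      by (rule theta_limit) (use a phi_sq a_sq phi_mean in \<open>auto simp: sq_integrable_def
          measurable_cong_sets[OF P_sets refl]\<close>)
    have "(\<lambda>n. (\<theta> n (Suc j) - \<theta> n j) - sqrt (M * (C j n - 1)))
        \<longlonglongrightarrow> (t (Suc j) * ls.mean_loss \<alpha> - t j * ls.mean_loss \<alpha>) - sqrt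
            (M * (exp (\<delta>\<^sup>2 * ls.mean_loss \<alpha>) - 1))"
      by (intro tendsto_intros \<theta> C_lim)
    moreover have "(t (Suc j) * ls.mean_loss \<alpha> - t j * ls.mean_loss \<alpha>)
        - sqrt (M * (exp (\<delta>\<^sup>2 * ls.mean_loss \<alpha>) - 1)) = 2 * e"
      by (simp add: e_def t_def algebra_simps)
    ultimately have "\<forall>\<^sub>F n in sequentially. e < (\<theta> n (Suc j) - \<theta> n j) - sqrt (M * (C j n - 1))"
      using e by (intro order_tendstoD(1)) auto
    then show ?thesis by eventually_elim linarith
  qed
  then have ev: "\<forall>\<^sub>F n in sequentially. \<forall>j\<in>{..<m}. sqrt (M * (C j n - 1)) + e \<le> \<theta> n (Suc j) - \<theta> n j"
    by (intro eventually_ball_finite) auto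
  let ?r = "\<lambda>n (t, v). local_risk d f SS k Psi w N a \<phi> est n t v"
  have "\<forall>\<^sub>F n in sequentially. ennreal M \<le> Max (?r n ` (I \<times> vpath ` I))"
    using ev eventually_ge_at_top[of 1]
  proof eventually_elim
    case (elim n)
    show ?case
    proof (rule ccontr)
      assume "\<not> ?thesis"
      then have lt: "Max (?r n ` (I \<times> vpath ` I)) \<le> ennreal M" by simp
      have risk: "local_risk d f SS k Psi w N a \<phi> est n (t j) (vpath (t j)) \<le> ennreal M" if "j
          \<le> m" for j
      proof (rule order_trans[OF Max_ge lt])
        show "local_risk d f SS k Psi w N a \<phi> est n (t j) (vpath (t j)) \<in> ?r n ` (I \<times> vpath ` I)"
          using that by (intro image_eqI[of _ _ "(t j, vpath (t j))"]) (auto simp: I_def)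
      qed (simp add: I_def)
      (* rescaled and centred, so that its squared error is that of the local risk *)
      let ?T = "\<lambda>z. sqrt (real n) * (est n z - th)"
      have "real m * e \<le> 2 * sqrt M"
      proof (rule bias_walk[where T = ?T and D = "\<lambda>j. Q n (t j)" and \<theta> = "\<theta> n" and C = "\<lambda>j. C j n"])
        have "est n \<in> borel_measurable (data_space d SS n (\<lambda>S. N S n))" using est elim(2) by simp
        then show "?T \<in> borel_measurable (Q n (t j))" for j
          unfolding measurable_cong_sets[OF Q_sets refl] by simp
        show "(\<integral>\<^sup>+ z. ennreal ((?T z - \<theta> n j)\<^sup>2) \<partial>Q n (t j)) \<le> ennreal M" if "j \<le> m" for j
        proof -
          have "(?T z - \<theta> n j)\<^sup>2
              = real n * (est n z - theta d a (local_density d f \<phi> n (t j)))\<^sup>2" for z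
            unfolding \<theta>_def right_diff_distrib[symmetric] power_mult_distrib by simp
          then show ?thesis using risk[OF that] by (simp add: local_risk_def)
        qed
      qed (use Q_prob C M elim in auto)
      then show False using m by simp
    qed
  qed
  then have low: "ennreal M \<le> liminf (\<lambda>n. Max (?r n ` (I \<times> vpath ` I)))" by (rule Liminf_bounded)
  show ?thesis
    by (rule exI[of _ I], rule exI[of _ "vpath ` I"], intro conjI low[unfolded \<phi>_def])
        (auto simp: I_def vpath)
qed

end

lemma risk_lower_bound:
  assumes "\<And>n. n \<ge> 1 \<Longrightarrow> est n \<in> borel_measurable (data_space d SS n (\<lambda>S. N S n))"
    and "0 < M" "M < ls.mean_loss \<alpha>"
  shows "\<exists>I J. finite I \<and> I \<noteq> {} \<and> finite J \<and> J \<noteq> {} \<and> J \<subseteq> vec_families SS k \<and>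
     ennreal M \<le> liminf (\<lambda>n. Max ((\<lambda>(t, v).
       local_risk d f SS k Psi w N a (influence d f SS a \<alpha>) est n t v) ` (I \<times> J)))"
proof -
  obtain u where "\<And>S. S \<in> SS \<Longrightarrow> least_favourable S (u S)"
    using least_favourable_direction by metis
  from risk_lower_bound_along_path[OF this assms] show ?thesis by blast
qed

end

end

theorem theorem19:
  fixes d :: nat
    and f a :: "(nat \<Rightarrow> real) \<Rightarrow> real"
    and SS :: "nat set set"
    and k :: "nat set \<Rightarrow> nat"
    and Psi :: "nat set \<Rightarrow> nat \<Rightarrow> (nat \<Rightarrow> real) \<Rightarrow> real"
    and w :: "nat set \<Rightarrow> nat \<Rightarrow> real"
    and N :: "nat set \<Rightarrow> nat \<Rightarrow> nat"
    and lam :: "nat set \<Rightarrow> real"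
  assumes "d \<ge> 2"
    and "prob_density (Rspace {1..d}) f"
    and "SS \<subseteq> Pow {1..d} - {{1..d}}"
    and "\<And>S j. S \<in> SS \<Longrightarrow> j \<in> {1..k S} \<Longrightarrow> Psi S j \<in> borel_measurable (Rspace S)"
    and "\<And>S j. S \<in> SS \<Longrightarrow> j \<in> {1..k S} \<Longrightarrow> bounded (Psi S j ` space (Rspace S))"
    and "\<And>S u. S \<in> SS \<Longrightarrow> u \<in> vecs (k S) \<Longrightarrow> (\<exists>j\<in>{1..k S}. u j \<noteq> 0) \<Longrightarrow>
           \<not> lin_comb (k S) u (Psi S) constant_on space (Rspace S)"
    and "w \<in> vec_families SS k"
    and "a \<in> borel_measurable (Rspace {1..d})"
    and "integrable (Rspace {1..d}) (\<lambda>x. (a x)\<^sup>2 * f x)"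
    and "\<And>S n. S \<in> SS \<Longrightarrow> n \<ge> 1 \<Longrightarrow> N S n \<ge> 1"
    and "\<And>S. S \<in> SS \<Longrightarrow> lam S > 0"
    and "\<And>S. S \<in> SS \<Longrightarrow> (\<lambda>n. real (N S n) / real n) \<longlonglongrightarrow> lam S"
  shows "(\<exists>\<alpha>. minimiser d f SS k Psi w lam a \<alpha>) \<and>
    (\<forall>\<alpha> \<beta>. minimiser d f SS k Psi w lam a \<alpha> \<longrightarrow> minimiser d f SS k Psi w lam a \<beta> \<longrightarrow>
       (\<forall>S\<in>SS. AE x in law {1..d} f. \<alpha> S x = \<beta> S x)) \<and>
    (\<forall>\<alpha> (est :: nat \<Rightarrow> obs \<Rightarrow> real).
       minimiser d f SS k Psi w lam a \<alpha> \<longrightarrow>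
       (\<forall>n\<ge>1. est n \<in> borel_measurable (data_space d SS n (\<lambda>S. N S n))) \<longrightarrow>
       (SUP (I, J) \<in> {(I, J). finite I \<and> I \<noteq> {} \<and> finite J \<and> J \<noteq> {} \<and> J \<subseteq> vec_families SS k}.
          liminf (\<lambda>n. Max ((\<lambda>(t, v). local_risk d f SS k Psi w N a (influence d f SS a \<alpha>) est n t v)
                             ` (I \<times> J))))
       \<ge> ennreal (INF \<beta> \<in> H_perp_prod d f SS k Psi. objective d f SS k Psi w lam a \<beta>))"
    (is "_ \<and> _ \<and> (\<forall>\<alpha> est. _ \<longrightarrow> _ \<longrightarrow> ?sup \<alpha> est \<ge> _)")
proof -
  interpret study d f a SS k Psi w N lam
    using assms by unfold_locales auto
  have "\<exists>\<alpha>. minimiser d f SS k Psi w lam a \<alpha>"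
    unfolding minimiser_iff using ls.minimiser_exists by blast
  moreover have "\<forall>S\<in>SS. AE x in law {1..d} f. \<alpha> S x = \<beta> S x"
    if "minimiser d f SS k Psi w lam a \<alpha>" "minimiser d f SS k Psi w lam a \<beta>" for \<alpha> \<beta>
    using that ls.minimiser_unique unfolding minimiser_iff by blast
  moreover have "?sup \<alpha> est \<ge> ennreal (INF \<beta>
      \<in> H_perp_prod d f SS k Psi. objective d f SS k Psi w lam a \<beta>)"
    if min: "minimiser d f SS k Psi w lam a \<alpha>"
      and est: "\<forall>n\<ge>1. est n \<in> borel_measurable (data_space d SS n (\<lambda>S. N S n))" for \<alpha>
          and est :: "nat \<Rightarrow> obs \<Rightarrow> real"
  proof -
    have \<alpha>: "\<alpha> \<in> ls.family" and le: "\<And>\<beta>. \<beta> \<in> ls.family \<Longrightarrow> ls.mean_loss \<alpha> \<le> ls.mean_loss \<beta>"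
      using min by (auto simp: minimiser_iff)
    have inf: "(INF \<beta> \<in> H_perp_prod d f SS k Psi. objective d f SS k Psi w lam a \<beta>)
        = ls.mean_loss \<alpha>"
    proof -
      have "(INF \<beta> \<in> H_perp_prod d f SS k Psi. objective d f SS k Psi w lam a \<beta>)
          = Inf (ls.mean_loss ` ls.family)"
        unfolding family_eq by (intro arg_cong[where f = Inf] image_cong refl objective_eq)
      also have "\<dots> = ls.mean_loss \<alpha>" by (rule cInf_eq_minimum) (use \<alpha> le in auto)
      finally show ?thesis .
    qed
    show ?thesis unfolding inf
      (* a step size exists only for levels strictly below the minimum *)
    proof (rule dense_le)
      fix y :: ennreal assume y: "y < ennreal (ls.mean_loss \<alpha>)"
      then obtain M where M: "y = ennreal M" "0 \<le> M" by (cases y) auto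
      show "y \<le> ?sup \<alpha> est"
      proof (cases "M = 0")
        case False
        then have "0 < M" "M < ls.mean_loss \<alpha>" using y M by (auto simp: ennreal_less_iff)
        have "\<exists>I J. finite I \<and> I \<noteq> {} \<and> finite J \<and> J \<noteq> {} \<and> J \<subseteq> vec_families SS k \<and>
          ennreal M \<le> liminf
              (\<lambda>n. Max ((\<lambda>(t, v). local_risk d f SS k Psi w N a (influence d f SS a \<alpha>) est n t v)
              ` (I \<times> J)))"
          by (rule risk_lower_bound) (use \<alpha> le est \<open>0 < M\<close> \<open>M < ls.mean_loss \<alpha>\<close> in auto)
        then obtain I J where IJ: "(I, J) \<in> {(I, J). finite I \<and> I \<noteq> {} \<and> finite J \<and> J \<noteq> {}
            \<and> J \<subseteq> vec_families SS k}"
          and low: "ennreal M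
              \<le> liminf (\<lambda>n. Max
              ((\<lambda>(t, v). local_risk d f SS k Psi w N a (influence d f SS a \<alpha>) est n t v) `
              (I \<times> J)))"
          by blast
        show ?thesis unfolding M(1) by (rule SUP_upper2[OF IJ]) (use low in simp)
      qed (simp add: M)
    qed
  qed
  ultimately show ?thesis by blast
qed

end
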